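(* For a given $A>0$ it is possible to modify Schmidt's algorithm so that it outputs an absolutely normal number $\xi$, depending on $A$, with discrepancy $D_N(\{r^n\xi\})=O_r\!\left(\frac{\log\log N}{(\log N)^A}\right)$ to base $r$, where the implied constant depends on $r$. Namely, let $0<c<1$ be given by $A=\frac{1-c}{c}$, and in Schmidt's algorithm (described in the context, with the data of its setup) replace the symbol $\langle m\rangle$ by $\langle m\rangle=\lfloor e^{m^c}\rfloor$, modifying $\langle m;x\rangle$, $a_m$, $b_m$ and the sets $\sigma_m$ accordingly. Then the output $\xi=\xi_c=\lim_{m\to\infty}\xi_m$ is absolutely normal and, for every integer base $r\ge2$, $$D_N(\{r^n\xi\}_{n\ge0})\ll\frac{\log\log N}{(\log N)^A},\qquad 0<A=\frac{1-c}{c}<\infty,$$ with an implied constant depending on $r$.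
   Context: Notation. $\log$ is the natural logarithm, $e(x)=\exp(2\pi i x)$, $\lfloor x\rfloor$ and $\{x\}$ are the integer and fractional part. Two integers $r,s\ge2$ are multiplicatively dependent, $r\sim s$, when they are rational powers of each other; $r\not\sim s$ is the negation. The discrepancy of a real sequence $(x_n)_{n\ge1}$ is $D_N(x_n)=\sup_{I}\left|\frac{\#\{1\le n\le N: x_n \bmod 1\in I\}}{N}-|I|\right|$, the supremum being over all subintervals $I\subset[0,1)$. A real number is absolutely normal if it is normal to every integer base $\ge2$. $f\ll g$ (equivalently $f=O(g)$) means $f(N)\le Cg(N)$ for some constant $C>0$ and all sufficiently large $N$; a subscript in $O_r$ indicates dependence on $r$. Constants $a_{20}(r,s)$. For integers $r,s>1$ with $r\not\sim s$, $a_{20}=a_{20}(r,s)$ is a positive constant depending only on $r$ and $s$ such that $\sum_{n=0}^{N-1}\prod_{k=K+1}^{\infty}|\cos(\pi r^n l/s^k)|\le 2N^{1-a_{20}}$ for positive integers $K,l$ with $l\ge s^K$ (a result of Schmidt). Setup. Let $R=(r_i)_{i\ge1}=\mathbb{N}_{\ge2}$ (in increasing order) and let $S=(s_j)_{j\ge1}$ be a sequence of integers $s>2$ such that $s_m\le m s_1$ and such that for each $r\in R$ there is an index $m_0(r)$ with $r\not\sim s_m$ for all $m\ge m_0(r)$. Let $\beta_{i,j}=a_{20}(r_i,s_j)$ and $\beta_k=\min_{1\le i,j\le k}\beta_{i,j}$, where one can assume $\beta_k<\tfrac12$, and let $\gamma_k=\max(r_1,\dots,r_k,s_1,\dots,s_k)$.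 The sequences are assumed to satisfy $\beta_k\ge\beta_1/k^{1/4}$ and $\gamma_k\le\gamma_1k$, which is achieved by repeating their values: set $\phi(1)=1$, let $\phi(k)$ be the largest integer $\phi$ such that $\phi\le\phi(k-1)+1$, $\beta_\phi\ge\beta_1/k^{1/4}$ and $\gamma_\phi\le\gamma_1k$, and replace the sequences by $r_i'=r_{\phi(i)}$, $s_i'=s_{\phi(i)}$. Below, $r_i,s_i$ denote the sequences after this modification. Symbols. In Schmidt's original algorithm $\langle m\rangle=\lfloor e^{\sqrt m}+2s_1m^3\rfloor$ for a positive integer $m$. Further $\langle m;x\rangle=\lfloor\langle m\rangle/\log x\rfloor$ for $x>1$, $a_m=\langle m;s_m\rangle$, $b_m=\langle m+1;s_m\rangle$. Algorithm. Step $0$: put $\xi_0=0$. Step $m\ge1$: given $\xi_{m-1}$, let $\eta_m(\xi_{m-1})$ be the smallest of the numbers $g s_m^{-a_m}$, $g$ an integer, that satisfy $\xi_{m-1}\le g s_m^{-a_m}$. Let $\sigma_m(\xi_{m-1})$ be the set of all numbers $\eta_m(\xi_{m-1})+d_{a_m+1}s_m^{-a_m-1}+\dots+d_{b_m-2}s_m^{-b_m+2}$ where the digits $d_k$ are $0$ or $1$. Let $\xi_m$ be the smallest of the numbers $x$ in $\sigma_m(\xi_{m-1})$ that minimize $$A_m'(x)=\sum_{\substack{t=-m\\t\ne0}}^{m}\ \sum_{\substack{i\le m\\ m_0(r_i)\le m}}\left|\sum_{j=\langle m;r_i\rangle+1}^{\langle m+1;r_i\rangle}e(r_i^jtx)\right|^2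 .$$ The output is $\xi=\lim_{m\to\infty}\xi_m$. *)

theory Defs
  imports "HOL-Analysis.Analysis" "HOL-Library.Landau_Symbols"
begin

text \<open>
  The real sequence in \<open>discrepancy\<close> and the sequences of bases below are functions on \<^typ>\<open>nat\<close>
  of which only the values at indices at least 1 are used.
\<close>

definition discrepancy :: "nat \<Rightarrow> (nat \<Rightarrow> real) \<Rightarrow> real" where
  "discrepancy N x =
     (SUP I\<in>{I. is_interval I \<and> I \<subseteq> {0..<1}}.
        \<bar>real (card {n\<in>{1..N}. frac (x n) \<in> I}) / real N - measure lborel I\<bar>)"

text \<open>The \<open>n\<close>-th digit (\<open>n \<ge> 1\<close>) after the point in the base \<open>b\<close> expansion.\<close>

definition digit :: "nat \<Rightarrow> real \<Rightarrow> nat \<Rightarrow> int" where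
  "digit b x n = \<lfloor>real b ^ n * x\<rfloor> mod int b"

definition normal_to_base :: "nat \<Rightarrow> real \<Rightarrow> bool" where
  "normal_to_base b x \<longleftrightarrow>
     (\<forall>w :: nat list. set w \<subseteq> {..<b} \<longrightarrow>
        (\<lambda>N. real (card {n\<in>{1..N}. \<forall>i<length w. digit b x (n + i) = int (w ! i)}) / real N)
          \<longlonglongrightarrow> 1 / real b ^ length w)"

definition absolutely_normal :: "real \<Rightarrow> bool" where
  "absolutely_normal x \<longleftrightarrow> (\<forall>b\<ge>2. normal_to_base b x)"

definition mult_dependent :: "nat \<Rightarrow> nat \<Rightarrow> bool" where
  "mult_dependent r s \<longleftrightarrow>
     (\<exists>p\<in>\<rat>. real r = real s powr p) \<and> (\<exists>q\<in>\<rat>. real s = real r powr q)"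

text \<open>
  \<open>a r s\<close> plays the role of $a_{20}(r,s)$. For multiplicatively dependent \<open>r\<close>, \<open>s\<close> the constant
  is not determined by Schmidt's estimate, but it formally enters the minimum \<open>beta\<close> below;
  there it may be any positive number. The infinite product is shifted to start at index 0.
\<close>

definition schmidt_constants :: "(nat \<Rightarrow> nat \<Rightarrow> real) \<Rightarrow> bool" where
  "schmidt_constants a \<longleftrightarrow>
     (\<forall>r>1. \<forall>s>1. a r s > 0 \<and>
        (\<not> mult_dependent r s \<longrightarrow>
          (\<forall>K\<ge>1. \<forall>l\<ge>s ^ K. \<forall>N\<ge>1.
             (\<Sum>n<N. \<Prod>k. \<bar>cos (pi * real r ^ n * real l / real s ^ (K + 1 + k))\<bar>)
               \<le> 2 * real N powr (1 - a r s))))"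

definition all_bases :: "nat \<Rightarrow> nat" where
  "all_bases i = i + 1"

definition beta :: "(nat \<Rightarrow> nat \<Rightarrow> real) \<Rightarrow> (nat \<Rightarrow> nat) \<Rightarrow> (nat \<Rightarrow> nat) \<Rightarrow> nat \<Rightarrow> real" where
  "beta a r s k = Min ((\<lambda>(i, j). a (r i) (s j)) ` ({1..k} \<times> {1..k}))"

definition gamma :: "(nat \<Rightarrow> nat) \<Rightarrow> (nat \<Rightarrow> nat) \<Rightarrow> nat \<Rightarrow> nat" where
  "gamma r s k = Max (r ` {1..k} \<union> s ` {1..k})"

fun phi :: "(nat \<Rightarrow> nat \<Rightarrow> real) \<Rightarrow> (nat \<Rightarrow> nat) \<Rightarrow> (nat \<Rightarrow> nat) \<Rightarrow> nat \<Rightarrow> nat" where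
  "phi a r s 0 = 0"
| "phi a r s (Suc 0) = 1"
| "phi a r s (Suc (Suc k)) =
     (GREATEST p. 1 \<le> p \<and> p \<le> phi a r s (Suc k) + 1 \<and>
        beta a r s p \<ge> beta a r s 1 / real (k + 2) powr (1 / 4) \<and>
        gamma r s p \<le> gamma r s 1 * (k + 2))"

text \<open>
  \<open>br\<close> is the symbol $\langle m\rangle$, \<open>br2 br m x\<close> is $\langle m; x\rangle$,
  and \<open>m0\<close> is the function $r \mapsto m_0(r)$.
\<close>

definition br2 :: "(nat \<Rightarrow> nat) \<Rightarrow> nat \<Rightarrow> real \<Rightarrow> nat" where
  "br2 br m x = nat \<lfloor>real (br m) / ln x\<rfloor>"

definition e :: "real \<Rightarrow> complex" where
  "e x = exp (2 * of_real pi * \<i> * of_real x)"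

definition eta :: "(nat \<Rightarrow> nat) \<Rightarrow> (nat \<Rightarrow> nat) \<Rightarrow> nat \<Rightarrow> real \<Rightarrow> real" where
  "eta br s m x =
     (LEAST y. \<exists>g::int. y = of_int g / real (s m) ^ br2 br m (s m) \<and> x \<le> y)"

definition sigma :: "(nat \<Rightarrow> nat) \<Rightarrow> (nat \<Rightarrow> nat) \<Rightarrow> nat \<Rightarrow> real \<Rightarrow> real set" where
  "sigma br s m x =
     {eta br s m x +
        (\<Sum>k = br2 br m (s m) + 1..br2 br (m + 1) (s m) - 2. real (d k) / real (s m) ^ k)
      | d :: nat \<Rightarrow> nat. \<forall>k. d k \<in> {0, 1}}"

definition A' :: "(nat \<Rightarrow> nat) \<Rightarrow> (nat \<Rightarrow> nat) \<Rightarrow> (nat \<Rightarrow> nat) \<Rightarrow> nat \<Rightarrow> real \<Rightarrow> real" where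
  "A' br r m0 m x =
     (\<Sum>t\<in>{- int m..int m} - {0}. \<Sum>i\<in>{i\<in>{1..m}. m0 (r i) \<le> m}.
        (cmod (\<Sum>j = br2 br m (r i) + 1..br2 br (m + 1) (r i).
           e (real (r i) ^ j * of_int t * x)))\<^sup>2)"

primrec xi :: "(nat \<Rightarrow> nat) \<Rightarrow> (nat \<Rightarrow> nat) \<Rightarrow> (nat \<Rightarrow> nat) \<Rightarrow> (nat \<Rightarrow> nat) \<Rightarrow> nat \<Rightarrow> real" where
  "xi br r s m0 0 = 0"
| "xi br r s m0 (Suc m) =
     (LEAST x. is_arg_min (A' br r m0 (Suc m))
                 (\<lambda>x. x \<in> sigma br s (Suc m) (xi br r s m0 m)) x)"

definition exp_bracket :: "real \<Rightarrow> nat \<Rightarrow> nat" where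
  "exp_bracket c m = nat \<lfloor>exp (real m powr c)\<rfloor>"

end

theory Submission
  imports Defs "HOL-Real_Asymp.Real_Asymp" "Jordan_Normal_Form.Determinant"
begin

text \<open>
  Stage \<open>m\<close> of the algorithm fixes, in base \<open>s m\<close>, the digits (0 or 1) at the places between
  $\langle m\rangle/\log s_m$ and $\langle m+1\rangle/\log s_m$, so that \<open>A'\<close>, a sum of squared
  exponential sums over the corresponding blocks of exponents, becomes minimal. A minimum is at most
  the mean over all choices of the digits, and in the mean a pair of exponents \<open>i\<close>, \<open>j\<close> of the base
  \<open>r\<close> contributes the product of $|\cos(\pi(r^i-r^j)t/s^k)|$ over the free places \<open>k\<close>
  (\<open>cantor_mean_square\<close>, \<open>A'_xi_le\<close>). The heart of the matter is that the sum of these products over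
  all pairs is smaller than the square of the block length by an arbitrary power of \<open>m\<close>, although a
  block has only about $e^{m^c}$ exponents, with \<open>c\<close> as small as one likes, and although \<open>r\<close> and \<open>s\<close>
  may be as large as a constant times \<open>m\<close>.

  For this only the \<open>D\<close> leading digits of $r^i\theta$ in base \<open>s\<close> are used, where
  $\theta=|t|(1-r^{-(i-j)})$ and \<open>D\<close> is a multiple of $\log m$. They are determined by the fractional
  part of $\log_s(r^i\theta)$, hence by the rotation of the circle by $\log r/\log s$. Averaged over all
  strings of digits the product of \<open>D\<close> cosines is at most $2^{-D/2}$ (\<open>sum_cos_prod_le\<close>), a power of
  \<open>m\<close>; and the rotation visits all strings about equally often, as soon as $\log r/\log s$ has a good
  rational approximation \<open>p/q\<close> with \<open>q\<close> larger than the number of strings but smaller than the block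
  length (\<open>top_cos_run\<close>). Dirichlet's theorem supplies \<open>p/q\<close>, and \<open>q\<close> cannot be too small, because
  $|q\log r-p\log s|$ is at least $e^{-h^{13}}$ for multiplicatively independent \<open>r\<close>, \<open>s\<close>, where
  $h=\log m+O(1)$ (\<open>linear_form_in_two_logarithms\<close>). The numbers $\exp((\log m)^{\kappa})$ that arise in this way are
  negligible against $e^{m^c}$ for every \<open>c > 0\<close>.

  The lower bound for linear forms is proved by the method of Gelfond and Schneider: if the form were
  very small, $r^xs^y$ would nearly be an exponential function of the integer $px+qy$, and a nonzero
  polynomial with integer coefficients, chosen by the box principle, would have values of modulus less
  than 1 at so many points $(px+qy,\,r^xs^y)$ that it vanishes identically (\<open>zero_estimate\<close>).

  The rest is the passage from exponential sums to discrepancy. An inequality of Erdos-Turan type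
  (\<open>discrepancy_exp_sum_bound\<close>) with frequencies up to \<open>m\<close> gives a discrepancy of order $\log m/m$ in
  the block of stage \<open>m\<close>, which is less than $m^{c-1}$, the length of the block relative to its position.
  The incomplete block at the end of an initial segment of length \<open>N\<close> therefore decides: its relative
  length $m^{c-1}$ is of order $(\log N)^{-A}$, as $\log N$ is of order $m^c$ and $A=(1-c)/c$.
\<close>

section \<open>A zero estimate\<close>

lemma coeff_mult_top:
  fixes f g :: "'a :: comm_semiring_0 poly"
  assumes "degree f \<le> a" "degree g \<le> b"
  shows "coeff (f * g) (a + b) = coeff f a * coeff g b"
proof -
  have "coeff (f * g) (a + b) = (\<Sum>i\<le>a + b. coeff f i * coeff g (a + b - i))"
    by (simp add: coeff_mult)
  also have "\<dots> = (\<Sum>i\<in>{a}. coeff f i * coeff g (a + b - i))"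
  proof (rule sum.mono_neutral_right, goal_cases)
    case 3
    show ?case
    proof
      fix i assume "i \<in> {..a + b} - {a}"
      then consider "i < a" | "i > a" by fastforce
      then show "coeff f i * coeff g (a + b - i) = 0"
        by cases (use assms in \<open>auto simp: coeff_eq_0\<close>)
    qed
  qed auto
  finally show ?thesis by simp
qed

lemma coeff_prod_top:
  fixes f :: "'b \<Rightarrow> 'a :: comm_semiring_1 poly"
  assumes "finite S" "\<And>i. i \<in> S \<Longrightarrow> degree (f i) \<le> d i"
  shows "degree (prod f S) \<le> sum d S" "coeff (prod f S) (sum d S) = (\<Prod>i\<in>S. coeff (f i) (d i))"
proof -
  have "degree (prod f S) \<le> sum d S \<and> coeff (prod f S) (sum d S) = (\<Prod>i\<in>S. coeff (f i) (d i))"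
    using assms
  proof (induction S rule: finite_induct)
    case (insert x S)
    have 1: "degree (f x) \<le> d x" "degree (prod f S) \<le> sum d S"
      "coeff (prod f S) (sum d S) = (\<Prod>i\<in>S. coeff (f i) (d i))"
      using insert by auto
    have "degree (f x * prod f S) \<le> d x + sum d S"
      using 1 degree_mult_le[of "f x" "prod f S"] by linarith
    then show ?case
      using insert(1,2) coeff_mult_top[OF 1(1,2)] 1(3) by simp
  qed auto
  then show "degree (prod f S) \<le> sum d S"
    "coeff (prod f S) (sum d S) = (\<Prod>i\<in>S. coeff (f i) (d i))" by auto
qed

text \<open>
  A vector in the kernel of the transpose is the coefficient vector of a polynomial of degree less
  than \<open>n\<close> with the \<open>n\<close> zeros \<open>\<rho> j\<close>.
\<close>

lemma vandermonde_det_nonzero: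
  fixes \<rho> w :: "nat \<Rightarrow> real"
  assumes "inj_on \<rho> {..<n}" "\<And>j. j < n \<Longrightarrow> w j \<noteq> 0"
  shows "det (mat n n (\<lambda>(i, j). \<rho> j ^ i * w j)) \<noteq> 0"
proof
  define B where "B = mat n n (\<lambda>(i, j). \<rho> j ^ i * w j)"
  have B: "B \<in> carrier_mat n n" by (simp add: B_def)
  assume "det (mat n n (\<lambda>(i, j). \<rho> j ^ i * w j)) = 0"
  then have "det (transpose_mat B) = 0" using det_transpose[OF B] by (simp add: B_def)
  then obtain v where v: "v \<in> carrier_vec n" "v \<noteq> 0\<^sub>v n" "transpose_mat B *\<^sub>v v = 0\<^sub>v n"
    using det_0_iff_vec_prod_zero[of "transpose_mat B" n] B by auto
  define V where "V = (\<Sum>i<n. monom (v $ i) i)"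
  have coeffV: "coeff V i = v $ i" if "i < n" for i
    using that by (simp add: V_def coeff_sum if_distrib sum.delta cong: if_cong)
  have V0: "V \<noteq> 0"
  proof
    assume "V = 0"
    then have "v = 0\<^sub>v n" using v(1) coeffV by (intro eq_vecI) auto
    then show False using v by simp
  qed
  have "n > 0"
  proof (rule ccontr)
    assume "\<not> n > 0" then have "V = 0" by (simp add: V_def)
    then show False using V0 by simp
  qed
  have "degree V < n"
    unfolding V_def by (rule degree_sum_less) (use \<open>n > 0\<close> in \<open>auto intro: le_less_trans[OF degree_monom_le]\<close>)
  moreover have "poly V (\<rho> j) = 0" if j: "j < n" for j
  proof -
    have "0 = (transpose_mat B *\<^sub>v v) $ j" using v(3) j by simp
    also have "\<dots> = (\<Sum>i<n. \<rho> j ^ i * w j * v $ i)"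
      using j v(1) by (simp add: scalar_prod_def B_def lessThan_atLeast0)
    also have "\<dots> = w j * (\<Sum>i<n. v $ i * \<rho> j ^ i)"
      by (simp add: sum_distrib_left mult_ac)
    finally have "(\<Sum>i<n. v $ i * \<rho> j ^ i) = 0" using assms(2)[OF j] by simp
    then show ?thesis by (simp add: V_def poly_sum poly_monom)
  qed
  then have "\<rho> ` {..<n} \<subseteq> {x. poly V x = 0}" by auto
  then have "card (\<rho> ` {..<n}) \<le> card {x. poly V x = 0}"
    by (intro card_mono) (use V0 poly_roots_finite in auto)
  then have "n \<le> degree V"
    using assms(1) card_poly_roots_bound[OF V0] by (simp add: card_image)
  ultimately show False by simp
qed

lemma lattice_values_inj:
  fixes p q R :: nat
  assumes "coprime p q" "R \<le> q"
  shows "inj_on (\<lambda>(x, y). p * x + q * y) ({..<R} \<times> {..<R})"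
proof -
  have *: "x = x' \<and> y = y'" if a: "x < R" "y < R" "x' < R" "y' < R" "p * x + q * y = p * x' + q * y'"
      and le: "x' \<le> x" for x y x' y'
  proof -
    have "y \<le> y'"
    proof -
      have "p * x' \<le> p * x" using le by simp
      then have "q * y \<le> q * y'" using a(5) by linarith
      moreover have "q > 0" using a(2) assms(2) by simp
      ultimately show ?thesis by simp
    qed
    then have e: "p * (x - x') = q * (y' - y)"
      using a(5) le by (simp add: diff_mult_distrib2)
    then have "q dvd p * (x - x')" by simp
    then have "q dvd x - x'" using assms(1) by (simp add: coprime_commute coprime_dvd_mult_right_iff)
    moreover have "x - x' < q" using a(1) assms(2) by linarith
    ultimately have "x - x' = 0" by (metis dvd_imp_le gr0I leD)
    then have "x = x'" using le by simp
    then show ?thesis using a(5) assms(2) a(2) by auto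
  qed
  show ?thesis
  proof (rule inj_onI)
    fix u v assume uv: "u \<in> {..<R} \<times> {..<R}" "v \<in> {..<R} \<times> {..<R}"
      "(case u of (x, y) \<Rightarrow> p * x + q * y) = (case v of (x, y) \<Rightarrow> p * x + q * y)"
    obtain x y x' y' where "u = (x, y)" "v = (x', y')" by fastforce
    then show "u = v"
      using *[of x y x' y'] *[of x' y' x y] uv by (cases "x' \<le> x") auto
  qed
qed

text \<open>
  Group the polynomial as $\sum_l P_l(X)Y^l$. Replacing \<open>x\<close> by \<open>x + i\<close> for several \<open>i\<close> turns the
  vanishing at one point into a linear system for the powers of $Y=r^xs^y$, with the entries
  $P_l(X+pi)\,r^{il}$. Its determinant is a polynomial in \<open>X\<close> which is not zero, as its leading
  coefficient is a Vandermonde determinant with the nodes $r^l$, and which has degree less than \<open>K * L\<close>,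
  but vanishes at the $R^2$ distinct values of $px+qy$.
\<close>

lemma zero_estimate:
  fixes c :: "nat \<Rightarrow> nat \<Rightarrow> real" and p q r s K L R :: nat
  assumes r: "r \<ge> 2" and s: "s \<ge> 1" and cop: "coprime p q" and Rq: "R \<le> q" and KL: "K * L \<le> R\<^sup>2"
    and zero: "\<And>x y. x < R + L \<Longrightarrow> y < R \<Longrightarrow>
      (\<Sum>k<K. \<Sum>l<L. c k l * real (p * x + q * y) ^ k * (real r ^ x * real s ^ y) ^ l) = 0"
    and kl: "k < K" "l < L"
  shows "c k l = 0"
proof -
  define P where "P l = (\<Sum>k<K. monom (c k l) k)" for l
  have K: "K > 0" using kl by auto
  have coeffP: "coeff (P l) k = (if k < K then c k l else 0)" for k l
    by (auto simp: P_def coeff_sum if_distrib sum.delta cong: if_cong)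
  have degP: "degree (P l) \<le> K - 1" for l
    by (rule degree_le) (use K in \<open>auto simp: coeffP\<close>)
  have polyP: "poly (P l) z = (\<Sum>k<K. c k l * z ^ k)" for l z
    by (simp add: P_def poly_sum poly_monom)
  define S where "S = {l. l < L \<and> P l \<noteq> 0}"
  have finS: "finite S" by (simp add: S_def)
  have "S = {}"
  proof (rule ccontr)
    assume S: "S \<noteq> {}"
    define n where "n = card S"
    have n0: "n > 0" using S finS by (simp add: n_def card_gt_0_iff)
    have nL: "n \<le> L"
    proof -
      have "card S \<le> card {..<L}" by (intro card_mono) (auto simp: S_def)
      then show ?thesis by (simp add: n_def)
    qed
    obtain e where e: "bij_betw e {0..<n} S"
      using ex_bij_betw_nat_finite[OF finS] n_def by auto
    have eS: "e j \<in> S" if "j < n" for j using e that by (auto simp: bij_betw_def)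
    define d where "d j = degree (P (e j))" for j
    define A where "A = mat n n (\<lambda>(i, j). Polynomial.smult ((real r ^ e j) ^ i) (P (e j) \<circ>\<^sub>p [:real (p * i), 1:]))"
    have A: "A \<in> carrier_mat n n" by (simp add: A_def)
    define B where "B = mat n n (\<lambda>(i, j). (real r ^ e j) ^ i * lead_coeff (P (e j)))"
    have B: "B \<in> carrier_mat n n" by (simp add: B_def)
    have degA: "degree (A $$ (i, j)) \<le> d j" if "i < n" "j < n" for i j
      using that by (simp add: A_def d_def degree_pcompose)
    have coeffA: "coeff (A $$ (i, j)) (d j) = B $$ (i, j)" if "i < n" "j < n" for i j
    proof -
      have "lead_coeff (P (e j) \<circ>\<^sub>p [:real (p * i), 1:]) = lead_coeff (P (e j))"
        using lead_coeff_comp[of "[:real (p * i), 1:]" "P (e j)"] by simp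
      then show ?thesis using that by (simp add: A_def B_def d_def degree_pcompose)
    qed
    define D where "D = sum d {0..<n}"
    have perm: "degree (\<Prod>i = 0..<n. A $$ (i, \<pi> i)) \<le> D \<and>
        coeff (\<Prod>i = 0..<n. A $$ (i, \<pi> i)) D = (\<Prod>i = 0..<n. B $$ (i, \<pi> i))"
      if "\<pi> permutes {0..<n}" for \<pi>
    proof -
      have lt: "\<pi> i < n" if "i < n" for i
        using permutes_in_image[OF \<open>\<pi> permutes {0..<n}\<close>, of i] that by simp
      have "D = (\<Sum>i = 0..<n. d (\<pi> i))"
        unfolding D_def using sum.permute[OF that, of d] by simp
      moreover note coeff_prod_top[of "{0..<n}" "\<lambda>i. A $$ (i, \<pi> i)" "\<lambda>i. d (\<pi> i)"]
      ultimately show ?thesis using degA coeffA lt by simp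
    qed
    have sgn: "signof \<pi> = (1 :: real poly) \<and> signof \<pi> = (1 :: real) \<or>
        signof \<pi> = (-1 :: real poly) \<and> signof \<pi> = (-1 :: real)" for \<pi> :: "nat \<Rightarrow> nat"
      by (auto simp: sign_def)
    have degD: "degree (det A) \<le> D"
      unfolding det_def'[OF A]
    proof (rule degree_sum_le, goal_cases)
      case (2 \<pi>) then show ?case using perm[of \<pi>] sgn[of \<pi>] by (auto)
    qed (auto intro: finite_permutations)
    have "coeff (det A) D = det B"
      unfolding det_def'[OF A] det_def'[OF B] coeff_sum
    proof (rule sum.cong[OF refl])
      fix \<pi> assume "\<pi> \<in> {\<pi>. \<pi> permutes {0..<n}}"
      then show "coeff (signof \<pi> * (\<Prod>i = 0..<n. A $$ (i, \<pi> i))) D = signof \<pi> * (\<Prod>i = 0..<n. B $$ (i, \<pi> i))"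
        using perm[of \<pi>] sgn[of \<pi>] by auto
    qed
    moreover have "det B \<noteq> 0"
      unfolding B_def
    proof (rule vandermonde_det_nonzero)
      show "inj_on (\<lambda>j. real r ^ e j) {..<n}"
      proof (rule inj_onI)
        fix i j assume ij: "i \<in> {..<n}" "j \<in> {..<n}" "real r ^ e i = real r ^ e j"
        then have "e i = e j" using r by (simp add: power_inject_exp)
        then show "i = j" using e ij by (auto simp: bij_betw_def inj_on_def)
      qed
    qed (use eS S_def in auto)
    ultimately have D0: "det A \<noteq> 0" by auto
    have root: "poly (det A) (real (p * x + q * y)) = 0" if xy: "x < R" "y < R" for x y
    proof -
      define z where "z = real (p * x + q * y)"
      define C where "C = mat n n (\<lambda>(i, j). poly (A $$ (i, j)) z)"
      have C: "C \<in> carrier_mat n n" by (simp add: C_def)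
      define Y where "Y = real r ^ x * real s ^ y"
      have Y: "Y \<noteq> 0" using r s by (simp add: Y_def)
      define v where "v = vec n (\<lambda>j. Y ^ e j)"
      have v: "v \<in> carrier_vec n" by (simp add: v_def)
      have "v $ 0 \<noteq> 0" using n0 Y by (simp add: v_def)
      then have v0: "v \<noteq> 0\<^sub>v n" using n0 by auto
      have "C *\<^sub>v v = 0\<^sub>v n"
      proof (rule eq_vecI)
        fix i assume "i < dim_vec (0\<^sub>v n :: real vec)"
        then have i: "i < n" by simp
        have "(C *\<^sub>v v) $ i = (\<Sum>j = 0..<n. (real r ^ e j) ^ i * poly (P (e j)) (z + real (p * i)) * Y ^ e j)"
          using i by (simp add: C_def v_def scalar_prod_def A_def poly_pcompose add.commute mult_ac)
        also have "\<dots> = (\<Sum>l\<in>S. (real r ^ l) ^ i * poly (P l) (z + real (p * i)) * Y ^ l)"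
          by (rule sum.reindex_bij_betw[OF e])
        also have "\<dots> = (\<Sum>l<L. (real r ^ l) ^ i * poly (P l) (z + real (p * i)) * Y ^ l)"
          by (rule sum.mono_neutral_left) (auto simp: S_def)
        also have "\<dots> = (\<Sum>l<L. \<Sum>k<K. c k l * real (p * (x + i) + q * y) ^ k * (real r ^ (x + i) * real s ^ y) ^ l)"
          by (intro sum.cong refl)
             (simp add: polyP z_def Y_def sum_distrib_left sum_distrib_right algebra_simps power_add power_mult_distrib flip: power_mult)
        also have "\<dots> = (\<Sum>k<K. \<Sum>l<L. c k l * real (p * (x + i) + q * y) ^ k * (real r ^ (x + i) * real s ^ y) ^ l)"
          by (rule sum.swap)
        also have "\<dots> = 0" by (rule zero) (use xy i nL in auto)
        finally show "(C *\<^sub>v v) $ i = 0\<^sub>v n $ i" using i by simp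
      qed (simp add: C_def)
      then have "det C = 0" using det_0_iff_vec_prod_zero[OF C] v v0 by blast
      moreover have "poly (det A) z = det C"
        unfolding det_def'[OF A] det_def'[OF C] poly_sum
      proof (rule sum.cong[OF refl])
        fix \<pi> assume p: "\<pi> \<in> {\<pi>. \<pi> permutes {0..<n}}"
        then have "\<pi> i < n" if "i < n" for i
          using permutes_in_image[of \<pi> "{0..<n}" i] that by simp
        then have "(\<Prod>i = 0..<n. poly (A $$ (i, \<pi> i)) z) = (\<Prod>i = 0..<n. C $$ (i, \<pi> i))"
          by (intro prod.cong) (auto simp: C_def)
        then show "poly (signof \<pi> * (\<Prod>i = 0..<n. A $$ (i, \<pi> i))) z = signof \<pi> * (\<Prod>i = 0..<n. C $$ (i, \<pi> i))"
          using sgn[of \<pi>] by (auto simp: poly_prod)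
      qed
      ultimately show ?thesis by (simp add: z_def)
    qed
    define Z where "Z = (\<lambda>(x, y). real (p * x + q * y)) ` ({..<R} \<times> {..<R})"
    have "inj_on (\<lambda>(x, y). real (p * x + q * y)) ({..<R} \<times> {..<R})"
      using lattice_values_inj[OF cop Rq] by (force simp: inj_on_def simp flip: of_nat_add of_nat_mult)
    then have "card Z = R\<^sup>2" unfolding Z_def
      by (subst card_image) (auto simp: power2_eq_square)
    moreover have "card Z \<le> card {z. poly (det A) z = 0}"
      by (intro card_mono poly_roots_finite D0) (use root in \<open>auto simp: Z_def\<close>)
    moreover have "card {z. poly (det A) z = 0} \<le> degree (det A)"
      by (rule card_poly_roots_bound[OF D0])
    moreover have "D \<le> n * (K - 1)"
      unfolding D_def using sum_bounded_above[of "{0..<n}" d "K - 1"] degP by (simp add: d_def)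
    ultimately have "R\<^sup>2 \<le> n * (K - 1)" using degD by linarith
    also have "\<dots> < n * K" using n0 K by simp
    also have "\<dots> \<le> K * L" using nL by (simp add: mult.commute)
    finally show False using KL by simp
  qed
  then have "P l = 0" using kl by (auto simp: S_def)
  then have "coeff (P l) k = 0" by simp
  then show ?thesis using coeffP[of l k] kl by simp
qed

section \<open>Linear forms in two logarithms\<close>

text \<open>
  The box principle: the $(H+1)^{|I|}$ vectors with entries in \<open>{0..H}\<close> are distributed over at most
  $(H^2+1)^T$ boxes of side \<open>\<delta>\<close>, and two of them in the same box have the required difference.
\<close>

lemma siegel_pigeonhole:
  fixes \<alpha> :: "'i \<Rightarrow> nat \<Rightarrow> real" and H T :: nat
  assumes I: "finite I" "2 * T < card I" and H: "H \<ge> 1" and \<delta>: "\<delta> > 0"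
    and \<alpha>: "\<And>i n. i \<in> I \<Longrightarrow> n < T \<Longrightarrow> 0 \<le> \<alpha> i n \<and> \<alpha> i n \<le> E"
    and HE: "real (card I) * E \<le> \<delta> * real H"
  obtains c :: "'i \<Rightarrow> int" where "\<exists>i\<in>I. c i \<noteq> 0" "\<And>i. i \<in> I \<Longrightarrow> \<bar>c i\<bar> \<le> int H"
    "\<And>n. n < T \<Longrightarrow> \<bar>\<Sum>i\<in>I. of_int (c i) * \<alpha> i n\<bar> \<le> \<delta>"
proof -
  define F where "F f n = (\<Sum>i\<in>I. real (f i) * \<alpha> i n)" for f :: "'i \<Rightarrow> nat" and n
  define G where "G f = (\<lambda>n\<in>{..<T}. nat \<lfloor>F f n / \<delta>\<rfloor>)" for f
  define A where "A = (I \<rightarrow>\<^sub>E {..H})"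
  have F: "0 \<le> F f n \<and> F f n \<le> \<delta> * real H * real H" if "f \<in> A" "n < T" for f n
  proof
    show "0 \<le> F f n" unfolding F_def by (intro sum_nonneg mult_nonneg_nonneg) (use \<alpha> that in auto)
    have "F f n \<le> (\<Sum>i\<in>I. real H * E)"
      unfolding F_def
      by (intro sum_mono mult_mono) (use \<alpha> that in \<open>force simp: A_def\<close>)+
    also have "\<dots> = real H * (real (card I) * E)" by simp
    also have "\<dots> \<le> real H * (\<delta> * real H)" using HE by (intro mult_left_mono) auto
    finally show "F f n \<le> \<delta> * real H * real H" by (simp add: mult_ac)
  qed
  have "G ` A \<subseteq> {..<T} \<rightarrow>\<^sub>E {..H\<^sup>2}"
  proof
    fix g assume "g \<in> G ` A"
    then obtain f where f: "f \<in> A" "g = G f" by auto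
    have "nat \<lfloor>F f n / \<delta>\<rfloor> \<le> H\<^sup>2" if "n < T" for n
    proof -
      have "F f n / \<delta> \<le> real (H\<^sup>2)" using F[OF f(1) that] \<delta> by (simp add: field_simps power2_eq_square)
      then have "\<lfloor>F f n / \<delta>\<rfloor> \<le> int (H\<^sup>2)" by (metis floor_mono floor_of_nat)
      then show ?thesis by (simp add: nat_le_iff)
    qed
    then show "g \<in> {..<T} \<rightarrow>\<^sub>E {..H\<^sup>2}" by (auto simp: f G_def)
  qed
  then have "card (G ` A) \<le> card ({..<T} \<rightarrow>\<^sub>E {..H\<^sup>2})"
    by (intro card_mono finite_PiE) auto
  also have "\<dots> = (H\<^sup>2 + 1) ^ T" by (simp add: card_PiE)
  also have "\<dots> \<le> ((H + 1)\<^sup>2) ^ T" by (intro power_mono) (auto simp: power2_eq_square)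
  also have "\<dots> = (H + 1) ^ (2 * T)" by (simp only: power_mult)
  also have "\<dots> < (H + 1) ^ card I" using I H by (intro power_strict_increasing) auto
  also have "\<dots> = card A" using I by (simp add: A_def card_PiE)
  finally have "\<not> inj_on G A" using card_image by (metis nless_le)
  then obtain f g where fg: "f \<in> A" "g \<in> A" "G f = G g" "f \<noteq> g" by (auto simp: inj_on_def)
  show thesis
  proof (rule that[of "\<lambda>i. int (f i) - int (g i)"])
    show "\<exists>i\<in>I. int (f i) - int (g i) \<noteq> 0"
    proof (rule ccontr)
      assume "\<not> ?thesis"
      then have "f i = g i" if "i \<in> I" for i using that by auto
      then have "f = g" using fg unfolding A_def by (intro PiE_ext[of f I _ g]) auto
      then show False using fg by simp
    qed
    show "\<bar>int (f i) - int (g i)\<bar> \<le> int H" if "i \<in> I" for i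
    proof -
      have "f i \<le> H" "g i \<le> H" using fg that by (auto simp: A_def PiE_iff)
      then show ?thesis by linarith
    qed
    show "\<bar>\<Sum>i\<in>I. of_int (int (f i) - int (g i)) * \<alpha> i n\<bar> \<le> \<delta>" if n: "n < T" for n
    proof -
      have "nat \<lfloor>F f n / \<delta>\<rfloor> = nat \<lfloor>F g n / \<delta>\<rfloor>" using fun_cong[OF fg(3), of n] n by (simp add: G_def)
      moreover have "0 \<le> F f n / \<delta>" "0 \<le> F g n / \<delta>" using F[OF fg(1) n] F[OF fg(2) n] \<delta> by auto
      ultimately have "\<lfloor>F f n / \<delta>\<rfloor> = \<lfloor>F g n / \<delta>\<rfloor>"
        by (metis eq_nat_nat_iff zero_le_floor)
      then have "\<bar>F f n / \<delta> - F g n / \<delta>\<bar> \<le> 1" by linarith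
      then have "\<bar>(F f n - F g n) / \<delta>\<bar> \<le> 1" by (simp add: diff_divide_distrib)
      then have "\<bar>F f n - F g n\<bar> \<le> \<delta>" using \<delta> by (simp add: abs_divide)
      moreover have "(\<Sum>i\<in>I. of_int (int (f i) - int (g i)) * \<alpha> i n) = F f n - F g n"
        by (simp add: F_def sum_subtractf left_diff_distrib)
      ultimately show ?thesis by simp
    qed
  qed
qed

lemma power_over_fact_le_exp: "(x::real) \<ge> 0 \<Longrightarrow> x ^ n / fact n \<le> exp x"
proof -
  assume x: "x \<ge> 0"
  obtain t where "exp x = (\<Sum>m<Suc n. x ^ m / fact m) + exp t / fact (Suc n) * x ^ Suc n"
    using Maclaurin_exp_le[of x "Suc n"] by blast
  moreover have "(\<Sum>m<n. x ^ m / fact m) \<ge> 0" "exp t / fact (Suc n) * x ^ Suc n \<ge> 0"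
    using x by (auto intro!: sum_nonneg mult_nonneg_nonneg)
  ultimately show ?thesis by simp
qed

lemma exp_taylor_remainder:
  fixes v V :: real
  assumes "0 \<le> v" "v \<le> V" "exp 2 * V \<le> real T" "T > 0"
  shows "\<bar>exp v - (\<Sum>i<T. v ^ i / fact i)\<bar> \<le> exp V * exp (- real T)"
proof -
  obtain t where t: "\<bar>t\<bar> \<le> \<bar>v\<bar>" "exp v = (\<Sum>m<T. v ^ m / fact m) + exp t / fact T * v ^ T"
    using Maclaurin_exp_le[of v T] by blast
  have "real T ^ T / fact T \<le> exp (real T)" by (rule power_over_fact_le_exp) simp
  then have f: "1 / fact T \<le> exp (real T) / real T ^ T" using assms(4) by (simp add: field_simps)
  have "v ^ T * (1 / fact T) \<le> (exp (-2) * real T) ^ T * (exp (real T) / real T ^ T)"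
  proof (intro mult_mono power_mono f)
    have "exp (-2) * (exp 2 * V) \<le> exp (-2) * real T" using assms by (intro mult_left_mono) auto
    moreover have "exp (-2) * (exp 2 * V) = V" by (simp add: mult.assoc[symmetric] flip: exp_add)
    ultimately show "v \<le> exp (-2) * real T" using assms by linarith
  qed (use assms in auto)
  also have "\<dots> = exp (-2) ^ T * exp (real T)" using assms by (simp add: power_mult_distrib)
  also have "\<dots> = exp (- real T)" by (simp flip: exp_add exp_of_nat_mult)
  finally have "v ^ T / fact T \<le> exp (- real T)" by simp
  moreover have "exp t \<le> exp V" using t(1) assms by auto
  ultimately have "exp t * (v ^ T / fact T) \<le> exp V * exp (- real T)"
    by (intro mult_mono) (use assms in auto)
  moreover have "exp v - (\<Sum>i<T. v ^ i / fact i) = exp t * (v ^ T / fact T)" using t(2) by simp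
  moreover have "exp t * (v ^ T / fact T) \<ge> 0" using assms by auto
  ultimately show ?thesis by simp
qed

lemma exp_minus_one_le: "\<bar>t\<bar> \<le> 1 \<Longrightarrow> \<bar>exp t - 1\<bar> \<le> 3 * \<bar>t::real\<bar>"
proof -
  assume t: "\<bar>t\<bar> \<le> 1"
  obtain u where u: "\<bar>u\<bar> \<le> \<bar>t\<bar>" "exp t = (\<Sum>m<1. t ^ m / fact m) + exp u / fact 1 * t ^ 1"
    using Maclaurin_exp_le[of t 1] by blast
  have "exp u \<le> exp 1" using u t by auto
  also have "\<dots> \<le> 3" using exp_le by simp
  finally have "exp u * \<bar>t\<bar> \<le> 3 * \<bar>t\<bar>" by (intro mult_right_mono) auto
  moreover have "\<bar>exp t - 1\<bar> = exp u * \<bar>t\<bar>" using u by (simp add: abs_mult)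
  ultimately show ?thesis by simp
qed

text \<open>
  Suppose that \<open>q * ln r - p * ln s\<close> is tiny, and put $Z=px+qy$, $w=\log s/q$. Then $r^xs^y$ is nearly
  $e^{wZ}$, so that for integers $c_{kl}$ the integer $\sum c_{kl}Z^k(r^xs^y)^l$ is nearly the value at
  \<open>Z\<close> of an entire function. The box principle makes its Taylor coefficients up to the order \<open>K + T\<close>
  small, and the tail is small anyway; so all values at the points considered are integers of modulus
  less than 1. This contradicts the zero estimate.

  The parameters are balanced as follows, for coefficients of size about $e^{Kh^3+V}$, where \<open>V\<close>, of order
  $LRh$, bounds $lwZ$: the number $KL=h^{12}$ of unknowns has to dominate both $Kh^3=h^{11}$ and
  $V$, of order $h^{11}$, and $R^2\ge KL$ is needed for the zero estimate.
\<close>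

lemma linear_form_core:
  fixes h r s p q :: nat
  defines "\<epsilon> \<equiv> exp (- (real h ^ 13))"
  defines "H \<equiv> 4 * (real h ^ 8 + 100 * real h ^ 11) * real h ^ 12 * exp (8 * real h ^ 11) + 1"
  assumes h: "h \<ge> 1"
    and h1: "exp (real h ^ 3) * (2 * real h + 3) * (real h ^ 6 + real h ^ 4) \<le> exp (2 * real h ^ 3)"
    and h2: "2 * (h ^ 8 + 100 * h ^ 11) < h ^ 12"
    and h3: "real h ^ 12 * H * (exp (8 * real h ^ 11) * exp (- (100 * real h ^ 11))) \<le> 1 / 4"
    and h4: "real h ^ 12 * H * (exp (8 * real h ^ 11) * (3 * (real h ^ 4 * (real h ^ 6 + real h ^ 4) * \<epsilon>))) \<le> 1 / 4"
    and h5: "real h ^ 4 * (real h ^ 6 + real h ^ 4) * \<epsilon> \<le> 1"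
    and r: "r \<ge> 2" "ln (real r) \<le> real h" and s: "s \<ge> 2" "ln (real s) \<le> real h"
    and cop: "coprime p q" and q: "h ^ 6 \<le> q" "real q \<le> exp (real h ^ 3)"
  shows "\<bar>real q * ln (real r) - real p * ln (real s)\<bar> \<ge> \<epsilon>"
proof (rule ccontr)
  assume "\<not> ?thesis"
  then have small: "\<bar>real q * ln (real r) - real p * ln (real s)\<bar> < \<epsilon>" by simp
  define \<Lambda> where "\<Lambda> = real q * ln (real r) - real p * ln (real s)"
  \<comment> \<open>\<open>K * L\<close> exceeds twice the number \<open>K + T\<close> of coefficients to be made small, and \<open>T\<close> exceeds
    \<open>exp 2\<close> times the bound \<open>V = 6 * h ^ 11\<close> for the exponents, which makes the Taylor tail negligible.\<close>
  define K L R X T where "K = h ^ 8" and "L = h ^ 4" and "R = h ^ 6" and "X = R + L" and "T = 100 * h ^ 11"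
  have pos: "K \<ge> 1" "L \<ge> 1" "R \<ge> 1" "T \<ge> 1" using h by (auto simp: K_def L_def R_def T_def)
  then have X1: "X \<ge> 1" by (simp add: X_def)
  have q1: "real q \<ge> 1" using q(1) pos(3) R_def by linarith
  define w where "w = ln (real s) / real q"
  define Zm where "Zm = real (p + q) * real X"
  have "\<epsilon> \<le> 1" by (simp add: \<epsilon>_def)
  have ln2: "1 / 2 \<le> ln (2::real)" using ln2_ge_two_thirds by simp
  have lns: "ln (real s) \<ge> 1 / 2" using s ln2 ln_mono[of 2 "real s"] by linarith
  have lnr: "ln (real r) \<ge> 1 / 2" using r ln2 ln_mono[of 2 "real r"] by linarith
  have pls: "real p * ln (real s) \<le> real q * ln (real r) + 1" using small \<open>\<epsilon> \<le> 1\<close> by linarith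
  have "real p * (1 / 2) \<le> real p * ln (real s)" using lns by (intro mult_left_mono) auto
  also have "\<dots> \<le> real q * real h + 1" using pls r(2) mult_left_mono[of "ln r" "real h" "real q"] by simp
  finally have "real p \<le> 2 * (real q * real h) + 2 * real q" using q1 by linarith
  then have pq: "real (p + q) \<le> real q * (2 * real h + 3)" by (simp add: algebra_simps)
  have Zm: "Zm \<le> exp (2 * real h ^ 3)"
  proof -
    have "Zm \<le> (exp (real h ^ 3) * (2 * real h + 3)) * (real h ^ 6 + real h ^ 4)"
      unfolding Zm_def X_def R_def L_def
      by (intro mult_mono order.trans[OF pq]) (use q in auto)
    then show ?thesis using h1 by linarith
  qed
  have Zm1: "Zm \<ge> 1"
  proof -
    have "1 * 1 \<le> Zm" unfolding Zm_def by (intro mult_mono) (use q1 X1 in auto)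
    then show ?thesis by simp
  qed
  have w0: "w \<ge> 0" using lns q1 by (simp add: w_def)
  have wZ: "w * Zm \<le> 3 * real h * real X"
  proof -
    have "w * Zm = (real p * ln (real s) / real q + ln (real s)) * real X"
      using q1 by (simp add: w_def Zm_def field_simps)
    also have "\<dots> \<le> (ln (real r) + 1 + ln (real s)) * real X"
    proof (intro mult_right_mono add_right_mono)
      have "real p * ln (real s) \<le> (ln (real r) + 1) * real q" using pls q1 by (simp add: algebra_simps)
      then show "real p * ln (real s) / real q \<le> ln (real r) + 1" using q1 by (simp add: field_simps)
    qed auto
    also have "\<dots> \<le> (3 * real h) * real X" using r s h by (intro mult_right_mono) auto
    finally show ?thesis .
  qed
  define V where "V = 6 * real h ^ 11"
  have LwZ: "real L * (w * Zm) \<le> V"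
  proof -
    have "real L * (w * Zm) \<le> real L * (3 * real h * real X)" using wZ by (intro mult_left_mono) auto
    also have "\<dots> = 3 * (real h ^ 11 + real h ^ 9)"
      by (simp add: X_def R_def L_def algebra_simps eval_nat_numeral)
    also have "real h ^ 9 \<le> real h ^ 11" using h by (intro power_increasing) auto
    finally show ?thesis by (simp add: V_def)
  qed
  define E where "E = exp (8 * real h ^ 11)"
  have ZE: "Zm ^ k * exp v \<le> E" if "k \<le> K" "v \<le> V" for k v
  proof -
    have "Zm ^ k \<le> Zm ^ K" using Zm1 that by (intro power_increasing) auto
    also have "\<dots> \<le> exp (2 * real h ^ 3) ^ K" using Zm Zm1 by (intro power_mono) auto
    also have "\<dots> = exp (2 * real h ^ 11)"
      by (simp add: K_def mult.commute flip: exp_of_nat_mult power_add)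
    finally have "Zm ^ k * exp v \<le> exp (2 * real h ^ 11) * exp V"
      using that by (intro mult_mono) auto
    then show ?thesis by (simp add: E_def V_def flip: exp_add)
  qed
  define T0 where "T0 = K + T"
  define I where "I = {..<K} \<times> {..<L}"
  have cardI: "card I = h ^ 12" by (simp add: I_def K_def L_def flip: power_add)
  define \<alpha> where "\<alpha> = (\<lambda>(k, l) n. if k \<le> n \<and> n - k < T
      then Zm ^ k * ((real l * (w * Zm)) ^ (n - k) / fact (n - k)) else 0)"
  define \<delta> where "\<delta> = 1 / (4 * real T0)"
  have T0: "T0 \<ge> 1" using pos by (simp add: T0_def)
  define Hn where "Hn = nat \<lceil>4 * real T0 * real h ^ 12 * E\<rceil>"
  have Hn1: "4 * real T0 * real h ^ 12 * E \<le> real Hn" unfolding Hn_def by (rule real_nat_ceiling_ge)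
  have "0 < 4 * real T0 * real h ^ 12 * E" using T0 h by (simp add: E_def)
  then have "Hn \<ge> 1" unfolding Hn_def by linarith
  have HnH: "real Hn \<le> H"
  proof -
    have "real Hn \<le> 4 * real T0 * real h ^ 12 * E + 1"
      unfolding Hn_def using \<open>0 < 4 * real T0 * real h ^ 12 * E\<close> by linarith
    then show ?thesis by (simp add: H_def T0_def K_def T_def E_def)
  qed
  have lV: "real l * (w * Zm) \<le> V" "real l * (w * Zm) \<ge> 0" if "l < L" for l
  proof -
    have "real l * (w * Zm) \<le> real L * (w * Zm)" using that w0 Zm1 by (intro mult_right_mono) auto
    then show "real l * (w * Zm) \<le> V" using LwZ by linarith
    show "real l * (w * Zm) \<ge> 0" using w0 Zm1 by auto
  qed
  obtain c :: "nat \<times> nat \<Rightarrow> int" where c: "\<exists>i\<in>I. c i \<noteq> 0" "\<And>i. i \<in> I \<Longrightarrow> \<bar>c i\<bar> \<le> int Hn"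
    "\<And>n. n < T0 \<Longrightarrow> \<bar>\<Sum>i\<in>I. of_int (c i) * \<alpha> i n\<bar> \<le> \<delta>"
  proof (rule siegel_pigeonhole[of I T0 Hn \<delta> \<alpha> E])
    show "finite I" by (simp add: I_def)
    show "2 * T0 < card I" using h2 by (simp add: cardI T0_def K_def T_def)
    show "\<delta> > 0" using T0 by (simp add: \<delta>_def)
    show "real (card I) * E \<le> \<delta> * real Hn" using Hn1 T0 by (simp add: cardI \<delta>_def field_simps)
    show "0 \<le> \<alpha> i n \<and> \<alpha> i n \<le> E" if "i \<in> I" for i n
    proof -
      obtain k l where i: "i = (k, l)" "k < K" "l < L" using \<open>i \<in> I\<close> by (auto simp: I_def)
      define v where "v = real l * (w * Zm)"
      have "Zm ^ k * (v ^ (n - k) / fact (n - k)) \<le> Zm ^ k * exp v"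
        using Zm1 lV[OF i(3)] by (intro mult_left_mono power_over_fact_le_exp) (auto simp: v_def)
      also have "\<dots> \<le> E" using ZE[of k v] i lV[OF i(3)] by (simp add: v_def)
      finally show ?thesis using Zm1 lV[OF i(3)] by (auto simp: \<alpha>_def i v_def E_def)
    qed
  qed (use \<open>Hn \<ge> 1\<close> in auto)
  define c' where "c' k l = real_of_int (c (k, l))" for k l
  have c': "\<bar>c' k l\<bar> \<le> H" if "k < K" "l < L" for k l
  proof -
    have "\<bar>c (k, l)\<bar> \<le> int Hn" using c(2) that by (simp add: I_def)
    then have "\<bar>c' k l\<bar> \<le> real Hn" unfolding c'_def by linarith
    then show ?thesis using HnH by linarith
  qed
  have zero: "(\<Sum>k<K. \<Sum>l<L. c' k l * real (p * x + q * y) ^ k * (real r ^ x * real s ^ y) ^ l) = 0"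
    if xy: "x < R + L" "y < R" for x y
  proof -
    define Z where "Z = real (p * x + q * y)"
    define u where "u = Z / Zm"
    have Z: "0 \<le> Z" "Z \<le> Zm"
    proof -
      have "p * x + q * y \<le> p * X + q * X" using xy by (intro add_mono mult_left_mono) (auto simp: X_def)
      then have "p * x + q * y \<le> (p + q) * X" by (simp add: algebra_simps)
      then show "Z \<le> Zm" unfolding Z_def Zm_def by (metis of_nat_le_iff of_nat_mult)
    qed (simp add: Z_def)
    have u: "0 \<le> u" "u \<le> 1" "Z = Zm * u" using Z Zm1 by (auto simp: u_def)
    define \<tau> where "\<tau> k l = Z ^ k * (\<Sum>i<T. (real l * (w * Z)) ^ i / fact i)" for k l
    have \<tau>: "\<tau> k l = (\<Sum>n<T0. \<alpha> (k, l) n * u ^ n)" if "k < K" for k l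
    proof -
      have "(\<Sum>n<T0. \<alpha> (k, l) n * u ^ n) = (\<Sum>n\<in>{k..<k + T}. \<alpha> (k, l) n * u ^ n)"
        by (rule sum.mono_neutral_right) (use that in \<open>auto simp: \<alpha>_def T0_def\<close>)
      also have "\<dots> = (\<Sum>i<T. \<alpha> (k, l) (i + k) * u ^ (i + k))"
        using sum.shift_bounds_nat_ivl[of "\<lambda>n. \<alpha> (k, l) n * u ^ n" 0 k T]
        by (simp add: lessThan_atLeast0 add.commute)
      also have "\<dots> = \<tau> k l"
        unfolding \<tau>_def sum_distrib_left
        by (intro sum.cong refl) (simp add: \<alpha>_def u(3) power_add power_mult_distrib mult_ac)
      finally show ?thesis by simp
    qed
    have main: "\<bar>\<Sum>k<K. \<Sum>l<L. c' k l * \<tau> k l\<bar> \<le> 1 / 4"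
    proof -
      have "(\<Sum>k<K. \<Sum>l<L. c' k l * \<tau> k l) = (\<Sum>k<K. \<Sum>l<L. \<Sum>n<T0. c' k l * \<alpha> (k, l) n * u ^ n)"
        by (intro sum.cong refl) (simp add: \<tau> sum_distrib_left mult_ac)
      also have "\<dots> = (\<Sum>i\<in>I. \<Sum>n<T0. of_int (c i) * \<alpha> i n * u ^ n)"
        unfolding I_def c'_def by (subst sum.cartesian_product) (simp add: case_prod_unfold)
      also have "\<dots> = (\<Sum>n<T0. (\<Sum>i\<in>I. of_int (c i) * \<alpha> i n) * u ^ n)"
        by (subst sum.swap) (simp add: sum_distrib_right)
      also have "\<bar>\<dots>\<bar> \<le> (\<Sum>n<T0. \<delta> * 1)"
        by (rule order.trans[OF sum_abs], intro sum_mono, unfold abs_mult, intro mult_mono)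
           (use c(3) u T0 in \<open>auto simp: power_le_one \<delta>_def\<close>)
      also have "\<dots> = 1 / 4" using T0 by (simp add: \<delta>_def)
      finally show ?thesis .
    qed
    define Y where "Y l = (real r ^ x * real s ^ y) ^ l" for l
    have Yexp: "Y l = exp (real l * (w * Z)) * exp (real l * real x * \<Lambda> / real q)" for l
    proof -
      have "x * ln (real r) + y * ln (real s) = w * Z + x * \<Lambda> / q"
        using q1 by (simp add: w_def Z_def \<Lambda>_def field_simps)
      then have "real l * (w * Z) + real l * real x * \<Lambda> / real q = l * (x * ln (real r) + y * ln (real s))"
        by (simp add: algebra_simps)
      then have "exp (real l * (w * Z)) * exp (real l * real x * \<Lambda> / real q) = exp (l * (x * ln (real r) + y * ln (real s)))"
        by (simp flip: exp_add)
      also have "\<dots> = (exp (x * ln (real r)) * exp (y * ln (real s))) ^ l"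
        by (simp add: exp_of_nat_mult exp_add)
      also have "\<dots> = Y l" using r s by (simp add: Y_def exp_of_nat_mult)
      finally show ?thesis by simp
    qed
    define e1 where "e1 = E * exp (- (100 * real h ^ 11))"
    define e2 where "e2 = E * (3 * (real h ^ 4 * (real h ^ 6 + real h ^ 4) * \<epsilon>))"
    have diff: "\<bar>Z ^ k * Y l - \<tau> k l\<bar> \<le> e1 + e2" if "k < K" "l < L" for k l
    proof -
      define v where "v = real l * (w * Z)"
      have v: "0 \<le> v" "v \<le> V"
      proof -
        show "0 \<le> v" using w0 Z by (simp add: v_def)
        have "v \<le> real l * (w * Zm)" unfolding v_def using Z w0 by (intro mult_left_mono) auto
        then show "v \<le> V" using lV[OF that(2)] by simp
      qed
      have Zk: "0 \<le> Z ^ k" "Z ^ k \<le> Zm ^ k" using Z by (auto intro: power_mono)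
      have "\<bar>exp v - (\<Sum>i<T. v ^ i / fact i)\<bar> \<le> exp V * exp (- real T)"
      proof (rule exp_taylor_remainder[OF v])
        have "exp (2::real) = exp 1 * exp 1" by (simp flip: exp_add)
        also have "\<dots> \<le> 3 * 3" using exp_le by (intro mult_mono) auto
        finally have "exp 2 * V \<le> 9 * V" by (intro mult_right_mono) (auto simp: V_def)
        also have "\<dots> \<le> real T" by (simp add: V_def T_def)
        finally show "exp 2 * V \<le> real T" .
      qed (use pos in simp)
      then have "Z ^ k * \<bar>exp v - (\<Sum>i<T. v ^ i / fact i)\<bar> \<le> Zm ^ k * (exp V * exp (- real T))"
        using Zk Zm1 by (intro mult_mono) auto
      also have "\<dots> = (Zm ^ k * exp V) * exp (- real T)" by simp
      also have "\<dots> \<le> E * exp (- real T)" using ZE[of k V] that by (intro mult_right_mono) auto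
      finally have 1: "\<bar>Z ^ k * exp v - \<tau> k l\<bar> \<le> e1"
        using Zk(1) by (simp add: \<tau>_def v_def e1_def T_def abs_mult flip: right_diff_distrib)
      define t where "t = real l * real x * \<Lambda> / real q"
      have "\<bar>t\<bar> = real l * real x * \<bar>\<Lambda>\<bar> / real q" using q1 by (simp add: t_def abs_mult)
      also have "\<dots> \<le> real l * real x * \<bar>\<Lambda>\<bar>"
      proof -
        have "a / real q \<le> a" if "a \<ge> 0" for a :: real
          using that q1 mult_left_mono[of 1 "real q" a] by (simp add: field_simps)
        then show ?thesis by simp
      qed
      also have "\<dots> \<le> real h ^ 4 * (real h ^ 6 + real h ^ 4) * \<epsilon>"
      proof (intro mult_mono)
        show "real l \<le> real h ^ 4" using that(2) by (simp add: L_def flip: of_nat_power)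
        have "real x \<le> real (R + L)" using xy by simp
        then show "real x \<le> real h ^ 6 + real h ^ 4" by (simp add: R_def L_def)
        show "\<bar>\<Lambda>\<bar> \<le> \<epsilon>" using small by (simp add: \<Lambda>_def)
      qed auto
      finally have t: "\<bar>t\<bar> \<le> real h ^ 4 * (real h ^ 6 + real h ^ 4) * \<epsilon>" .
      have "\<bar>exp t - 1\<bar> \<le> 3 * \<bar>t\<bar>" using t h5 by (intro exp_minus_one_le) linarith
      also have "\<dots> \<le> 3 * (real h ^ 4 * (real h ^ 6 + real h ^ 4) * \<epsilon>)" using t by simp
      finally have "(Z ^ k * exp v) * \<bar>exp t - 1\<bar> \<le> E * (3 * (real h ^ 4 * (real h ^ 6 + real h ^ 4) * \<epsilon>))"
      proof (rule mult_mono[rotated])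
        have "Z ^ k * exp v \<le> Zm ^ k * exp v" using Zk by (intro mult_right_mono) auto
        also have "\<dots> \<le> E" using ZE[of k v] v that by simp
        finally show "Z ^ k * exp v \<le> E" .
      qed (auto simp: E_def)
      moreover have "Z ^ k * Y l - Z ^ k * exp v = (Z ^ k * exp v) * (exp t - 1)"
        by (simp add: Yexp v_def t_def algebra_simps)
      ultimately have 2: "\<bar>Z ^ k * Y l - Z ^ k * exp v\<bar> \<le> e2"
        using Zk(1) by (simp add: e2_def abs_mult)
      show ?thesis using 1 2 by linarith
    qed
    have "\<bar>(\<Sum>k<K. \<Sum>l<L. c' k l * (Z ^ k * Y l)) - (\<Sum>k<K. \<Sum>l<L. c' k l * \<tau> k l)\<bar>
        = \<bar>\<Sum>k<K. \<Sum>l<L. c' k l * (Z ^ k * Y l - \<tau> k l)\<bar>"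
      by (simp add: sum_subtractf right_diff_distrib)
    also have "\<dots> \<le> (\<Sum>k<K. \<Sum>l<L. H * (e1 + e2))"
      apply (rule order.trans[OF sum_abs], intro sum_mono, rule order.trans[OF sum_abs], intro sum_mono)
      unfolding abs_mult using c' diff by (intro mult_mono) (auto intro: order.trans[OF abs_ge_zero])
    also have "\<dots> = real h ^ 12 * H * e1 + real h ^ 12 * H * e2"
      by (simp add: K_def L_def algebra_simps flip: power_add)
    also have "\<dots> \<le> 1 / 4 + 1 / 4" using h3 h4 by (simp add: e1_def e2_def E_def)
    finally have "\<bar>\<Sum>k<K. \<Sum>l<L. c' k l * (Z ^ k * Y l)\<bar> < 1" using main by linarith
    moreover have "(\<Sum>k<K. \<Sum>l<L. c' k l * (Z ^ k * Y l))
        = of_int (\<Sum>k<K. \<Sum>l<L. c (k, l) * (int (p * x + q * y) ^ k * (int r ^ x * int s ^ y) ^ l))"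
      by (simp add: c'_def Z_def Y_def)
    moreover have "n = 0" if "\<bar>real_of_int n\<bar> < 1" for n using that by linarith
    ultimately have "(\<Sum>k<K. \<Sum>l<L. c' k l * (Z ^ k * Y l)) = 0"
      by (metis (no_types, lifting) of_int_0)
    then show ?thesis by (simp add: Z_def Y_def mult.assoc)
  qed
  have "c' k l = 0" if "k < K" "l < L" for k l
  proof (rule zero_estimate[of r s p q R K L c' k l])
    show "K * L \<le> R\<^sup>2" by (simp add: K_def L_def R_def flip: power_add power_mult)
  qed (use r s cop q zero that in \<open>auto simp: R_def\<close>)
  then show False using c(1) by (auto simp: I_def c'_def)
qed

text \<open>
  Distinct positive integers differ by at least 1.
\<close>

lemma liouville_log:
  fixes u v :: nat
  assumes "u > 0" "v > 0" "u \<noteq> v" "ln (real u) \<le> B" "ln (real v) \<le> B"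
  shows "\<bar>ln (real u) - ln (real v)\<bar> \<ge> exp (- B)"
proof -
  have *: "ln (real v) - ln (real u) \<ge> exp (- B)" if "u < v" "u > 0" "ln (real v) \<le> B" for u v :: nat
  proof -
    have "ln (real u / real v) \<le> real u / real v - 1" using that by (intro ln_le_minus_one) auto
    then have "ln (real v) - ln (real u) \<ge> 1 - real u / real v" using that by (simp add: ln_div)
    moreover have "1 - real u / real v \<ge> 1 / real v" using that by (simp add: field_simps)
    moreover have "1 / real v = exp (- ln (real v))" using that by (simp add: exp_minus field_simps)
    moreover have "exp (- ln (real v)) \<ge> exp (- B)" using that by simp
    ultimately show ?thesis by linarith
  qed
  show ?thesis using assms *[of u v] *[of v u] by (cases "u < v") auto
qed

text \<open>
  The zero estimate requires $q\ge h^6$. Smaller \<open>q\<close> are covered by the trivial bound, since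
  $r^q$ and $s^p$ are distinct integers of size at most $e^{h^7+1}$; here the multiplicative
  independence enters.
\<close>

theorem linear_form_in_two_logarithms:
  "\<forall>\<^sub>F h in sequentially. \<forall>r s p q :: nat. r \<ge> 2 \<longrightarrow> s \<ge> 2 \<longrightarrow> ln (real r) \<le> real h \<longrightarrow> ln (real s) \<le> real h \<longrightarrow>
     (\<forall>x y. r ^ x = s ^ y \<longrightarrow> x = 0) \<longrightarrow> coprime p q \<longrightarrow> 0 < q \<longrightarrow> real q \<le> exp (real h ^ 3) \<longrightarrow>
     \<bar>real q * ln (real r) - real p * ln (real s)\<bar> \<ge> exp (- (real h ^ 13))"
proof -
  have 1: "\<forall>\<^sub>F h in sequentially. exp (real h ^ 3) * (2 * real h + 3) * (real h ^ 6 + real h ^ 4) \<le> exp (2 * real h ^ 3)"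
    by real_asymp
  have 2: "\<forall>\<^sub>F h in sequentially. 2 * (h ^ 8 + 100 * h ^ 11) < h ^ 12"
  proof -
    have "\<forall>\<^sub>F h in sequentially. 2 * (real h ^ 8 + 100 * real h ^ 11) < real h ^ 12" by real_asymp
    then show ?thesis
    proof (rule eventually_mono)
      fix h assume "2 * (real h ^ 8 + 100 * real h ^ 11) < real h ^ 12"
      then have "real (2 * (h ^ 8 + 100 * h ^ 11)) < real (h ^ 12)" by simp
      then show "2 * (h ^ 8 + 100 * h ^ 11) < h ^ 12" by (simp only: of_nat_less_iff)
    qed
  qed
  have 3: "\<forall>\<^sub>F h in sequentially. real h ^ 12 * (4 * (real h ^ 8 + 100 * real h ^ 11) * real h ^ 12 * exp (8 * real h ^ 11) + 1) * (exp (8 * real h ^ 11) * exp (- (100 * real h ^ 11))) \<le> 1 / 4"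
  proof -
    have A: "\<forall>\<^sub>F h in sequentially. real h ^ 12 * (4 * (real h ^ 8 + 100 * real h ^ 11) * real h ^ 12 * exp (- (84 * real h ^ 11)) + exp (- (92 * real h ^ 11))) \<le> 1 / 4" by real_asymp
    have B: "real h ^ 12 * (4 * (real h ^ 8 + 100 * real h ^ 11) * real h ^ 12 * exp (- (84 * real h ^ 11)) + exp (- (92 * real h ^ 11))) 
       = real h ^ 12 * (4 * (real h ^ 8 + 100 * real h ^ 11) * real h ^ 12 * exp (8 * real h ^ 11) + 1) * (exp (8 * real h ^ 11) * exp (- (100 * real h ^ 11)))" for h
    proof -
      define x where "x = real h ^ 11"
      have "exp (- (84 * x)) = exp (8 * x) * (exp (8 * x) * exp (- (100 * x)))"
       "exp (- (92 * x)) = exp (8 * x) * exp (- (100 * x))" by (simp_all flip: exp_add)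
      then show ?thesis unfolding x_def[symmetric] by (simp only: distrib_left distrib_right mult_ac mult_1_left mult_1_right)
    qed
    from A show ?thesis unfolding B .
  qed
  have 4: "\<forall>\<^sub>F h in sequentially. real h ^ 12 * (4 * (real h ^ 8 + 100 * real h ^ 11) * real h ^ 12 * exp (8 * real h ^ 11) + 1)  * (exp (8 * real h ^ 11) * (3 * (real h ^ 4 * (real h ^ 6 + real h ^ 4) * exp (- (real h ^ 13))))) \<le> 1 / 4"
  proof -
    have A: "\<forall>\<^sub>F h in sequentially. real h ^ 12 * (3 * (real h ^ 4 * (real h ^ 6 + real h ^ 4))) * (4 * (real h ^ 8 + 100 * real h ^ 11) * real h ^ 12 * exp (16 * real h ^ 11 - real h ^ 13) + exp (8 * real h ^ 11 - real h ^ 13)) \<le> 1 / 4" by real_asymp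
    have B: "real h ^ 12 * (3 * (real h ^ 4 * (real h ^ 6 + real h ^ 4))) * (4 * (real h ^ 8 + 100 * real h ^ 11) * real h ^ 12 * exp (16 * real h ^ 11 - real h ^ 13) + exp (8 * real h ^ 11 - real h ^ 13))
       = real h ^ 12 * (4 * (real h ^ 8 + 100 * real h ^ 11) * real h ^ 12 * exp (8 * real h ^ 11) + 1)  * (exp (8 * real h ^ 11) * (3 * (real h ^ 4 * (real h ^ 6 + real h ^ 4) * exp (- (real h ^ 13)))))" for h
    proof -
      define x where "x = real h ^ 11"
      define y where "y = real h ^ 13"
      have "exp (16 * x - y) = exp (8 * x) * (exp (8 * x) * exp (- y))"
       "exp (8 * x - y) = exp (8 * x) * exp (- y)" by (simp_all flip: exp_add)
      then show ?thesis unfolding x_def[symmetric] y_def[symmetric] by (simp only: distrib_left distrib_right mult_ac mult_1_left mult_1_right)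
    qed
    from A show ?thesis unfolding B .
  qed
  have 5: "\<forall>\<^sub>F h in sequentially. real h ^ 4 * (real h ^ 6 + real h ^ 4) * exp (- (real h ^ 13)) \<le> 1"
    by real_asymp
  have 6: "\<forall>\<^sub>F h in sequentially. real h ^ 7 + 1 \<le> real h ^ 13" by real_asymp
  have main: "\<bar>real q * ln (real r) - real p * ln (real s)\<bar> \<ge> exp (- (real h ^ 13))"
    if h: "h \<ge> 1" and ineqs:
      "exp (real h ^ 3) * (2 * real h + 3) * (real h ^ 6 + real h ^ 4) \<le> exp (2 * real h ^ 3)"
      "2 * (h ^ 8 + 100 * h ^ 11) < h ^ 12"
      "real h ^ 12 * (4 * (real h ^ 8 + 100 * real h ^ 11) * real h ^ 12 * exp (8 * real h ^ 11) + 1) * (exp (8 * real h ^ 11) * exp (- (100 * real h ^ 11))) \<le> 1 / 4"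
      "real h ^ 12 * (4 * (real h ^ 8 + 100 * real h ^ 11) * real h ^ 12 * exp (8 * real h ^ 11) + 1) * (exp (8 * real h ^ 11) * (3 * (real h ^ 4 * (real h ^ 6 + real h ^ 4) * exp (- (real h ^ 13))))) \<le> 1 / 4"
      "real h ^ 4 * (real h ^ 6 + real h ^ 4) * exp (- (real h ^ 13)) \<le> 1"
    and h6: "real h ^ 7 + 1 \<le> real h ^ 13"
    and r: "r \<ge> 2" "ln (real r) \<le> real h" and s: "s \<ge> 2" "ln (real s) \<le> real h"
    and indep: "\<forall>x y. r ^ x = s ^ y \<longrightarrow> x = 0"
    and pq: "coprime p q" and q: "0 < q" "real q \<le> exp (real h ^ 3)" for h r s p q :: nat
  proof (cases "h ^ 6 \<le> q")
    case True
    show ?thesis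
      by (rule linear_form_core[OF h ineqs r s pq True q(2)])
  next
    case False
    show ?thesis
    proof (rule ccontr)
      assume "\<not> ?thesis"
      then have small: "\<bar>real q * ln (real r) - real p * ln (real s)\<bar> < exp (- (real h ^ 13))" by simp
      have le1: "exp (- (real h ^ 13)) \<le> 1" by simp
      have "real q * ln (real r) \<le> real h ^ 6 * real h"
      proof (intro mult_mono)
        have "real q \<le> real (h ^ 6)" using False by linarith
        then show "real q \<le> real h ^ 6" by simp
      qed (use r in auto)
      also have "real h ^ 6 * real h = real h ^ 7" by (simp add: eval_nat_numeral)
      finally have q7: "real q * ln (real r) \<le> real h ^ 7" .
      have lu: "ln (real (r ^ q)) = real q * ln (real r)" "ln (real (s ^ p)) = real p * ln (real s)"
        using r s by (auto simp: ln_realpow)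
      have "r ^ q \<noteq> s ^ p" using indep q by blast
      moreover have "r ^ q > 0" "s ^ p > 0" using r s by auto
      ultimately have "\<bar>ln (real (r ^ q)) - ln (real (s ^ p))\<bar> \<ge> exp (- (real h ^ 7 + 1))"
        using lu q7 small le1 by (intro liouville_log) linarith+
      moreover have "exp (- (real h ^ 7 + 1)) \<ge> exp (- (real h ^ 13))" using h6 by simp
      ultimately show False using small lu by linarith
    qed
  qed
  show ?thesis
    using 1 2 3 4 5 6 eventually_ge_at_top[of 1]
    by eventually_elim (blast intro: main)
qed

section \<open>Leading digits of geometric progressions\<close>

lemma sum_nat_blocks: "(\<Sum>i<M * k. f i) = (\<Sum>m<M. \<Sum>i<k. f (m * k + i))" for f :: "nat \<Rightarrow> real"
proof -
  have "(\<Sum>i = m * k..<m * k + k. f i) = (\<Sum>i<k. f (m * k + i))" for m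
    by (simp add: sum.atLeastLessThan_shift_0[of f] lessThan_atLeast0)
  then show ?thesis using sum.nat_group[of f k M] by simp
qed

lemma sum_cos_arith_progression:
  fixes \<alpha> :: real and s :: nat
  assumes "s \<ge> 2"
  shows "(\<Sum>d<s. cos (\<alpha> + 2 * pi * real d / real s)) = 0"
proof -
  define \<beta> where "\<beta> = pi / real s"
  have "0 < \<beta>" "\<beta> < pi" using assms by (auto simp: \<beta>_def field_simps)
  then have sin: "sin \<beta> > 0" by (rule sin_gt_zero)
  have step: "2 * sin \<beta> * cos (\<alpha> + 2 * pi * real d / real s)
      = sin (\<alpha> - \<beta> + 2 * \<beta> * real (Suc d)) - sin (\<alpha> - \<beta> + 2 * \<beta> * real d)" for d
  proof -
    have *: "\<alpha> - \<beta> + 2 * \<beta> * real (Suc d) = (\<alpha> + 2 * pi * real d / real s) + \<beta>"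
      "\<alpha> - \<beta> + 2 * \<beta> * real d = (\<alpha> + 2 * pi * real d / real s) - \<beta>"
      by (simp_all add: \<beta>_def distrib_left add_divide_distrib)
    show ?thesis unfolding * sin_add sin_diff by simp
  qed
  have "2 * sin \<beta> * (\<Sum>d<s. cos (\<alpha> + 2 * pi * real d / real s))
      = (\<Sum>d<s. sin (\<alpha> - \<beta> + 2 * \<beta> * real (Suc d)) - sin (\<alpha> - \<beta> + 2 * \<beta> * real d))"
    by (simp only: sum_distrib_left step)
  also have "\<dots> = sin (\<alpha> - \<beta> + 2 * \<beta> * real s) - sin (\<alpha> - \<beta>)"
    using sum_lessThan_telescope[of "\<lambda>d. sin (\<alpha> - \<beta> + 2 * \<beta> * real d)" s] by simp
  also have "\<dots> = 0"
  proof -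
    have "\<alpha> - \<beta> + 2 * \<beta> * real s = (\<alpha> - \<beta>) + 2 * pi" using assms by (simp add: \<beta>_def)
    then show ?thesis by (simp only: sin_periodic)
  qed
  finally show ?thesis using sin by simp
qed

text \<open>
  Cauchy-Schwarz: the squares of the cosines have the mean 1/2 exactly.
\<close>

lemma sum_abs_cos_le:
  fixes y :: real and s :: nat
  assumes "s \<ge> 2"
  shows "(\<Sum>d<s. \<bar>cos (pi * (y + real d / real s))\<bar>) \<le> real s * sqrt (1 / 2)"
proof -
  have "(\<Sum>d<s. \<bar>cos (pi * (y + real d / real s))\<bar>)\<^sup>2
      \<le> (\<Sum>d<s. 1\<^sup>2) * (\<Sum>d<s. \<bar>cos (pi * (y + real d / real s))\<bar>\<^sup>2)"
    using Cauchy_Schwarz_ineq_sum[of "\<lambda>_. 1" "\<lambda>d. \<bar>cos (pi * (y + real d / real s))\<bar>" "{..<s}"] by simp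
  also have "(\<Sum>d<s. \<bar>cos (pi * (y + real d / real s))\<bar>\<^sup>2)
      = (\<Sum>d<s. 1 / 2 + cos (2 * pi * y + 2 * pi * real d / real s) / 2)"
  proof (rule sum.cong[OF refl])
    fix d
    have "2 * pi * y + 2 * pi * real d / real s = 2 * (pi * (y + real d / real s))"
      by (simp add: algebra_simps)
    then show "\<bar>cos (pi * (y + real d / real s))\<bar>\<^sup>2 = 1 / 2 + cos (2 * pi * y + 2 * pi * real d / real s) / 2"
      by (simp only: cos_double_cos) (simp add: diff_divide_distrib)
  qed
  also have "\<dots> = real s / 2 + (\<Sum>d<s. cos (2 * pi * y + 2 * pi * real d / real s)) / 2"
    by (simp add: sum.distrib sum_divide_distrib)
  also have "\<dots> = real s / 2" using sum_cos_arith_progression[OF assms] by simp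
  finally have "(\<Sum>d<s. \<bar>cos (pi * (y + real d / real s))\<bar>)\<^sup>2 \<le> (real s * sqrt (1 / 2))\<^sup>2"
    by (simp add: power_mult_distrib power2_eq_square real_sqrt_divide)
  then show ?thesis by (rule power2_le_imp_le) simp
qed

lemma abs_cos_shift: "\<bar>cos (pi * (x + real m))\<bar> = \<bar>cos (pi * x)\<bar>"
  by (simp add: distrib_left cos_add mult.commute[of pi "real m"] abs_mult)

text \<open>
  Write $g=ds^{n-1}+g'$. Only the factor \<open>i = 0\<close> depends on the leading digit \<open>d\<close>, and its mean over
  \<open>d\<close> is at most $\sqrt{1/2}$; the other factors form the product for $g'$ with \<open>n - 1\<close> and \<open>D - 1\<close>.
\<close>

lemma sum_cos_prod_le:
  fixes s :: nat
  assumes s: "s \<ge> 2" and "D \<le> n"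
  shows "(\<Sum>g<s ^ n. \<Prod>i<D. \<bar>cos (pi * (real g / real s ^ (n - i)))\<bar>) \<le> real s ^ n * sqrt (1 / 2) ^ D"
  using assms(2)
proof (induction D arbitrary: n)
  case (Suc D)
  then obtain n' where n: "n = Suc n'" "D \<le> n'" by (cases n) auto
  define f where "f n D g = (\<Prod>i<D. \<bar>cos (pi * (real g / real s ^ (n - i)))\<bar>)" for n D g :: nat
  have s0: "real s > 0" using s by simp
  have step: "f n (Suc D) (d * s ^ n' + g) = \<bar>cos (pi * (real g / real s ^ n + real d / real s))\<bar> * f n' D g"
    for d g
  proof -
    have "\<bar>cos (pi * (real (d * s ^ n' + g) / real s ^ (n' - i)))\<bar> = \<bar>cos (pi * (real g / real s ^ (n' - i)))\<bar>"
      if "i < D" for i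
    proof -
      have "real s ^ n' = real s ^ i * real s ^ (n' - i)" using that n(2) by (simp flip: power_add)
      then have "real (d * s ^ n' + g) / real s ^ (n' - i) = real g / real s ^ (n' - i) + real (d * s ^ i)"
        using s0 by (simp add: field_simps)
      then show ?thesis by (simp only: abs_cos_shift)
    qed
    moreover have "real (d * s ^ n' + g) / real s ^ n = real g / real s ^ n + real d / real s"
      using s0 by (simp add: n(1) field_simps)
    ultimately show ?thesis
      unfolding f_def by (subst prod.lessThan_Suc_shift) (simp add: n(1))
  qed
  have "(\<Sum>g<s ^ n. f n (Suc D) g) = (\<Sum>d<s. \<Sum>g<s ^ n'. f n (Suc D) (d * s ^ n' + g))"
    by (simp add: n(1) sum_nat_blocks)
  also have "\<dots> = (\<Sum>g<s ^ n'. (\<Sum>d<s. \<bar>cos (pi * (real g / real s ^ n + real d / real s))\<bar>) * f n' D g)"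
    by (simp only: step) (subst sum.swap, simp add: sum_distrib_right)
  also have "\<dots> \<le> (\<Sum>g<s ^ n'. (real s * sqrt (1 / 2)) * f n' D g)"
    by (intro sum_mono mult_right_mono sum_abs_cos_le s) (auto simp: f_def intro!: prod_nonneg)
  also have "\<dots> = (real s * sqrt (1 / 2)) * (\<Sum>g<s ^ n'. f n' D g)" by (simp add: sum_distrib_left)
  also have "\<dots> \<le> (real s * sqrt (1 / 2)) * (real s ^ n' * sqrt (1 / 2) ^ D)"
    using Suc.IH[OF n(2)] by (intro mult_left_mono) (auto simp: f_def)
  also have "\<dots> = real s ^ n * sqrt (1 / 2) ^ Suc D" by (simp add: n(1) mult_ac)
  finally show ?case by (simp add: f_def)
qed simp

lemma sum_cos_prod_periods_le:
  fixes s M :: nat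
  assumes s: "s \<ge> 2" and "D \<le> n"
  shows "(\<Sum>g<M * s ^ n. \<Prod>i<D. \<bar>cos (pi * (real g / real s ^ (n - i)))\<bar>) \<le> real M * (real s ^ n * sqrt (1 / 2) ^ D)"
proof -
  define f where "f g = (\<Prod>i<D. \<bar>cos (pi * (real g / real s ^ (n - i)))\<bar>)" for g :: nat
  have s0: "real s > 0" using s by simp
  have per: "f (d * s ^ n + g) = f g" for d g
  proof -
    have "\<bar>cos (pi * (real (d * s ^ n + g) / real s ^ (n - i)))\<bar> = \<bar>cos (pi * (real g / real s ^ (n - i)))\<bar>"
      if "i < D" for i
    proof -
      have "real s ^ n = real s ^ i * real s ^ (n - i)" using that assms(2) by (simp flip: power_add)
      then have "real (d * s ^ n + g) / real s ^ (n - i) = real g / real s ^ (n - i) + real (d * s ^ i)"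
        using s0 by (simp add: field_simps)
      then show ?thesis by (simp only: abs_cos_shift)
    qed
    then show ?thesis by (simp add: f_def)
  qed
  have "(\<Sum>g<M * s ^ n. f g) = (\<Sum>d<M. \<Sum>g<s ^ n. f (d * s ^ n + g))"
    by (rule sum_nat_blocks)
  also have "\<dots> = real M * (\<Sum>g<s ^ n. f g)" by (simp add: per)
  also have "\<dots> \<le> real M * (real s ^ n * sqrt (1 / 2) ^ D)"
    using sum_cos_prod_le[OF assms] by (intro mult_left_mono) (auto simp: f_def)
  finally show ?thesis by (simp add: f_def)
qed

text \<open>
  For an index \<open>i\<close> that is counted, the integer $ip-q\lfloor\tau+i\omega\rfloor$ lies in an interval of
  length $q(v-u)+2$, and for distinct \<open>i < q\<close> these integers are distinct modulo \<open>q\<close>.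
\<close>

lemma rotation_count:
  fixes \<omega> \<tau> u v :: real and p :: int and q :: nat
  assumes q: "q > 0" and cop: "coprime p (int q)" and close: "\<bar>real q * \<omega> - of_int p\<bar> \<le> 1 / real q"
    and uv: "u \<le> v"
  shows "real (card {i\<in>{..<q}. frac (\<tau> + real i * \<omega>) \<in> {u..<v}}) \<le> real q * (v - u) + 3"
proof -
  define S where "S = {i\<in>{..<q}. frac (\<tau> + real i * \<omega>) \<in> {u..<v}}"
  define z where "z i = int i * p - int q * \<lfloor>\<tau> + real i * \<omega>\<rfloor>" for i
  define a b where "a = real q * (u - \<tau>) - 1" and "b = real q * (v - \<tau>) + 1"
  have "inj_on z S"
  proof (rule inj_onI)
    fix i j assume ij: "i \<in> S" "j \<in> S" "z i = z j"
    then have "(int i - int j) * p = int q * (\<lfloor>\<tau> + real i * \<omega>\<rfloor> - \<lfloor>\<tau> + real j * \<omega>\<rfloor>)"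
      by (simp add: z_def algebra_simps)
    then have "int q dvd (int i - int j) * p" by simp
    then have "int q dvd int i - int j" using cop by (simp add: coprime_commute coprime_dvd_mult_left_iff)
    moreover have "\<bar>int i - int j\<bar> < int q" using ij by (auto simp: S_def)
    ultimately have "int i - int j = 0"
      using dvd_imp_le_int[of "int i - int j" "int q"] by (cases "int i - int j = 0") auto
    then show "i = j" by simp
  qed
  moreover have "z ` S \<subseteq> {\<lceil>a\<rceil>..\<lfloor>b\<rfloor>}"
  proof
    fix y assume "y \<in> z ` S"
    then obtain i where i: "i \<in> S" "y = z i" by auto
    have eq: "real_of_int (z i) = real q * frac (\<tau> + real i * \<omega>) - real q * \<tau> - real i * (real q * \<omega> - of_int p)"
      by (simp add: z_def frac_def algebra_simps)
    have "\<bar>real i * (real q * \<omega> - of_int p)\<bar> \<le> real i * (1 / real q)"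
      unfolding abs_mult using close by (intro mult_mono) auto
    also have "\<dots> \<le> 1" using i q by (simp add: S_def)
    finally have 1: "\<bar>real i * (real q * \<omega> - of_int p)\<bar> \<le> 1" .
    have "u \<le> frac (\<tau> + real i * \<omega>)" "frac (\<tau> + real i * \<omega>) \<le> v" using i by (auto simp: S_def)
    then have 2: "real q * u \<le> real q * frac (\<tau> + real i * \<omega>)" "real q * frac (\<tau> + real i * \<omega>) \<le> real q * v"
      by (auto intro: mult_left_mono)
    have "a \<le> real_of_int y" "real_of_int y \<le> b"
      unfolding i(2) eq a_def b_def using 1 2 by (auto simp: right_diff_distrib)
    then show "y \<in> {\<lceil>a\<rceil>..\<lfloor>b\<rfloor>}" by (auto simp: ceiling_le_iff le_floor_iff)
  qed
  ultimately have "card S \<le> card {\<lceil>a\<rceil>..\<lfloor>b\<rfloor>}" by (intro card_inj_on_le) auto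
  also have "\<dots> = nat (\<lfloor>b\<rfloor> - \<lceil>a\<rceil> + 1)" by simp
  finally have "real (card S) \<le> real (nat (\<lfloor>b\<rfloor> - \<lceil>a\<rceil> + 1))" by simp
  also have "\<dots> \<le> b - a + 1"
  proof -
    have "b - a \<ge> 0" using uv q by (simp add: a_def b_def mult_left_mono)
    then show ?thesis by linarith
  qed
  also have "\<dots> = real q * (v - u) + 3" by (simp add: a_def b_def algebra_simps)
  finally show ?thesis by (simp add: S_def)
qed

text \<open>
  With $n=\lfloor\log_su\rfloor$ this is the product of $|\cos(\pi u/s^k)|$ over $n-D\le k<n$. Writing it
  with the mantissa $u/s^n$ shows that it depends only on the fractional part of $\log_su$.
\<close>

definition top_cos :: "nat \<Rightarrow> nat \<Rightarrow> real \<Rightarrow> real" where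
  "top_cos s D u = (\<Prod>d = 1..D. \<bar>cos (pi * (real s ^ d * real s powr frac (log (real s) u)))\<bar>)"

lemma top_cos_nonneg: "top_cos s D u \<ge> 0"
  by (auto simp: top_cos_def intro!: prod_nonneg)

lemma abs_cos_diff_le: "\<bar>\<bar>cos (pi * x)\<bar> - \<bar>cos (pi * y)\<bar>\<bar> \<le> pi * \<bar>x - y\<bar>"
proof -
  have "\<bar>cos (pi * x) - cos (pi * y)\<bar> \<le> \<bar>pi * x - pi * y\<bar>"
  proof -
    have "cos (pi * x) - cos (pi * y) = 2 * sin ((pi * x + pi * y) / 2) * sin ((pi * y - pi * x) / 2)"
      by (rule cos_diff_cos)
    then have "\<bar>cos (pi * x) - cos (pi * y)\<bar> = 2 * \<bar>sin ((pi * x + pi * y) / 2)\<bar> * \<bar>sin ((pi * y - pi * x) / 2)\<bar>"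
      by (simp add: abs_mult)
    also have "\<dots> \<le> 2 * 1 * \<bar>(pi * y - pi * x) / 2\<bar>"
      by (intro mult_mono abs_sin_x_le_abs_x) auto
    finally show ?thesis by (simp add: abs_minus_commute)
  qed
  also have "\<dots> = pi * \<bar>x - y\<bar>" by (simp add: abs_mult flip: right_diff_distrib)
  finally show ?thesis by linarith
qed

lemma ln_ge_1: "(x::real) \<ge> 3 \<Longrightarrow> ln x \<ge> 1"
  using exp_le by (subst ln_ge_iff) auto

text \<open>Sum over a full run of length @.\<close>
text \<open>
  Truncating the mantissa after \<open>2 * D\<close> digits changes the product by at most $7s^{-D}$. As \<open>q\<close> consecutive
  multiples of $\log_sr$ are nearly equidistributed modulo 1, every truncated mantissa arises for at most
  $4q/s^{2D}$ exponents, and the sum is compared with the sum over all strings of digits.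
\<close>

lemma top_cos_run:
  fixes \<theta> :: real and r s D q :: nat and p :: int
  assumes s: "s \<ge> 3" and r: "r \<ge> 2" and \<theta>: "\<theta> > 0" and D: "D \<ge> 1"
    and q: "q > 0" "coprime p (int q)" "\<bar>real q * log (real s) (real r) - of_int p\<bar> \<le> 1 / real q"
    and qs: "s ^ (2 * D) \<le> q"
  shows "(\<Sum>i<q. top_cos s D (real r ^ i * \<theta>)) \<le> real q * (11 * real s * sqrt (1 / 2) ^ D)"
proof -
  \<comment> \<open>The last \<open>D\<close> of the \<open>2 * D\<close> digits absorb the Lipschitz constant of the product, of order \<open>s ^ D\<close>.\<close>
  define n where "n = 2 * D"
  have n': "n = Suc (n - 1)" using D by (simp add: n_def)
  then have n'': "x ^ n = x * x ^ (n - 1)" for x :: "'a :: monoid_mult" by (metis power_Suc)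
  define \<kappa> where "\<kappa> = sqrt (1 / 2)"
  define \<omega> where "\<omega> = log (real s) (real r)"
  define \<tau> where "\<tau> = log (real s) \<theta>"
  define v where "v i = real s powr frac (\<tau> + real i * \<omega>)" for i :: nat
  have s1: "real s > 1" "real s > 0" using s by auto
  have lnS: "ln (real s) \<ge> 1" using s by (intro ln_ge_1) auto
  have logr: "log (real s) (real r ^ i * \<theta>) = \<tau> + real i * \<omega>" for i
    using r \<theta> s1 by (simp add: \<tau>_def \<omega>_def log_mult log_nat_power)
  have v: "1 \<le> v i" "v i < real s" for i
  proof -
    have "real s powr 0 \<le> v i" unfolding v_def using s1 by (intro powr_mono frac_ge_0) auto
    then show "1 \<le> v i" using s1 by simp
    have "v i < real s powr 1" unfolding v_def using s1 frac_lt_1 by (intro powr_less_mono) auto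
    then show "v i < real s" using s1 by simp
  qed
  define g where "g i = nat \<lfloor>real s ^ n * v i\<rfloor>" for i
  have g: "real (g i) \<le> real s ^ n * v i" "real s ^ n * v i < real (g i) + 1" for i
  proof -
    have "0 \<le> real s ^ n * v i" using v(1)[of i] s1 by auto
    then show "real (g i) \<le> real s ^ n * v i" "real s ^ n * v i < real (g i) + 1"
      unfolding g_def by linarith+
  qed
  have gran: "s ^ n \<le> g i \<and> g i < s ^ 2 * s ^ (n - 1)" for i
  proof
    have "real s ^ n * 1 \<le> real s ^ n * v i" using v(1)[of i] by (intro mult_left_mono) auto
    then have "int (s ^ n) \<le> \<lfloor>real s ^ n * v i\<rfloor>" by (simp add: le_floor_iff)
    then show "s ^ n \<le> g i" unfolding g_def by linarith
    have "real s ^ n * v i < real s ^ n * real s" using v(2)[of i] s1 by (intro mult_strict_left_mono) auto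
    then have "real (g i) < real s ^ n * real s" using g(1)[of i] by linarith
    then have "real (g i) < real (s ^ n * s)" by simp
    then have "g i < s ^ n * s" by (simp only: of_nat_less_iff)
    moreover have "s ^ n * s = s ^ 2 * s ^ (n - 1)" by (simp add: n'' power2_eq_square mult_ac)
    ultimately show "g i < s ^ 2 * s ^ (n - 1)" by simp
  qed
  have sn: "real s ^ n = real s ^ D * real s ^ D" by (simp add: n_def mult_2 power_add)
  define U where "U g = (\<Prod>i<D. \<bar>cos (pi * (real g / real s ^ (n - 1 - i)))\<bar>)" for g :: nat
  have U0: "U g \<ge> 0" for g by (auto simp: U_def intro!: prod_nonneg)
  have Ualt: "U g = (\<Prod>d = 1..D. \<bar>cos (pi * (real s ^ d * (real g / real s ^ n)))\<bar>)" for g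
  proof -
    have "(\<Prod>d = 1..D. \<bar>cos (pi * (real s ^ d * (real g / real s ^ n)))\<bar>)
        = (\<Prod>i<D. \<bar>cos (pi * (real s ^ Suc i * (real g / real s ^ n)))\<bar>)"
      by (simp only: prod.atLeast1_atMost_eq One_nat_def)
    also have "\<dots> = U g" unfolding U_def
    proof (intro prod.cong refl)
      fix i assume "i \<in> {..<D}"
      then have "n = Suc i + (n - 1 - i)" by (auto simp: n_def)
      then have "real s ^ n = real s ^ Suc i * real s ^ (n - 1 - i)" by (metis power_add)
      then have "real s ^ Suc i * (real g / real s ^ n) = real g / real s ^ (n - 1 - i)"
        using s1 by (simp add: field_simps)
      then show "\<bar>cos (pi * (real s ^ Suc i * (real g / real s ^ n)))\<bar> = \<bar>cos (pi * (real g / real s ^ (n - 1 - i)))\<bar>"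
        by simp
    qed
    finally show ?thesis by simp
  qed
  have approx: "top_cos s D (real r ^ i * \<theta>) \<le> U (g i) + 7 * (1 / real s ^ D)" for i
  proof -
    have "\<bar>top_cos s D (real r ^ i * \<theta>) - U (g i)\<bar>
        \<le> (\<Sum>d = 1..D. \<bar>\<bar>cos (pi * (real s ^ d * v i))\<bar> - \<bar>cos (pi * (real s ^ d * (real (g i) / real s ^ n)))\<bar>\<bar>)"
      unfolding top_cos_def Ualt logr v_def[symmetric]
      using norm_prod_diff[of "{1..D}" "\<lambda>d. \<bar>cos (pi * (real s ^ d * v i))\<bar>" "\<lambda>d. \<bar>cos (pi * (real s ^ d * (real (g i) / real s ^ n)))\<bar>"]
      by (simp)
    also have "\<dots> \<le> (\<Sum>d = 1..D. pi * (real s ^ d * (1 / real s ^ n)))"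
    proof (rule sum_mono)
      fix d
      have "\<bar>v i - real (g i) / real s ^ n\<bar> \<le> 1 / real s ^ n"
      proof -
        have "v i - real (g i) / real s ^ n = (real s ^ n * v i - real (g i)) / real s ^ n"
          using s1 by (simp add: diff_divide_distrib)
        also have "\<bar>\<dots>\<bar> \<le> 1 / real s ^ n"
          unfolding abs_divide using g[of i] s1 by (auto intro!: divide_right_mono)
        finally show ?thesis .
      qed
      then have "real s ^ d * \<bar>v i - real (g i) / real s ^ n\<bar> \<le> real s ^ d * (1 / real s ^ n)"
        by (intro mult_left_mono) auto
      moreover have "real s ^ d * v i - real s ^ d * (real (g i) / real s ^ n) = real s ^ d * (v i - real (g i) / real s ^ n)"
        by (simp only: right_diff_distrib)
      then have "\<bar>real s ^ d * v i - real s ^ d * (real (g i) / real s ^ n)\<bar> = real s ^ d * \<bar>v i - real (g i) / real s ^ n\<bar>"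
        by (simp only: abs_mult) simp
      ultimately have "pi * \<bar>real s ^ d * v i - real s ^ d * (real (g i) / real s ^ n)\<bar> \<le> pi * (real s ^ d * (1 / real s ^ n))"
        by (intro mult_left_mono) auto
      then show "\<bar>\<bar>cos (pi * (real s ^ d * v i))\<bar> - \<bar>cos (pi * (real s ^ d * (real (g i) / real s ^ n)))\<bar>\<bar>
          \<le> pi * (real s ^ d * (1 / real s ^ n))"
        using abs_cos_diff_le[of "real s ^ d * v i" "real s ^ d * (real (g i) / real s ^ n)"] by linarith
    qed
    also have "\<dots> = pi / real s ^ n * (\<Sum>d = 1..D. real s ^ d)"
      by (simp add: sum_distrib_left)
    also have "\<dots> \<le> pi / real s ^ n * (2 * real s ^ D)"
    proof (intro mult_left_mono)
      show "(\<Sum>d = 1..D. real s ^ d) \<le> 2 * real s ^ D"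
      proof (induction D)
        case (Suc D)
        have "2 * real s ^ D \<le> real s * real s ^ D" using s by (intro mult_right_mono) auto
        then show ?case using Suc by simp
      qed simp
    qed auto
    also have "\<dots> = 2 * pi * (1 / real s ^ D)" using s1 by (simp add: sn)
    also have "\<dots> \<le> 7 * (1 / real s ^ D)" using pi_less_4 pi_approx by (intro mult_right_mono) auto
    finally show ?thesis by linarith
  qed
  define A where "A a = {i\<in>{..<q}. g i = a}" for a
  have cardA: "real (card (A a)) \<le> 4 * real q / real s ^ n" if a: "s ^ n \<le> a" for a
  proof -
    have "real (s ^ n) \<le> real a" using a by (simp only: of_nat_le_iff)
    moreover have "real (s ^ n) > 0" using s1 by simp
    ultimately have apos: "real a > 0" "real a \<ge> real s ^ n" by (linarith, simp)
    define x y where "x = log (real s) (real a / real s ^ n)" and "y = log (real s) ((real a + 1) / real s ^ n)"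
    have yx: "y - x \<le> 1 / real s ^ n"
    proof -
      have "y - x = log (real s) ((real a + 1) / real a)"
        unfolding x_def y_def using apos s1 by (simp add: log_divide)
      also have "\<dots> = ln (1 + 1 / real a) / ln (real s)" using apos by (simp add: log_def add_divide_distrib)
      also have "\<dots> \<le> (1 / real a) / 1" using apos lnS by (intro frac_le ln_add_one_self_le_self) auto
      also have "\<dots> \<le> 1 / real s ^ n" using apos s1 by (simp add: frac_le)
      finally show ?thesis .
    qed
    have xy: "x \<le> y" unfolding x_def y_def using apos s1 by (intro log_mono divide_right_mono) auto
    have "A a \<subseteq> {i\<in>{..<q}. frac (\<tau> + real i * \<omega>) \<in> {x..<y}}"
    proof
      fix i assume "i \<in> A a"
      then have i: "i < q" "real a \<le> real s ^ n * v i" "real s ^ n * v i < real a + 1"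
        using g[of i] by (auto simp: A_def)
      have "log (real s) (v i) = frac (\<tau> + real i * \<omega>)" using s1 by (simp add: v_def log_powr)
      moreover have "x \<le> log (real s) (v i)"
        unfolding x_def using apos s1 i by (intro log_mono) (auto simp: field_simps)
      moreover have "log (real s) (v i) < y"
        unfolding y_def using apos s1 i v(1)[of i] by (intro log_less) (auto simp: field_simps)
      ultimately show "i \<in> {i\<in>{..<q}. frac (\<tau> + real i * \<omega>) \<in> {x..<y}}" using i by auto
    qed
    then have "real (card (A a)) \<le> real (card {i\<in>{..<q}. frac (\<tau> + real i * \<omega>) \<in> {x..<y}})"
      by (intro of_nat_mono card_mono) auto
    also have "\<dots> \<le> real q * (y - x) + 3" using q xy by (intro rotation_count) (auto simp: \<omega>_def)
    also have "\<dots> \<le> real q * (1 / real s ^ n) + 3 * (real q / real s ^ n)"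
    proof (intro add_mono mult_left_mono yx)
      have "real (s ^ n) \<le> real q" using qs n_def by (simp only: of_nat_le_iff)
      then show "3 \<le> 3 * (real q / real s ^ n)" using s1 by (simp add: field_simps)
    qed auto
    finally show ?thesis by simp
  qed
  have "(\<Sum>i<q. U (g i)) = (\<Sum>a<s ^ 2 * s ^ (n - 1). \<Sum>i\<in>A a. U (g i))"
    unfolding A_def
  proof (rule sum.group[symmetric])
    show "g ` {..<q} \<subseteq> {..<s ^ 2 * s ^ (n - 1)}" using gran by blast
  qed auto
  also have "\<dots> = (\<Sum>a<s ^ 2 * s ^ (n - 1). real (card (A a)) * U a)"
    by (intro sum.cong refl) (simp add: A_def)
  also have "\<dots> \<le> (\<Sum>a<s ^ 2 * s ^ (n - 1). (4 * real q / real s ^ n) * U a)"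
  proof (intro sum_mono mult_right_mono U0)
    fix a
    show "real (card (A a)) \<le> 4 * real q / real s ^ n"
    proof (cases "s ^ n \<le> a")
      case False
      then have "A a = {}" using gran by (auto simp: A_def)
      then show ?thesis by simp
    qed (rule cardA)
  qed
  also have "\<dots> = (4 * real q / real s ^ n) * (\<Sum>a<s ^ 2 * s ^ (n - 1). U a)" by (simp add: sum_distrib_left)
  also have "\<dots> \<le> (4 * real q / real s ^ n) * (real (s ^ 2) * (real s ^ (n - 1) * \<kappa> ^ D))"
    unfolding U_def \<kappa>_def using s D by (intro mult_left_mono sum_cos_prod_periods_le) (auto simp: n_def)
  also have "\<dots> = 4 * real q * real s * \<kappa> ^ D"
  proof -
    have "real s ^ n = real s * real s ^ (n - 1)" by (rule n'')
    then show ?thesis using s1 by (simp add: power2_eq_square)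
  qed
  finally have 1: "(\<Sum>i<q. U (g i)) \<le> 4 * real q * real s * \<kappa> ^ D" .
  have "1 / real s ^ D = (1 / real s) ^ D" by (simp add: power_divide)
  also have "\<dots> \<le> \<kappa> ^ D"
  proof (rule power_mono)
    have "1 / real s \<le> 1 / 2" using s by (simp add: field_simps)
    also have "\<dots> \<le> \<kappa>" unfolding \<kappa>_def by (rule real_le_rsqrt) (simp add: power2_eq_square)
    finally show "1 / real s \<le> \<kappa>" .
  qed auto
  also have "\<dots> \<le> real s * \<kappa> ^ D" using s by (simp add: \<kappa>_def)
  finally have 2: "1 / real s ^ D \<le> real s * \<kappa> ^ D" .
  have "(\<Sum>i<q. top_cos s D (real r ^ i * \<theta>)) \<le> (\<Sum>i<q. U (g i) + 7 * (1 / real s ^ D))"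
    by (intro sum_mono approx)
  also have "\<dots> = (\<Sum>i<q. U (g i)) + real q * (7 * (1 / real s ^ D))" by (simp add: sum.distrib)
  also have "\<dots> \<le> 4 * real q * real s * \<kappa> ^ D + real q * (7 * (real s * \<kappa> ^ D))"
    using 1 2 by (intro add_mono mult_left_mono) auto
  also have "\<dots> = real q * (11 * real s * \<kappa> ^ D)" by (simp add: algebra_simps)
  finally show ?thesis by (simp add: \<kappa>_def)
qed

text \<open>
  The denominator \<open>q\<close> given by Dirichlet's theorem is at most \<open>Q\<close>, and the lower bound for
  the linear form forces $q>e^{h^3}\ge s^{2D}$. The sum is then split into runs of length \<open>q\<close>.
\<close>

lemma top_cos_sum:
  fixes \<theta> :: real and r s D h Q N :: nat
  assumes s: "s \<ge> 3" "ln (real s) \<le> real h" and r: "r \<ge> 2" and \<theta>: "\<theta> > 0"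
    and D: "D \<ge> 1" "2 * D \<le> h\<^sup>2" and Q: "real h * exp (real h ^ 13) < real Q"
    and lf: "\<And>p q :: nat. coprime p q \<Longrightarrow> 0 < q \<Longrightarrow> real q \<le> exp (real h ^ 3) \<Longrightarrow>
      \<bar>real q * ln (real r) - real p * ln (real s)\<bar> \<ge> exp (- (real h ^ 13))"
  shows "(\<Sum>i<N. top_cos s D (real r ^ i * \<theta>)) \<le> (real N + real Q) * (11 * real s * sqrt (1 / 2) ^ D)"
proof -
  define \<omega> where "\<omega> = log (real s) (real r)"
  define B where "B = 11 * real s * sqrt (1 / 2) ^ D"
  have s1: "real s > 1" using s by auto
  have lnS: "ln (real s) \<ge> 1" using s by (intro ln_ge_1) auto
  have "0 \<le> real h * exp (real h ^ 13)" by simp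
  then have "real Q > 0" using Q by linarith
  then have Q0: "Q > 0" by simp
  obtain p q' where pq: "coprime p q'" "0 < q'" "q' \<le> int Q" "\<bar>of_int q' * \<omega> - of_int p\<bar> < 1 / real Q"
    using Dirichlet_approx_coprime[OF Q0] by metis
  define q where "q = nat q'"
  have q: "q' = int q" "0 < q" "q \<le> Q" using pq by (auto simp: q_def)
  have close: "\<bar>real q * \<omega> - of_int p\<bar> < 1 / real Q" using pq q by simp
  also have "\<dots> \<le> 1 / real q" using q by (intro divide_left_mono) auto
  finally have close': "\<bar>real q * \<omega> - of_int p\<bar> \<le> 1 / real q" by simp
  have "\<omega> > 0" unfolding \<omega>_def using s1 r by simp
  then have "real q * \<omega> > 0" using q by simp
  moreover have "1 / real Q \<le> 1" using Q0 by simp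
  ultimately have "real_of_int p > -1" using close by linarith
  then have p0: "p \<ge> 0" by linarith
  have big: "real q > exp (real h ^ 3)"
  proof (rule ccontr)
    assume "\<not> ?thesis"
    moreover have "coprime (nat p) q" using pq(1) p0 q(1) by (simp flip: coprime_int_iff)
    ultimately have "exp (- (real h ^ 13)) \<le> \<bar>real q * ln (real r) - real (nat p) * ln (real s)\<bar>"
      using q by (intro lf) auto
    also have "\<dots> = \<bar>(real q * \<omega> - of_int p) * ln (real s)\<bar>"
      using p0 lnS by (simp add: \<omega>_def log_def left_diff_distrib)
    also have "\<dots> = \<bar>real q * \<omega> - of_int p\<bar> * ln (real s)" using lnS by (simp add: abs_mult)
    also have "\<dots> \<le> (1 / real Q) * real h" using close s lnS by (intro mult_mono) auto
    also have "\<dots> < exp (- (real h ^ 13))"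
    proof -
      have "real h < real Q * exp (- (real h ^ 13))" using Q by (simp add: exp_minus field_simps)
      then show ?thesis using Q0 by (simp add: field_simps)
    qed
    finally show False by simp
  qed
  have "s ^ (2 * D) \<le> q"
  proof -
    have "real s ^ (2 * D) = exp (real (2 * D) * ln (real s))" unfolding exp_of_nat_mult using s1 by simp
    also have "\<dots> \<le> exp (real (h\<^sup>2) * real h)"
    proof -
      have "real (2 * D) \<le> real (h\<^sup>2)" using D(2) by (simp only: of_nat_le_iff)
      then have "real (2 * D) * ln (real s) \<le> real (h\<^sup>2) * real h" using s lnS by (intro mult_mono) auto
      then show ?thesis by simp
    qed
    also have "real (h\<^sup>2) * real h = real h ^ 3" by (simp add: eval_nat_numeral)
    finally have "real s ^ (2 * D) \<le> real q" using big by linarith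
    then show ?thesis by simp
  qed
  then have run: "(\<Sum>i<q. top_cos s D (real r ^ i * \<theta>')) \<le> real q * B" if "\<theta>' > 0" for \<theta>'
    unfolding B_def using s r D q pq(1) close' that by (intro top_cos_run) (auto simp: \<omega>_def)
  define M where "M = N div q + 1"
  have "N \<le> M * q" unfolding M_def using dividend_less_times_div[OF q(2), of N] by (simp add: mult.commute)
  then have "(\<Sum>i<N. top_cos s D (real r ^ i * \<theta>)) \<le> (\<Sum>i<M * q. top_cos s D (real r ^ i * \<theta>))"
    by (intro sum_mono2) (auto simp: top_cos_nonneg)
  also have "\<dots> = (\<Sum>m<M. \<Sum>i<q. top_cos s D (real r ^ i * (real r ^ (m * q) * \<theta>)))"
    by (simp add: sum_nat_blocks power_add mult_ac)
  also have "\<dots> \<le> (\<Sum>m<M. real q * B)" using r \<theta> by (intro sum_mono run) auto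
  also have "\<dots> = real (M * q) * B" by simp
  also have "\<dots> \<le> (real N + real Q) * B"
  proof (intro mult_right_mono)
    have "M * q \<le> N + q" by (simp add: M_def)
    then show "real (M * q) \<le> real N + real Q" using q(3) by linarith
  qed (simp add: B_def)
  finally show ?thesis by (simp add: B_def)
qed

section \<open>Discrepancy and exponential sums\<close>

definition fejer :: "nat \<Rightarrow> real \<Rightarrow> real" where
  "fejer n x = 1 + 2 * (\<Sum>t = 1..n. (1 - real t / real n) * cos (2 * pi * real t * x))"

text \<open>
  The primitive of the Fejer kernel. It increases, its difference to \<open>x\<close> is a trigonometric polynomial
  of degree less than \<open>n\<close>, and away from the integers it is close to $\lfloor x\rfloor+1/2$.
\<close>

definition fejer_int :: "nat \<Rightarrow> real \<Rightarrow> real" where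
  "fejer_int n x = x + (\<Sum>t = 1..n. (1 - real t / real n) / (pi * real t) * sin (2 * pi * real t * x))"

lemma fejer_square_aux:
  fixes \<theta> :: real
  shows "real n + 2 * (\<Sum>t = 1..n. (real n - real t) * cos (real t * \<theta>))
    = (\<Sum>k<n. cos (real k * \<theta>))\<^sup>2 + (\<Sum>k<n. sin (real k * \<theta>))\<^sup>2"
proof (induction n)
  case (Suc n)
  define C S where "C = (\<Sum>k<n. cos (real k * \<theta>))" and "S = (\<Sum>k<n. sin (real k * \<theta>))"
  have "(\<Sum>t = 1..Suc n. (real (Suc n) - real t) * cos (real t * \<theta>))
      = (\<Sum>t = 1..n. (real n - real t) * cos (real t * \<theta>) + cos (real t * \<theta>))"
    by (simp add: algebra_simps)
  also have "\<dots> = (\<Sum>t = 1..n. (real n - real t) * cos (real t * \<theta>)) + (\<Sum>t = 1..n. cos (real t * \<theta>))"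
    by (rule sum.distrib)
  finally have 1: "(\<Sum>t = 1..Suc n. (real (Suc n) - real t) * cos (real t * \<theta>))
      = (\<Sum>t = 1..n. (real n - real t) * cos (real t * \<theta>)) + (\<Sum>t = 1..n. cos (real t * \<theta>))" .
  have "(\<Sum>t = 1..n. cos (real t * \<theta>)) = (\<Sum>k<n. cos (real (Suc k) * \<theta>))"
    by (simp only: sum.atLeast1_atMost_eq One_nat_def)
  also have "\<dots> = (\<Sum>k<n. cos (real (n - k) * \<theta>))"
    by (subst sum.nat_diff_reindex[symmetric]) (auto intro!: sum.cong simp: Suc_diff_Suc)
  also have "\<dots> = (\<Sum>k<n. cos (real n * \<theta>) * cos (real k * \<theta>) + sin (real n * \<theta>) * sin (real k * \<theta>))"
    by (intro sum.cong refl) (simp add: of_nat_diff left_diff_distrib cos_diff)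
  also have "\<dots> = cos (real n * \<theta>) * C + sin (real n * \<theta>) * S"
    by (simp add: C_def S_def sum.distrib sum_distrib_left)
  finally have 2: "(\<Sum>t = 1..n. cos (real t * \<theta>)) = cos (real n * \<theta>) * C + sin (real n * \<theta>) * S" .
  have "(C + cos (real n * \<theta>))\<^sup>2 + (S + sin (real n * \<theta>))\<^sup>2
      = C\<^sup>2 + S\<^sup>2 + 2 * (cos (real n * \<theta>) * C + sin (real n * \<theta>) * S) + ((cos (real n * \<theta>))\<^sup>2 + (sin (real n * \<theta>))\<^sup>2)"
    by (simp add: power2_eq_square algebra_simps)
  also have "(cos (real n * \<theta>))\<^sup>2 + (sin (real n * \<theta>))\<^sup>2 = 1" by simp
  finally have 3: "(C + cos (real n * \<theta>))\<^sup>2 + (S + sin (real n * \<theta>))\<^sup>2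
      = C\<^sup>2 + S\<^sup>2 + 2 * (cos (real n * \<theta>) * C + sin (real n * \<theta>) * S) + 1" .
  show ?case
    using Suc.IH unfolding 1 2 sum.lessThan_Suc C_def[symmetric] S_def[symmetric] 3 by simp
qed simp

lemma fejer_eq_square:
  assumes "n > 0"
  shows "real n * fejer n x = (\<Sum>k<n. cos (real k * (2 * pi * x)))\<^sup>2 + (\<Sum>k<n. sin (real k * (2 * pi * x)))\<^sup>2"
proof -
  have "real n * fejer n x = real n + 2 * (\<Sum>t = 1..n. real n * ((1 - real t / real n) * cos (2 * pi * real t * x)))"
    by (simp add: fejer_def distrib_left sum_distrib_left mult.left_commute)
  also have "(\<Sum>t = 1..n. real n * ((1 - real t / real n) * cos (2 * pi * real t * x)))
      = (\<Sum>t = 1..n. (real n - real t) * cos (real t * (2 * pi * x)))"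
  proof (intro sum.cong refl)
    fix t
    have "real n * (1 - real t / real n) = real n - real t" using assms by (simp add: field_simps)
    moreover have "2 * pi * real t * x = real t * (2 * pi * x)" by simp
    ultimately show "real n * ((1 - real t / real n) * cos (2 * pi * real t * x)) = (real n - real t) * cos (real t * (2 * pi * x))"
      by (simp only: mult.assoc[symmetric])
  qed
  finally show ?thesis using fejer_square_aux[of n "2 * pi * x"] by simp
qed

lemma fejer_nonneg: "n > 0 \<Longrightarrow> fejer n x \<ge> 0"
  using fejer_eq_square[of n x] by (metis of_nat_0_less_iff sum_power2_ge_zero zero_le_mult_iff linorder_not_less)

lemma half_le_sin:
  fixes y :: real
  assumes "0 \<le> y" "y \<le> pi / 2"
  shows "y / 2 \<le> sin y"
proof -
  have cos_half: "(cos (y / 2))\<^sup>2 \<ge> 1 / 2"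
  proof -
    have "cos y \<ge> 0" using assms by (intro cos_ge_zero) auto
    moreover have "cos y = 2 * (cos (y / 2))\<^sup>2 - 1" using cos_double_cos[of "y / 2"] by simp
    ultimately show ?thesis by linarith
  qed
  have c0: "cos (y / 2) > 0" using assms pi_gt_zero by (intro cos_gt_zero_pi) linarith+
  have s0: "sin (y / 2) \<ge> 0" using assms pi_gt_zero by (intro sin_ge_zero) linarith+
  have "\<bar>y / 2\<bar> \<le> \<bar>tan (y / 2)\<bar>" using assms pi_gt_zero by (intro abs_tan_ge) linarith
  also have "\<bar>tan (y / 2)\<bar> = sin (y / 2) / cos (y / 2)" using c0 s0 by (simp add: tan_def)
  finally have "y / 2 * cos (y / 2) \<le> sin (y / 2)" using assms c0 by (simp add: field_simps)
  then have "y / 2 * cos (y / 2) * cos (y / 2) \<le> sin (y / 2) * cos (y / 2)"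
    using c0 by (intro mult_right_mono) auto
  moreover have "sin y = 2 * (sin (y / 2) * cos (y / 2))" using sin_double[of "y / 2"] by simp
  moreover have "y * (1 / 2) \<le> y * (cos (y / 2))\<^sup>2" using cos_half assms by (intro mult_left_mono) auto
  ultimately show ?thesis by (simp add: power2_eq_square)
qed

lemma trig_sum_square_le:
  fixes \<theta> :: real
  shows "((\<Sum>k<n. cos (real k * \<theta>))\<^sup>2 + (\<Sum>k<n. sin (real k * \<theta>))\<^sup>2) * (sin (\<theta> / 2))\<^sup>2 \<le> 1"
proof -
  define C S b where "C = (\<Sum>k<n. cos (real k * \<theta>))" and "S = (\<Sum>k<n. sin (real k * \<theta>))" and "b = \<theta> / 2"
  define a where "a = real n * \<theta> - b"
  have ang: "real k * \<theta> + b = (real (Suc k) * \<theta> - b)" for k by (simp add: b_def algebra_simps)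
  have "2 * sin b * C = (\<Sum>k<n. sin (real (Suc k) * \<theta> - b) - sin (real k * \<theta> - b))"
    unfolding C_def sum_distrib_left
  proof (intro sum.cong refl)
    fix k show "2 * sin b * cos (real k * \<theta>) = sin (real (Suc k) * \<theta> - b) - sin (real k * \<theta> - b)"
      unfolding ang[symmetric] by (simp add: sin_add sin_diff)
  qed
  also have "\<dots> = sin a + sin b"
    using sum_lessThan_telescope[of "\<lambda>k. sin (real k * \<theta> - b)" n] by (simp add: a_def)
  finally have C: "2 * sin b * C = sin a + sin b" .
  have "2 * sin b * S = (\<Sum>k<n. cos (real k * \<theta> - b) - cos (real (Suc k) * \<theta> - b))"
    unfolding S_def sum_distrib_left
  proof (intro sum.cong refl)
    fix k show "2 * sin b * sin (real k * \<theta>) = cos (real k * \<theta> - b) - cos (real (Suc k) * \<theta> - b)"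
      unfolding ang[symmetric] by (simp add: cos_add cos_diff)
  qed
  also have "\<dots> = cos b - cos a"
    using sum_lessThan_telescope[of "\<lambda>k. - cos (real k * \<theta> - b)" n] by (simp add: a_def)
  finally have S: "2 * sin b * S = cos b - cos a" .
  have "4 * ((C\<^sup>2 + S\<^sup>2) * (sin b)\<^sup>2) = (2 * sin b * C)\<^sup>2 + (2 * sin b * S)\<^sup>2"
    by (simp add: power_mult_distrib algebra_simps)
  also have "\<dots> = ((sin a)\<^sup>2 + (cos a)\<^sup>2) + ((sin b)\<^sup>2 + (cos b)\<^sup>2) - 2 * (cos a * cos b - sin a * sin b)"
  proof -
    have "(x + y)\<^sup>2 + (z - w)\<^sup>2 = (x\<^sup>2 + w\<^sup>2) + (y\<^sup>2 + z\<^sup>2) - 2 * (w * z - x * y)" for x y z w :: real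
      by (simp add: power2_eq_square algebra_simps)
    then show ?thesis unfolding C S .
  qed
  also have "\<dots> = 2 - 2 * cos (a + b)" by (simp add: cos_add)
  also have "\<dots> \<le> 4" using cos_ge_minus_one[of "a + b"] by linarith
  finally show ?thesis by (simp add: C_def S_def b_def)
qed

lemma fejer_upper:
  assumes n: "n > 0" and x: "0 < x" "x \<le> 1 / 2"
  shows "fejer n x \<le> 1 / (2 * real n * x\<^sup>2)"
proof -
  define F where "F = real n * fejer n x"
  have "pi * x \<le> pi / 2" using mult_left_mono[OF x(2), of pi] by simp
  then have "pi * x / 2 \<le> sin (pi * x)" using x by (intro half_le_sin) auto
  moreover have "3 * x / 2 \<le> pi * x / 2" using x pi_gt3 by simp
  ultimately have "3 * x / 2 \<le> sin (pi * x)" by linarith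
  then have "(3 * x / 2)\<^sup>2 \<le> (sin (pi * x))\<^sup>2" using x by (intro power_mono) auto
  moreover have "2 * x\<^sup>2 \<le> (3 * x / 2)\<^sup>2" by (simp add: power2_eq_square)
  ultimately have "2 * x\<^sup>2 \<le> (sin (pi * x))\<^sup>2" by linarith
  moreover have "F \<ge> 0" unfolding F_def using fejer_nonneg[OF n] by simp
  ultimately have "F * (2 * x\<^sup>2) \<le> F * (sin (pi * x))\<^sup>2" by (intro mult_left_mono)
  also have "\<dots> \<le> 1"
    using trig_sum_square_le[where n = n and \<theta> = "2 * pi * x"] fejer_eq_square[OF n, of x] by (simp add: F_def)
  finally show ?thesis using n x by (simp add: F_def field_simps)
qed

lemma fejer_lower:
  assumes n: "n > 0" and x: "\<bar>x\<bar> \<le> 1 / (6 * real n)"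
  shows "fejer n x \<ge> real n / 4"
proof -
  have "cos (real k * (2 * pi * x)) \<ge> 1 / 2" if "k < n" for k
  proof -
    have "real k * (2 * pi * \<bar>x\<bar>) \<le> real n * (2 * pi * (1 / (6 * real n)))"
      using that x by (intro mult_mono) auto
    then have "\<bar>real k * (2 * pi * x)\<bar> \<le> pi / 3" using n by (simp add: abs_mult)
    then have "cos (pi / 3) \<le> cos \<bar>real k * (2 * pi * x)\<bar>"
      using pi_gt_zero by (intro cos_monotone_0_pi_le) linarith+
    then show ?thesis by (simp add: cos_60)
  qed
  then have "(\<Sum>k<n. cos (real k * (2 * pi * x))) \<ge> (\<Sum>k<n. 1 / 2)" by (intro sum_mono) auto
  then have "(real n / 2)\<^sup>2 \<le> (\<Sum>k<n. cos (real k * (2 * pi * x)))\<^sup>2" by (intro power_mono) auto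
  then have "(real n / 2)\<^sup>2 \<le> real n * fejer n x"
    unfolding fejer_eq_square[OF n] using zero_le_power2[of "\<Sum>k<n. sin (real k * (2 * pi * x))"] by linarith
  then show ?thesis using n by (simp add: power2_eq_square)
qed

lemma sin_int_shift: "sin (2 * pi * real t * (x + of_int m)) = sin (2 * pi * real t * x)"
proof -
  have "2 * pi * real t * (x + of_int m) = 2 * pi * real t * x + of_int (int t * m) * (2 * pi)" by (simp add: algebra_simps)
  then show ?thesis by (simp only: sin_add sin_int_2pin cos_int_2pin mult.commute[of "of_int _" "2 * pi"])
qed

lemma cos_int_shift: "cos (2 * pi * real t * (x + of_int m)) = cos (2 * pi * real t * x)"
proof -
  have "2 * pi * real t * (x + of_int m) = 2 * pi * real t * x + of_int (int t * m) * (2 * pi)" by (simp add: algebra_simps)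
  then show ?thesis by (simp only: cos_add sin_int_2pin cos_int_2pin mult.commute[of "of_int _" "2 * pi"])
qed

lemma fejer_int_shift: "fejer_int n (x + of_int m) = fejer_int n x + of_int m"
  by (simp add: fejer_int_def sin_int_shift)

lemma fejer_shift: "fejer n (x + of_int m) = fejer n x"
  by (simp add: fejer_def cos_int_shift)

lemma fejer_int_minus: "fejer_int n (- x) = - fejer_int n x"
  by (simp add: fejer_int_def sum_negf)

lemma fejer_int_reflect: "fejer_int n (1 - x) = 1 - fejer_int n x"
  using fejer_int_shift[of n "- x" 1] by (simp add: fejer_int_minus)

lemma fejer_int_deriv: "(fejer_int n has_real_derivative fejer n x) (at x)"
proof -
  have "((\<lambda>x. fejer_int n x) has_real_derivative
      1 + (\<Sum>t = 1..n. (1 - real t / real n) / (pi * real t) * (cos (2 * pi * real t * x) * (2 * pi * real t)))) (at x)"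
    unfolding fejer_int_def
  proof (intro DERIV_add DERIV_ident DERIV_sum DERIV_cmult)
    fix t
    show "((\<lambda>x. sin (2 * pi * real t * x)) has_real_derivative cos (2 * pi * real t * x) * (2 * pi * real t)) (at x)"
      by (auto intro!: derivative_eq_intros)
  qed
  also have "(\<Sum>t = 1..n. (1 - real t / real n) / (pi * real t) * (cos (2 * pi * real t * x) * (2 * pi * real t)))
      = (\<Sum>t = 1..n. 2 * ((1 - real t / real n) * cos (2 * pi * real t * x)))"
  proof (intro sum.cong refl)
    fix t assume "t \<in> {1..n}"
    then have "w / (pi * real t) * (c * (2 * pi * real t)) = 2 * (w * c)" for w c by simp
    then show "(1 - real t / real n) / (pi * real t) * (cos (2 * pi * real t * x) * (2 * pi * real t))
        = 2 * ((1 - real t / real n) * cos (2 * pi * real t * x))" .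
  qed
  finally show ?thesis by (simp only: fejer_def sum_distrib_left)
qed

lemma fejer_int_mono: "n > 0 \<Longrightarrow> x \<le> y \<Longrightarrow> fejer_int n x \<le> fejer_int n y"
  by (rule DERIV_nonneg_imp_nondecreasing[of x y]) (auto intro: fejer_int_deriv fejer_nonneg)

lemma fejer_int_half: "fejer_int n (1 / 2) = 1 / 2"
  using fejer_int_reflect[of n "1 / 2"] by simp

lemma fejer_int_0: "fejer_int n 0 = 0"
  by (simp add: fejer_int_def)

text \<open>
  The function $y\mapsto\,$\<open>fejer_int n y + 1 / (2 * n * y)\<close> decreases on $(0,1/2]$ because of
  \<open>fejer_upper\<close>, and at $1/2$ the first summand has the value $1/2$ by symmetry.
\<close>

lemma fejer_int_lower:
  assumes n: "n > 0" and x: "0 < x" "x \<le> 1 / 2"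
  shows "\<bar>fejer_int n x - 1 / 2\<bar> \<le> 1 / (2 * real n * x)"
proof -
  define H where "H y = fejer_int n y + 1 / (2 * real n) * inverse y" for y
  have "H (1 / 2) \<le> H x"
  proof (rule DERIV_nonpos_imp_nonincreasing[of x "1 / 2" H])
    fix y assume y: "x \<le> y" "y \<le> 1 / 2"
    have "y \<noteq> 0" using x y by simp
    then have "(inverse has_real_derivative - (inverse y ^ 2)) (at y)"
      using DERIV_inverse[of y UNIV] by (simp add: numeral_2_eq_2)
    then have "(H has_real_derivative fejer n y + 1 / (2 * real n) * (- (inverse y ^ 2))) (at y)"
      unfolding H_def by (intro DERIV_add fejer_int_deriv DERIV_cmult)
    moreover have "fejer n y + 1 / (2 * real n) * (- (inverse y ^ 2)) \<le> 0"
      using fejer_upper[OF n, of y] x y n by (simp add: field_simps power_inverse)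
    ultimately show "\<exists>d. DERIV H y :> d \<and> d \<le> 0" by blast
  qed (use x in auto)
  then have "1 / 2 \<le> fejer_int n x + 1 / (2 * real n * x)"
  proof -
    have "1 / (2 * real n) * inverse x = 1 / (2 * real n * x)" by (simp add: inverse_eq_divide)
    moreover have "1 / (2 * real n) * inverse (1 / 2) \<ge> 0" by simp
    ultimately show ?thesis using \<open>H (1 / 2) \<le> H x\<close> unfolding H_def fejer_int_half by linarith
  qed
  moreover have "fejer_int n x \<le> 1 / 2" using fejer_int_mono[OF n x(2)] fejer_int_half by simp
  ultimately show ?thesis by linarith
qed

text \<open>
  The distance of \<open>fejer_int\<close> to $\lfloor x\rfloor+1/2$ decays like the reciprocal of the distance of \<open>x\<close> to
  the nearest integer. It is bounded on cells of length $1/(3n)$, because on such a cell a translate of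
  the Fejer kernel is at least $n/4$, which allows to count the points in it.
\<close>

lemma fejer_int_frac_close:
  assumes n: "n > 0" and k: "k < 3 * n" "real k / (3 * real n) \<le> frac x" "frac x < real (Suc k) / (3 * real n)"
  shows "\<bar>fejer_int n x - of_int \<lfloor>x\<rfloor> - 1 / 2\<bar> \<le> 3 / real (k + 1) + 3 / real (3 * n - k)"
proof -
  define y where "y = frac x"
  have y: "0 \<le> y" "y < 1" by (auto simp: y_def frac_lt_1)
  have "fejer_int n x = fejer_int n y + of_int \<lfloor>x\<rfloor>"
    using fejer_int_shift[of n y "\<lfloor>x\<rfloor>"] by (simp add: y_def frac_def)
  then have eq: "fejer_int n x - of_int \<lfloor>x\<rfloor> - 1 / 2 = fejer_int n y - 1 / 2" by simp
  have "0 \<le> fejer_int n y" "fejer_int n y \<le> 1"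
    using fejer_int_mono[OF n y(1)] fejer_int_mono[OF n less_imp_le[OF y(2)]] fejer_int_0[of n] fejer_int_reflect[of n 0]
    by auto
  then have triv: "\<bar>fejer_int n y - 1 / 2\<bar> \<le> 1 / 2" by linarith
  have nk: "real (3 * n - k) = 3 * real n - real k" using k by (simp add: of_nat_diff)
  have nk1: "3 * real n - real k \<ge> 1" 
  proof -
    have "real (k + 1) \<le> real (3 * n)" using k(1) by (simp only: of_nat_le_iff)
    then show ?thesis by simp
  qed
  consider "k = 0" | "3 * n - k = 1" | "k \<ge> 1" "3 * n - k \<ge> 2" using k(1) by linarith
  then show ?thesis
  proof cases
    case 1
    then have "(3::real) / real (k + 1) = 3" by simp
    then have "\<bar>fejer_int n y - 1 / 2\<bar> \<le> 3 / real (k + 1)" using triv by simp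
    then show ?thesis unfolding eq by (intro add_increasing2) auto
  next
    case 2
    then have "(3::real) / real (3 * n - k) = 3" by simp
    then have "\<bar>fejer_int n y - 1 / 2\<bar> \<le> 3 / real (3 * n - k)" using triv by simp
    then show ?thesis unfolding eq by (intro add_increasing) auto
  next
    case 3
    have ny: "real k / 3 \<le> real n * y" "real n * y < real (Suc k) / 3"
      using k n by (auto simp: y_def field_simps)
    show ?thesis
    proof (cases "y \<le> 1 / 2")
      case True
      have "real n * y > 0" using ny(1) 3 by linarith
      then have "y > 0" using n by (simp add: zero_less_mult_iff)
      then have "\<bar>fejer_int n y - 1 / 2\<bar> \<le> 1 / (2 * real n * y)" using True by (intro fejer_int_lower n)
      also have "\<dots> \<le> 1 / (2 * (real k / 3))"
      proof (intro divide_left_mono)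
        show "2 * (real k / 3) \<le> 2 * real n * y" using ny by linarith
        show "0 < 2 * real n * y * (2 * (real k / 3))" using 3 \<open>y > 0\<close> n by simp
      qed auto
      also have "\<dots> \<le> 3 / real (k + 1)" using 3 by (simp add: field_simps)
      finally have "\<bar>fejer_int n y - 1 / 2\<bar> \<le> 3 / real (k + 1)" .
      then show ?thesis unfolding eq by (intro add_increasing2) auto
    next
      case False
      have "\<bar>fejer_int n (1 - y) - 1 / 2\<bar> \<le> 1 / (2 * real n * (1 - y))" using False y by (intro fejer_int_lower n) auto
      also have "\<dots> \<le> 1 / (2 * ((3 * real n - real (Suc k)) / 3))"
      proof (intro divide_left_mono)
        show "2 * ((3 * real n - real (Suc k)) / 3) \<le> 2 * real n * (1 - y)" 
        proof -
          have *: "2 * real n * (1 - y) = 2 * real n - 2 * (real n * y)" by (simp add: algebra_simps)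
          have "2 * (real n * y) \<le> 2 * (real (Suc k) / 3)" using ny(2) by (intro mult_left_mono) auto
          moreover have "2 * ((3 * real n - real (Suc k)) / 3) = 2 * real n - 2 * (real (Suc k) / 3)"
            by (simp add: diff_divide_distrib)
          ultimately show ?thesis unfolding * by simp
        qed
        show "0 < 2 * real n * (1 - y) * (2 * ((3 * real n - real (Suc k)) / 3))"
          using y n 3 nk by (intro mult_pos_pos) auto
      qed auto
      also have "\<dots> \<le> 3 / real (3 * n - k)"
      proof -
        define z where "z = 3 * real n - real k"
        have "z \<ge> 2" using 3(2) nk by (simp add: z_def)
        then have "1 / (2 * ((z - 1) / 3)) \<le> 3 / z" by (simp add: field_simps)
        moreover have *: "3 * real n - real (Suc k) = z - 1" by (simp add: z_def)
        ultimately show ?thesis unfolding nk * z_def[symmetric] by simp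
      qed
      finally have "\<bar>fejer_int n y - 1 / 2\<bar> \<le> 3 / real (3 * n - k)"
        using fejer_int_reflect[of n y] by (simp add: abs_minus_commute)
      then show ?thesis unfolding eq by (intro add_increasing) auto
    qed
  qed
qed

lemma e_altdef: "e x = cis (2 * pi * x)"
  by (simp add: e_def cis_conv_exp mult_ac)

lemma exp_sum_shift:
  fixes x :: "'j \<Rightarrow> real"
  shows "\<bar>\<Sum>j\<in>J. cos (2 * pi * real t * (x j - a))\<bar> \<le> cmod (\<Sum>j\<in>J. e (real t * x j))"
    and "\<bar>\<Sum>j\<in>J. sin (2 * pi * real t * (x j - a))\<bar> \<le> cmod (\<Sum>j\<in>J. e (real t * x j))"
proof -
  define w where "w = e (- (real t * a)) * (\<Sum>j\<in>J. e (real t * x j))"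
  have w: "w = (\<Sum>j\<in>J. cis (2 * pi * real t * (x j - a)))"
    unfolding w_def sum_distrib_left by (intro sum.cong refl) (simp add: e_altdef cis_mult algebra_simps)
  have "cmod w = cmod (\<Sum>j\<in>J. e (real t * x j))" by (simp add: w_def norm_mult e_altdef)
  moreover have "Re w = (\<Sum>j\<in>J. cos (2 * pi * real t * (x j - a)))" "Im w = (\<Sum>j\<in>J. sin (2 * pi * real t * (x j - a)))"
    unfolding w by simp_all
  ultimately show "\<bar>\<Sum>j\<in>J. cos (2 * pi * real t * (x j - a))\<bar> \<le> cmod (\<Sum>j\<in>J. e (real t * x j))"
    "\<bar>\<Sum>j\<in>J. sin (2 * pi * real t * (x j - a))\<bar> \<le> cmod (\<Sum>j\<in>J. e (real t * x j))"
    using abs_Re_le_cmod[of w] abs_Im_le_cmod[of w] by auto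
qed

lemma sum_reciprocals_le:
  assumes "N > 0"
  shows "(\<Sum>k<N. 3 / real (k + 1) + 3 / real (N - k)) \<le> 6 * (1 + ln (real N))"
proof -
  have "(\<Sum>k<N. 3 / real (N - k)) = (\<Sum>k<N. 3 / real (k + 1))"
    by (subst sum.nat_diff_reindex[symmetric]) (auto intro!: sum.cong simp: Suc_diff_Suc)
  then have "(\<Sum>k<N. 3 / real (k + 1) + 3 / real (N - k)) = 6 * (\<Sum>k<N. 1 / real (k + 1))"
    by (simp add: sum.distrib sum_distrib_left)
  also have "(\<Sum>k<N. 1 / real (k + 1)) = harm N" by (simp add: harm_altdef divide_inverse add.commute)
  also have "harm N \<le> 1 + ln (real N)"
    using decseqD[OF decseq_harm_diff_ln, of 0 "N - 1"] assms by (simp add: harm_expand)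
  finally show ?thesis by simp
qed

text \<open>
  The sawtooth \<open>frac x - 1/2\<close> is the trigonometric polynomial \<open>x - fejer_int n x\<close> plus an error that is
  concentrated near the integers. The number of points in a cell of length $1/(3n)$ is at most a constant
  times the mean over the points of a translate of the nonnegative Fejer kernel; summation over the cells
  costs the logarithm.
\<close>

lemma sawtooth_sum_le:
  fixes x :: "'j \<Rightarrow> real"
  assumes J: "finite J" and n: "n > 0"
  defines "W \<equiv> (\<Sum>t = 1..n. cmod (\<Sum>j\<in>J. e (real t * x j)))"
  shows "\<bar>\<Sum>j\<in>J. frac (x j - a) - 1 / 2\<bar> \<le> W + 24 * (1 + ln (3 * real n)) / real n * (real (card J) + 2 * W)"
proof -
  define E where "E j = fejer_int n (x j - a) - of_int \<lfloor>x j - a\<rfloor> - 1 / 2" for j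
  define L where "L = real (card J) + 2 * W"
  have weight: "0 \<le> 1 - real t / real n" "1 - real t / real n \<le> 1" if "t \<in> {1..n}" for t
    using that n by (auto simp: field_simps)
  have local: "(\<Sum>j\<in>J. fejer n (x j - b)) \<le> L" for b
  proof -
    have "(\<Sum>j\<in>J. fejer n (x j - b)) = real (card J) + 2 * (\<Sum>j\<in>J. \<Sum>t = 1..n. (1 - real t / real n) * cos (2 * pi * real t * (x j - b)))"
      by (simp add: fejer_def sum.distrib sum_distrib_left)
    also have "(\<Sum>j\<in>J. \<Sum>t = 1..n. (1 - real t / real n) * cos (2 * pi * real t * (x j - b)))
        = (\<Sum>t = 1..n. (1 - real t / real n) * (\<Sum>j\<in>J. cos (2 * pi * real t * (x j - b))))"
      by (subst sum.swap) (simp add: sum_distrib_left)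
    also have "\<dots> \<le> (\<Sum>t = 1..n. 1 * cmod (\<Sum>j\<in>J. e (real t * x j)))"
    proof (intro sum_mono)
      fix t assume t: "t \<in> {1..n}"
      have "(1 - real t / real n) * (\<Sum>j\<in>J. cos (2 * pi * real t * (x j - b)))
          \<le> (1 - real t / real n) * \<bar>\<Sum>j\<in>J. cos (2 * pi * real t * (x j - b))\<bar>"
        using weight[OF t] by (intro mult_left_mono) auto
      also have "\<dots> \<le> 1 * cmod (\<Sum>j\<in>J. e (real t * x j))"
        using weight[OF t] exp_sum_shift(1) by (intro mult_mono) auto
      finally show "(1 - real t / real n) * (\<Sum>j\<in>J. cos (2 * pi * real t * (x j - b))) \<le> 1 * cmod (\<Sum>j\<in>J. e (real t * x j))" .
    qed
    finally show ?thesis by (simp add: L_def W_def)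
  qed
  define \<kappa> where "\<kappa> j = nat \<lfloor>3 * real n * frac (x j - a)\<rfloor>" for j
  have \<kappa>: "\<kappa> j < 3 * n" "real (\<kappa> j) / (3 * real n) \<le> frac (x j - a)" "frac (x j - a) < real (Suc (\<kappa> j)) / (3 * real n)" for j
  proof -
    have "0 \<le> 3 * real n * frac (x j - a)" by simp
    then have *: "real (\<kappa> j) \<le> 3 * real n * frac (x j - a)" "3 * real n * frac (x j - a) < real (Suc (\<kappa> j))"
      unfolding \<kappa>_def by linarith+
    then show "real (\<kappa> j) / (3 * real n) \<le> frac (x j - a)" "frac (x j - a) < real (Suc (\<kappa> j)) / (3 * real n)"
      using n by (simp_all add: field_simps)
    have "3 * real n * frac (x j - a) < 3 * real n * 1"
      using n frac_lt_1[of "x j - a"] by (intro mult_strict_left_mono) auto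
    then show "\<kappa> j < 3 * n" using * by linarith
  qed
  define A where "A k = {j\<in>J. \<kappa> j = k}" for k
  have cardA: "real (card (A k)) \<le> 4 * L / real n" for k
  proof -
    define b where "b = a + (real k + 1 / 2) / (3 * real n)"
    have "real (card (A k)) * (real n / 4) = (\<Sum>j\<in>A k. real n / 4)" by simp
    also have "\<dots> \<le> (\<Sum>j\<in>A k. fejer n (x j - b))"
    proof (intro sum_mono)
      fix j assume "j \<in> A k"
      then have k: "real k / (3 * real n) \<le> frac (x j - a)" "frac (x j - a) < (real k + 1) / (3 * real n)"
        using \<kappa>[of j] by (auto simp: A_def add.commute)
      define z where "z = frac (x j - a) - (real k + 1 / 2) / (3 * real n)"
      have "z = (frac (x j - a) - real k / (3 * real n)) - 1 / (6 * real n)"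
        using n by (simp add: z_def field_simps)
      moreover have "(real k + 1) / (3 * real n) = real k / (3 * real n) + 2 * (1 / (6 * real n))"
        using n by (simp add: field_simps)
      ultimately have "\<bar>z\<bar> \<le> 1 / (6 * real n)" using k by linarith
      then have "fejer n z \<ge> real n / 4" by (rule fejer_lower[OF n])
      moreover have "x j - b = z + of_int \<lfloor>x j - a\<rfloor>" by (simp add: z_def b_def frac_def)
      ultimately show "real n / 4 \<le> fejer n (x j - b)" by (simp add: fejer_shift)
    qed
    also have "\<dots> \<le> (\<Sum>j\<in>J. fejer n (x j - b))"
      using J fejer_nonneg[OF n] by (intro sum_mono2) (auto simp: A_def)
    also have "\<dots> \<le> L" by (rule local)
    finally show ?thesis using n by (simp add: field_simps)
  qed
  have L0: "L \<ge> 0" by (auto simp: L_def W_def intro!: add_nonneg_nonneg sum_nonneg)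
  have "\<bar>\<Sum>j\<in>J. E j\<bar> \<le> (\<Sum>j\<in>J. 3 / real (\<kappa> j + 1) + 3 / real (3 * n - \<kappa> j))"
    unfolding E_def by (rule order.trans[OF sum_abs], intro sum_mono fejer_int_frac_close n \<kappa>)
  also have "\<dots> = (\<Sum>k<3 * n. \<Sum>j\<in>A k. 3 / real (\<kappa> j + 1) + 3 / real (3 * n - \<kappa> j))"
    unfolding A_def by (rule sum.group[symmetric]) (use J \<kappa> in auto)
  also have "\<dots> = (\<Sum>k<3 * n. real (card (A k)) * (3 / real (k + 1) + 3 / real (3 * n - k)))"
    by (intro sum.cong refl) (simp add: A_def)
  also have "\<dots> \<le> (\<Sum>k<3 * n. (4 * L / real n) * (3 / real (k + 1) + 3 / real (3 * n - k)))"
    by (intro sum_mono mult_right_mono cardA) auto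
  also have "\<dots> = (4 * L / real n) * (\<Sum>k<3 * n. 3 / real (k + 1) + 3 / real (3 * n - k))"
    by (simp only: sum_distrib_left)
  also have "\<dots> \<le> (4 * L / real n) * (6 * (1 + ln (real (3 * n))))"
    using n L0 by (intro mult_left_mono sum_reciprocals_le) auto
  finally have Esum: "\<bar>\<Sum>j\<in>J. E j\<bar> \<le> 24 * (1 + ln (3 * real n)) / real n * L" by (simp add: mult_ac)
  have "\<bar>\<Sum>j\<in>J. fejer_int n (x j - a) - (x j - a)\<bar> \<le> W"
  proof -
    have "(\<Sum>j\<in>J. fejer_int n (x j - a) - (x j - a))
        = (\<Sum>t = 1..n. (1 - real t / real n) / (pi * real t) * (\<Sum>j\<in>J. sin (2 * pi * real t * (x j - a))))"
      unfolding fejer_int_def by (simp add: sum_distrib_left) (rule sum.swap)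
    also have "\<bar>\<dots>\<bar> \<le> (\<Sum>t = 1..n. 1 * cmod (\<Sum>j\<in>J. e (real t * x j)))"
    proof (rule order.trans[OF sum_abs], intro sum_mono, unfold abs_mult, intro mult_mono exp_sum_shift(2))
      fix t assume t: "t \<in> {1..n}"
      have "1 * 1 \<le> pi * real t" using t pi_gt3 by (intro mult_mono) auto
      then have "(1 - real t / real n) / (pi * real t) \<le> 1 / 1" using weight[OF t] by (intro frac_le) auto
      moreover have "(1 - real t / real n) / (pi * real t) \<ge> 0" using weight[OF t] by auto
      ultimately show "\<bar>(1 - real t / real n) / (pi * real t)\<bar> \<le> 1" by simp
    qed auto
    finally show ?thesis by (simp add: W_def)
  qed
  moreover have "(\<Sum>j\<in>J. frac (x j - a) - 1 / 2) = (\<Sum>j\<in>J. E j) - (\<Sum>j\<in>J. fejer_int n (x j - a) - (x j - a))"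
    by (simp add: E_def frac_def algebra_simps flip: sum_subtractf)
  ultimately show ?thesis using Esum by (simp add: L_def)
qed

lemma unit_interval_bounds:
  assumes I: "is_interval I" "I \<subseteq> {0..<1}" "I \<noteq> {}"
  obtains \<alpha> \<beta> :: real where "0 \<le> \<alpha>" "\<alpha> \<le> \<beta>" "\<beta> \<le> 1" "{\<alpha><..<\<beta>} \<subseteq> I" "I \<subseteq> {\<alpha>..\<beta>}"
    "measure lborel I = \<beta> - \<alpha>"
proof -
  define \<alpha> \<beta> where "\<alpha> = Inf I" and "\<beta> = Sup I"
  have bdd: "bdd_below I" "bdd_above I" 
    using I(2) bdd_below_mono[of "{0..<1}" I] bdd_above_mono[of "{0..<1}" I] by auto
  obtain y where y: "y \<in> I" using I by auto
  have sub: "I \<subseteq> {\<alpha>..\<beta>}" unfolding \<alpha>_def \<beta>_def using bdd by (auto intro: cInf_lower cSup_upper)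
  have "0 \<le> \<alpha>" unfolding \<alpha>_def using I by (intro cInf_greatest) auto
  moreover have "\<beta> \<le> 1" unfolding \<beta>_def using I by (intro cSup_least) auto
  moreover have ab: "\<alpha> \<le> \<beta>" using sub y by auto
  moreover have inn: "{\<alpha><..<\<beta>} \<subseteq> I"
  proof
    fix z assume z: "z \<in> {\<alpha><..<\<beta>}"
    obtain u where u: "u \<in> I" "u < z" using z I(3) bdd cInf_less_iff[of I z] by (auto simp: \<alpha>_def)
    obtain v where v: "v \<in> I" "z < v" using z I(3) bdd less_cSup_iff[of I z] by (auto simp: \<beta>_def)
    show "z \<in> I" using I(1) u v unfolding is_interval_1 by (meson less_imp_le)
  qed
  moreover have "measure lborel I = \<beta> - \<alpha>"
  proof -
    have eq: "I = {\<alpha><..<\<beta>} \<union> (I \<inter> {\<alpha>, \<beta>})" using inn sub by (auto simp: less_le)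
    have "finite (I \<inter> {\<alpha>, \<beta>})" by simp
    then have "(I \<inter> {\<alpha>, \<beta>}) \<in> sets borel" by (intro borel_closed finite_imp_closed)
    then have meas: "I \<in> sets borel" by (subst eq) auto
    have fm: "{\<alpha>..\<beta>} \<in> fmeasurable lborel" using ab by (intro fmeasurableI) auto
    then have "I \<in> fmeasurable lborel" by (rule fmeasurableI2) (use sub meas in auto)
    then have "measure lborel {\<alpha><..<\<beta>} \<le> measure lborel I"
      by (intro measure_mono_fmeasurable inn) auto
    moreover have "measure lborel I \<le> measure lborel {\<alpha>..\<beta>}"
      using meas by (intro measure_mono_fmeasurable sub fm) auto
    ultimately show ?thesis using ab by simp
  qed
  ultimately show thesis using that sub by blast
qed

text \<open>
  A weak form of the Erdos-Turan inequality. The indicator function of an interval is a difference of two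
  floor functions, hence of two sawtooth functions up to a linear term.
\<close>

theorem discrepancy_exp_sum_bound:
  fixes x :: "'j \<Rightarrow> real"
  assumes J: "finite J" and n: "n > 0" and I: "is_interval I" "I \<subseteq> {0..<1}"
  defines "W \<equiv> (\<Sum>t = 1..n. cmod (\<Sum>j\<in>J. e (real t * x j)))"
  shows "\<bar>real (card {j\<in>J. frac (x j) \<in> I}) - real (card J) * measure lborel I\<bar>
    \<le> real (card J) / real n + 2 * (W + 24 * (1 + ln (3 * real n)) / real n * (real (card J) + 2 * W))"
proof (cases "I = {}")
  case True
  have "ln (3 * real n) \<ge> 0" "W \<ge> 0" using n by (auto simp: W_def intro!: sum_nonneg)
  then show ?thesis using True by (auto intro!: add_nonneg_nonneg mult_nonneg_nonneg divide_nonneg_nonneg)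
next
  case False
  obtain \<alpha> \<beta> where ab: "0 \<le> \<alpha>" "\<alpha> \<le> \<beta>" "\<beta> \<le> 1" "{\<alpha><..<\<beta>} \<subseteq> I" "I \<subseteq> {\<alpha>..\<beta>}"
    and meas: "measure lborel I = \<beta> - \<alpha>" using unit_interval_bounds[OF I False] .
  define B where "B = W + 24 * (1 + ln (3 * real n)) / real n * (real (card J) + 2 * W)"
  \<comment> \<open>One endpoint is moved by \<open>\<epsilon>\<close>, so that it does not matter which endpoints belong to \<open>I\<close>.\<close>
  define \<epsilon> where "\<epsilon> = 1 / real n"
  define L where "L = real (card J)"
  have \<epsilon>: "\<epsilon> > 0" using n by (simp add: \<epsilon>_def)
  have floor_sum: "\<bar>(\<Sum>j\<in>J. real_of_int (\<lfloor>x j - a\<rfloor> - \<lfloor>x j - b\<rfloor>)) - L * (b - a)\<bar> \<le> 2 * B" for a b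
  proof -
    have "real_of_int (\<lfloor>x j - a\<rfloor> - \<lfloor>x j - b\<rfloor>) = (frac (x j - b) - 1 / 2) - (frac (x j - a) - 1 / 2) + (b - a)" for j
      by (simp add: frac_def)
    then have "(\<Sum>j\<in>J. real_of_int (\<lfloor>x j - a\<rfloor> - \<lfloor>x j - b\<rfloor>))
        = (\<Sum>j\<in>J. frac (x j - b) - 1 / 2) - (\<Sum>j\<in>J. frac (x j - a) - 1 / 2) + L * (b - a)"
      by (simp only: sum.distrib sum_subtractf) (simp add: L_def algebra_simps)
    then show ?thesis
      using sawtooth_sum_le[OF J n, of x a] sawtooth_sum_le[OF J n, of x b] by (simp add: B_def W_def)
  qed
  have count: "real (card {j\<in>J. frac (x j) \<in> I}) = (\<Sum>j\<in>J. of_bool (frac (x j) \<in> I))"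
    using J by (simp add: Int_def)
  have floor_eq: "\<lfloor>x j - a\<rfloor> = \<lfloor>frac (x j) - a\<rfloor> + \<lfloor>x j\<rfloor>" for a j
  proof -
    have *: "x j - a = (frac (x j) - a) + of_int \<lfloor>x j\<rfloor>" by (simp add: frac_def)
    show ?thesis by (subst *) (simp only: floor_add_int[symmetric])
  qed
  have y: "0 \<le> frac (x j)" "frac (x j) < 1" for j by (auto simp: frac_lt_1)
  have upper: "real (card {j\<in>J. frac (x j) \<in> I}) \<le> L * (\<beta> - \<alpha>) + L * \<epsilon> + 2 * B"
  proof -
    have *: "of_bool (frac (x j) \<in> I) \<le> real_of_int (\<lfloor>x j - \<alpha>\<rfloor> - \<lfloor>x j - (\<beta> + \<epsilon>)\<rfloor>)" for j
    proof -
      have "of_bool (frac (x j) \<in> I) \<le> \<lfloor>frac (x j) - \<alpha>\<rfloor> - \<lfloor>frac (x j) - (\<beta> + \<epsilon>)\<rfloor>"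
      proof (cases "frac (x j) \<in> I")
        case True
        then have "\<alpha> \<le> frac (x j)" "frac (x j) \<le> \<beta>" using ab by auto
        then have "\<lfloor>frac (x j) - \<alpha>\<rfloor> \<ge> 0" "\<lfloor>frac (x j) - (\<beta> + \<epsilon>)\<rfloor> < 0" using \<epsilon> by (auto simp: floor_less_iff)
        moreover have "of_bool (frac (x j) \<in> I) = (1 :: int)" using True by simp
        ultimately show ?thesis by linarith
      next
        case False
        have "\<lfloor>frac (x j) - (\<beta> + \<epsilon>)\<rfloor> \<le> \<lfloor>frac (x j) - \<alpha>\<rfloor>" using ab \<epsilon> by (intro floor_mono) auto
        then show ?thesis using False by simp
      qed
      then have "of_bool (frac (x j) \<in> I) \<le> \<lfloor>x j - \<alpha>\<rfloor> - \<lfloor>x j - (\<beta> + \<epsilon>)\<rfloor>" by (simp add: floor_eq)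
      then show ?thesis by (simp flip: of_int_le_iff[where 'a = real])
    qed
    have "real (card {j\<in>J. frac (x j) \<in> I}) \<le> (\<Sum>j\<in>J. real_of_int (\<lfloor>x j - \<alpha>\<rfloor> - \<lfloor>x j - (\<beta> + \<epsilon>)\<rfloor>))"
      unfolding count by (rule sum_mono) (rule *)
    then show ?thesis using floor_sum[of \<alpha> "\<beta> + \<epsilon>"] by (simp add: algebra_simps)
  qed
  have lower: "real (card {j\<in>J. frac (x j) \<in> I}) \<ge> L * (\<beta> - \<alpha>) - L * \<epsilon> - 2 * B"
  proof (cases "\<alpha> + \<epsilon> < \<beta>")
    case True
    have *: "of_bool (frac (x j) \<in> I) \<ge> real_of_int (\<lfloor>x j - (\<alpha> + \<epsilon>)\<rfloor> - \<lfloor>x j - \<beta>\<rfloor>)" for j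
    proof -
      have "-1 \<le> frac (x j) - \<beta>" using y[of j] ab by linarith
      then have floor1: "\<lfloor>frac (x j) - \<beta>\<rfloor> \<ge> -1" by (simp add: le_floor_iff)
      have "of_bool (frac (x j) \<in> I) \<ge> \<lfloor>frac (x j) - (\<alpha> + \<epsilon>)\<rfloor> - \<lfloor>frac (x j) - \<beta>\<rfloor>"
      proof (cases "\<alpha> + \<epsilon> \<le> frac (x j) \<and> frac (x j) < \<beta>")
        case True
        then have "frac (x j) \<in> I" using ab \<epsilon> by auto
        then have "of_bool (frac (x j) \<in> I) = (1 :: int)" by simp
        moreover have "\<lfloor>frac (x j) - (\<alpha> + \<epsilon>)\<rfloor> \<le> 0" using y[of j] ab \<epsilon> by (simp add: floor_le_iff)
        moreover have "\<lfloor>frac (x j) - \<beta>\<rfloor> \<ge> -1" using floor1 .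
        ultimately show ?thesis by linarith
      next
        case False
        then have "\<lfloor>frac (x j) - (\<alpha> + \<epsilon>)\<rfloor> \<le> \<lfloor>frac (x j) - \<beta>\<rfloor>"
        proof (cases "frac (x j) < \<alpha> + \<epsilon>")
          case True
          then have "\<lfloor>frac (x j) - (\<alpha> + \<epsilon>)\<rfloor> < 0" by (simp add: floor_less_iff)
          moreover have "\<lfloor>frac (x j) - \<beta>\<rfloor> \<ge> -1" using floor1 .
          ultimately show ?thesis by linarith
        next
          case 2: False
          then have "\<lfloor>frac (x j) - (\<alpha> + \<epsilon>)\<rfloor> \<le> 0" using y[of j] ab \<epsilon> by (simp add: floor_le_iff)
          moreover have "\<lfloor>frac (x j) - \<beta>\<rfloor> \<ge> 0" using 2 False by simp
          ultimately show ?thesis by linarith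
        qed
        moreover have "(0 :: int) \<le> of_bool (frac (x j) \<in> I)" by simp
        ultimately show ?thesis by linarith
      qed
      then have "of_bool (frac (x j) \<in> I) \<ge> \<lfloor>x j - (\<alpha> + \<epsilon>)\<rfloor> - \<lfloor>x j - \<beta>\<rfloor>" by (simp add: floor_eq)
      then show ?thesis by (simp flip: of_int_le_iff[where 'a = real])
    qed
    have "real (card {j\<in>J. frac (x j) \<in> I}) \<ge> (\<Sum>j\<in>J. real_of_int (\<lfloor>x j - (\<alpha> + \<epsilon>)\<rfloor> - \<lfloor>x j - \<beta>\<rfloor>))"
      unfolding count by (rule sum_mono) (rule *)
    then show ?thesis using floor_sum[of "\<alpha> + \<epsilon>" \<beta>] by (simp add: algebra_simps)
  next
    case False
    have "L * (\<beta> - \<alpha>) \<le> L * \<epsilon>" using False by (intro mult_left_mono) (auto simp: L_def)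
    moreover have "B \<ge> 0" using floor_sum[of 0 0] by linarith
    moreover have "real (card {j\<in>J. frac (x j) \<in> I}) \<ge> 0" by simp
    ultimately show ?thesis by linarith
  qed
  show ?thesis using upper lower unfolding meas by (simp add: B_def L_def \<epsilon>_def abs_le_iff algebra_simps)
qed

section \<open>Digits and the slowed-down sequence of bases\<close>

lemma discrepancy_term_le:
  assumes "is_interval I" "I \<subseteq> {0..<1}"
  shows "\<bar>real (card {n\<in>{1..N}. frac (x n) \<in> I}) / real N - measure lborel I\<bar> \<le> discrepancy N x"
  unfolding discrepancy_def
proof (rule cSUP_upper)
  show "bdd_above ((\<lambda>I. \<bar>real (card {n\<in>{1..N}. frac (x n) \<in> I}) / real N - measure lborel I\<bar>) `
      {I. is_interval I \<and> I \<subseteq> {0..<1}})"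
  proof (rule bdd_aboveI2[where M = 1])
    fix I :: "real set" assume I: "I \<in> {I. is_interval I \<and> I \<subseteq> {0..<1}}"
    have "card {n\<in>{1..N}. frac (x n) \<in> I} \<le> card {1..N}" by (intro card_mono) auto
    then have 1: "real (card {n\<in>{1..N}. frac (x n) \<in> I}) / real N \<le> 1" by (simp add: divide_le_eq)
    have 2: "measure lborel I \<le> 1"
    proof (cases "I = {}")
      case False
      have "is_interval I" "I \<subseteq> {0..<1}" using I by auto
      then obtain \<alpha> \<beta> where "0 \<le> \<alpha>" "\<beta> \<le> 1" "measure lborel I = \<beta> - \<alpha>"
        by (rule unit_interval_bounds[OF _ _ False])
      then show ?thesis by simp
    qed simp
    have "real (card {n\<in>{1..N}. frac (x n) \<in> I}) / real N \<ge> 0" "measure lborel I \<ge> 0" by auto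
    then show "\<bar>real (card {n\<in>{1..N}. frac (x n) \<in> I}) / real N - measure lborel I\<bar> \<le> 1" using 1 2 by linarith
  qed
qed (use assms in simp)

lemma discrepancy_nonneg: "discrepancy N x \<ge> 0"
  using discrepancy_term_le[of "{}" N x] by simp

lemma discrepancy_leI:
  assumes "\<And>I. is_interval I \<Longrightarrow> I \<subseteq> {0..<1} \<Longrightarrow>
    \<bar>real (card {n\<in>{1..N}. frac (x n) \<in> I}) / real N - measure lborel I\<bar> \<le> B"
  shows "discrepancy N x \<le> B"
  unfolding discrepancy_def
proof (rule cSUP_least)
  have "{} \<in> {I :: real set. is_interval I \<and> I \<subseteq> {0..<1}}" by simp
  then show "{I :: real set. is_interval I \<and> I \<subseteq> {0..<1}} \<noteq> {}" by blast
qed (use assms in auto)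

text \<open>
  Reading a digit is multiplying the fractional part by \<open>b\<close>, so a further digit in front shrinks the
  interval by the factor \<open>b\<close>.
\<close>

lemma digit_word_iff_interval:
  assumes b: "b \<ge> 2" and w: "set w \<subseteq> {..<b}"
  shows "\<exists>lo\<ge>0. lo + 1 / real b ^ length w \<le> 1 \<and> (\<forall>n\<ge>1. \<forall>x.
    (\<forall>i<length w. digit b x (n + i) = int (w ! i)) \<longleftrightarrow>
    frac (real b ^ (n - 1) * x) \<in> {lo..<lo + 1 / real b ^ length w})"
  using w
proof (induction w)
  case Nil
  show ?case by (rule exI[of _ 0]) (auto simp: frac_lt_1)
next
  case (Cons a w)
  define l where "l = 1 / real b ^ length w"
  obtain lo where lo: "lo \<ge> 0" "lo + l \<le> 1"
    "\<And>n x. n \<ge> 1 \<Longrightarrow> (\<forall>i<length w. digit b x (n + i) = int (w ! i)) \<longleftrightarrow>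
    frac (real b ^ (n - 1) * x) \<in> {lo..<lo + l}"
    using Cons unfolding l_def by auto
  have a: "a < b" using Cons by auto
  have b0: "real b > 0" using b by simp
  have len: "1 / real b ^ length (a # w) = l / real b" by (simp add: l_def)
  define lo' where "lo' = (real a + lo) / real b"
  show ?case
  proof (rule exI[of _ lo'], intro conjI allI impI)
    show "0 \<le> lo'" using lo b0 by (simp add: lo'_def)
    have "real a + 1 \<le> real b" using a by linarith
    then have "real a + lo + l \<le> real b" using lo by linarith
    then show "lo' + 1 / real b ^ length (a # w) \<le> 1"
      unfolding len lo'_def using b0 by (simp add: add_divide_distrib[symmetric])
    fix n :: nat and x :: real assume n: "n \<ge> 1"
    define y where "y = frac (real b ^ (n - 1) * x)"
    define m where "m = \<lfloor>real b ^ (n - 1) * x\<rfloor>"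
    have y: "0 \<le> y" "y < 1" by (auto simp: y_def frac_lt_1)
    have bn: "real b ^ n = real b * real b ^ (n - 1)" using n by (metis power_eq_if not_one_le_zero)
    have by_eq: "real b ^ n * x = real b * y + of_int (int b * m)"
      unfolding bn by (simp add: y_def m_def frac_def algebra_simps)
    have rng: "0 \<le> real b * y" "real b * y < real b" using y b0 by auto
    have "\<lfloor>real b ^ n * x\<rfloor> = \<lfloor>real b * y\<rfloor> + int b * m"
      unfolding by_eq by (simp only: floor_add_int)
    then have "digit b x n = \<lfloor>real b * y\<rfloor> mod int b" by (simp add: digit_def)
    also have "\<dots> = \<lfloor>real b * y\<rfloor>"
      using rng by (intro mod_pos_pos_trivial) (auto simp: floor_less_iff)
    finally have dig: "digit b x n = \<lfloor>real b * y\<rfloor>" .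
    have fr: "frac (real b ^ (Suc n - 1) * x) = frac (real b * y)"
      using by_eq by (simp add: frac_def)
    have "(\<forall>i<length (a # w). digit b x (n + i) = int ((a # w) ! i)) \<longleftrightarrow>
        digit b x n = int a \<and> (\<forall>i<length w. digit b x (Suc n + i) = int (w ! i))"
      by (simp add: All_less_Suc2)
    also have "\<dots> \<longleftrightarrow> \<lfloor>real b * y\<rfloor> = int a \<and> frac (real b * y) \<in> {lo..<lo + l}"
      unfolding dig using lo(3)[of "Suc n" x] fr by simp
    also have "\<dots> \<longleftrightarrow> real a + lo \<le> real b * y \<and> real b * y < real a + lo + l"
    proof
      assume "\<lfloor>real b * y\<rfloor> = int a \<and> frac (real b * y) \<in> {lo..<lo + l}"
      then show "real a + lo \<le> real b * y \<and> real b * y < real a + lo + l" by (auto simp: frac_def)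
    next
      assume *: "real a + lo \<le> real b * y \<and> real b * y < real a + lo + l"
      then have "\<lfloor>real b * y\<rfloor> = int a" using lo(1,2) by (intro floor_unique) auto
      then show "\<lfloor>real b * y\<rfloor> = int a \<and> frac (real b * y) \<in> {lo..<lo + l}" using * by (auto simp: frac_def)
    qed
    also have "\<dots> \<longleftrightarrow> y \<in> {lo'..<lo' + l / real b}"
      unfolding lo'_def using b0 by (auto simp: field_simps)
    finally show "(\<forall>i<length (a # w). digit b x (n + i) = int ((a # w) ! i)) \<longleftrightarrow>
        frac (real b ^ (n - 1) * x) \<in> {lo'..<lo' + 1 / real b ^ length (a # w)}"
      unfolding len y_def .
  qed
qed

lemma normal_of_discrepancy:
  assumes b: "b \<ge> 2" and disc: "(\<lambda>N. discrepancy N (\<lambda>n. frac (real b ^ (n - 1) * x))) \<longlonglongrightarrow> 0"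
  shows "normal_to_base b x"
  unfolding normal_to_base_def
proof (intro allI impI)
  fix w :: "nat list" assume w: "set w \<subseteq> {..<b}"
  define l where "l = 1 / real b ^ length w"
  obtain lo where lo: "lo \<ge> 0" "lo + l \<le> 1"
    "\<And>n x. n \<ge> 1 \<Longrightarrow> (\<forall>i<length w. digit b x (n + i) = int (w ! i)) \<longleftrightarrow>
    frac (real b ^ (n - 1) * x) \<in> {lo..<lo + l}"
    using digit_word_iff_interval[OF b w] unfolding l_def by auto
  have l0: "l \<ge> 0" by (simp add: l_def)
  have "\<bar>real (card {n\<in>{1..N}. \<forall>i<length w. digit b x (n + i) = int (w ! i)}) / real N - l\<bar>
      \<le> discrepancy N (\<lambda>n. frac (real b ^ (n - 1) * x))" for N
  proof -
    have "{n\<in>{1..N}. \<forall>i<length w. digit b x (n + i) = int (w ! i)}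
        = {n\<in>{1..N}. frac (frac (real b ^ (n - 1) * x)) \<in> {lo..<lo + l}}"
      using lo(3) by auto
    moreover have "measure lborel {lo..<lo + l} = l" using l0 by simp
    moreover have "is_interval {lo..<lo + l}" by (simp add: is_interval_1)
    moreover have "{lo..<lo + l} \<subseteq> {0..<1}" using lo by auto
    ultimately show ?thesis
      using discrepancy_term_le[of "{lo..<lo + l}" N "\<lambda>n. frac (real b ^ (n - 1) * x)"] by simp
  qed
  then have "(\<lambda>N. real (card {n\<in>{1..N}. \<forall>i<length w. digit b x (n + i) = int (w ! i)}) / real N - l) \<longlonglongrightarrow> 0"
    by (intro Lim_null_comparison[OF _ disc] always_eventually) auto
  then show "(\<lambda>N. real (card {n\<in>{1..N}. \<forall>i<length w. digit b x (n + i) = int (w ! i)}) / real N)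
      \<longlonglongrightarrow> 1 / real b ^ length w"
    using LIM_zero_iff l_def by blast
qed

context
  fixes a :: "nat \<Rightarrow> nat \<Rightarrow> real" and S :: "nat \<Rightarrow> nat"
  assumes a_pos: "\<And>i j. i > 1 \<Longrightarrow> j > 1 \<Longrightarrow> a i j > 0" and S_gt: "\<And>m. m \<ge> 1 \<Longrightarrow> S m > 2"
begin

lemma beta_pos:
  assumes "k \<ge> 1"
  shows "beta a all_bases S k > 0"
proof -
  have "({1..k} :: nat set) \<noteq> {}" using assms by simp
  moreover have "a (all_bases i) (S j) > 0" if "i \<in> {1..k}" "j \<in> {1..k}" for i j
    using that S_gt[of j] by (intro a_pos) (auto simp: all_bases_def)
  ultimately show ?thesis unfolding beta_def by (subst Min_gr_iff) auto
qed

lemma gamma_pos: "gamma all_bases S 1 \<ge> 1"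
  by (simp add: gamma_def all_bases_def)

text \<open>
  The conditions in the definition of \<open>phi\<close> always admit the value 1, so the greatest value exists.
\<close>

lemma phi_step_spec:
  fixes k :: nat
  defines "P \<equiv> (\<lambda>k p. 1 \<le> p \<and> beta a all_bases S p \<ge> beta a all_bases S 1 / real k powr (1 / 4)
     \<and> gamma all_bases S p \<le> gamma all_bases S 1 * k)"
  assumes "k \<ge> 1"
  shows "P k (phi a all_bases S k)"
    and "phi a all_bases S (Suc k) \<le> phi a all_bases S k + 1"
    and "p \<le> phi a all_bases S k + 1 \<Longrightarrow> P (Suc k) p \<Longrightarrow> p \<le> phi a all_bases S (Suc k)"
proof -
  define f where "f = phi a all_bases S"
  have P1: "P k 1" if "k \<ge> 1" for k
  proof -
    have "real k powr (1 / 4) \<ge> 1" using that by (intro ge_one_powr_ge_zero) auto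
    then have "beta a all_bases S 1 / real k powr (1 / 4) \<le> beta a all_bases S 1 / 1"
      using beta_pos[of 1] that by (intro divide_left_mono) auto
    then show ?thesis using that gamma_pos by (simp add: P_def)
  qed
  have f1: "f 1 = 1" by (simp add: f_def)
  have fS: "f (Suc k) = (GREATEST p. p \<le> f k + 1 \<and> P (Suc k) p)" if "k \<ge> 1" for k
  proof -
    obtain j where j: "k = Suc j" using \<open>k \<ge> 1\<close> by (cases k) auto
    have "(\<lambda>p. 1 \<le> p \<and> p \<le> f (Suc j) + 1 \<and> beta a all_bases S p \<ge> beta a all_bases S 1 / real (j + 2) powr (1 / 4) \<and>
        gamma all_bases S p \<le> gamma all_bases S 1 * (j + 2)) = (\<lambda>p. p \<le> f (Suc j) + 1 \<and> P (Suc (Suc j)) p)"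
      by (auto simp: P_def fun_eq_iff)
    then show ?thesis unfolding j f_def by simp
  qed
  have spec: "f (Suc k) \<le> f k + 1 \<and> P (Suc k) (f (Suc k))" if "k \<ge> 1" for k
    unfolding fS[OF that]
    by (rule GreatestI_nat[where k = 1 and b = "f k + 1"]) (use P1[of "Suc k"] in auto)
  have "P k (f k)" if "k \<ge> 1" for k
    using that spec[of "k - 1"] f1 P1[of 1] by (cases "k = 1") auto
  then show "P k (phi a all_bases S k)" using assms(2) by (simp add: f_def)
  show "phi a all_bases S (Suc k) \<le> phi a all_bases S k + 1" using spec[OF assms(2)] by (simp add: f_def)
  show "p \<le> phi a all_bases S (Suc k)" if "p \<le> phi a all_bases S k + 1" "P (Suc k) p"
    using Greatest_le_nat[where P = "\<lambda>p. p \<le> f k + 1 \<and> P (Suc k) p" and k = p and b = "f k + 1"] that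
    by (simp add: fS[OF assms(2)] flip: f_def)
qed

lemma phi_bounds:
  assumes "k \<ge> 1"
  shows "1 \<le> phi a all_bases S k" "phi a all_bases S k \<le> k"
proof -
  show "1 \<le> phi a all_bases S k" using phi_step_spec(1)[OF assms] by simp
  show "phi a all_bases S k \<le> k"
    using assms
  proof (induction k rule: dec_induct)
    case (step k) then show ?case using phi_step_spec(2)[of k] by simp
  qed simp
qed

lemma phi_mono_step:
  assumes "k \<ge> 1"
  shows "phi a all_bases S k \<le> phi a all_bases S (Suc k)"
proof (rule phi_step_spec(3)[OF assms])
  have "real k powr (1 / 4) \<le> real (Suc k) powr (1 / 4)" by (intro powr_mono2) auto
  then have "beta a all_bases S 1 / real (Suc k) powr (1 / 4) \<le> beta a all_bases S 1 / real k powr (1 / 4)"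
    using beta_pos[of 1] assms by (intro divide_left_mono) auto
  moreover have "gamma all_bases S 1 * k \<le> gamma all_bases S 1 * Suc k" by simp
  ultimately show "1 \<le> phi a all_bases S k \<and>
      beta a all_bases S 1 / real (Suc k) powr (1 / 4) \<le> beta a all_bases S (phi a all_bases S k) \<and>
      gamma all_bases S (phi a all_bases S k) \<le> gamma all_bases S 1 * Suc k"
    using phi_step_spec(1)[OF assms] by linarith
qed simp

lemma phi_mono: "1 \<le> k \<Longrightarrow> k \<le> l \<Longrightarrow> phi a all_bases S k \<le> phi a all_bases S l"
proof (induction l)
  case (Suc l)
  then show ?case using phi_mono_step[of l] by (cases "k = Suc l") auto
qed simp

text \<open>
  As \<open>beta\<close> is positive, every index satisfies the conditions in the definition of \<open>phi\<close> eventually, so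
  \<open>phi\<close> is unbounded; it increases by at most 1 in a step. Hence every base occurs in the
  slowed-down sequence.
\<close>

lemma phi_surj:
  assumes "p \<ge> 1"
  shows "\<exists>k\<ge>1. phi a all_bases S k = p"
  using assms
proof (induction p rule: dec_induct)
  case base
  show ?case by (rule exI[of _ 1]) simp
next
  case (step p)
  define f where "f = phi a all_bases S"
  obtain k where k: "k \<ge> 1" "f k = p" using step by (auto simp: f_def)
  have "\<forall>\<^sub>F K in sequentially. beta a all_bases S 1 / real (Suc K) powr (1 / 4) < beta a all_bases S (Suc p)"
  proof -
    have "(\<lambda>K. B / real (Suc K) powr (1 / 4)) \<longlonglongrightarrow> 0" if "B > 0" for B :: real
      using that by real_asymp
    from this[OF beta_pos[of 1]] show ?thesis using beta_pos[of "Suc p"] by (intro order_tendstoD(2)) auto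
  qed
  then obtain K0 where K0: "\<And>K. K \<ge> K0 \<Longrightarrow> beta a all_bases S 1 / real (Suc K) powr (1 / 4) < beta a all_bases S (Suc p)"
    by (auto simp: eventually_sequentially)
  define K where "K = max K0 (max k (gamma all_bases S (Suc p)))"
  have K: "K \<ge> K0" "K \<ge> k" "K \<ge> 1" using k by (auto simp: K_def)
  have gam: "gamma all_bases S (Suc p) \<le> gamma all_bases S 1 * Suc K"
  proof -
    have "gamma all_bases S (Suc p) \<le> 1 * Suc K" by (simp add: K_def)
    also have "\<dots> \<le> gamma all_bases S 1 * Suc K" using gamma_pos by (intro mult_right_mono) auto
    finally show ?thesis .
  qed
  have "f K \<ge> p" using phi_mono[of k K] k K by (simp add: f_def)
  then have "Suc p \<le> f (Suc K)"
    unfolding f_def using phi_step_spec(3)[OF K(3), of "Suc p"] K0[OF K(1)] gam by simp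
  then have ex: "\<exists>j. j \<ge> 1 \<and> f j \<ge> Suc p" by (intro exI[of _ "Suc K"]) auto
  define j where "j = (LEAST j. j \<ge> 1 \<and> f j \<ge> Suc p)"
  have j: "j \<ge> 1" "f j \<ge> Suc p" using LeastI_ex[OF ex] by (auto simp: j_def)
  have "f 1 = 1" by (simp add: f_def)
  then have "j \<noteq> 1" using j step by auto
  then have j2: "j - 1 \<ge> 1" "Suc (j - 1) = j" using j by auto
  have "j - 1 < (LEAST j. j \<ge> 1 \<and> f j \<ge> Suc p)" unfolding j_def[symmetric] using j2 by linarith
  from not_less_Least[OF this] have "\<not> f (j - 1) \<ge> Suc p" using j2 by simp
  then have "f j \<le> Suc p" using phi_step_spec(2)[OF j2(1)] j2(2) by (simp add: f_def)
  then show ?case using j by (auto simp: f_def intro!: exI[of _ j])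
qed

end

section \<open>Mean squares over the digit choices\<close>

lemma cmod_one_plus_e: "cmod (1 + e u) = 2 * \<bar>cos (pi * u)\<bar>"
proof -
  have "1 + e u = cis (pi * u) * of_real (2 * cos (pi * u))"
  proof -
    have "cis (pi * u) * of_real (2 * cos (pi * u)) = cis (pi * u) * (cis (pi * u) + cis (- (pi * u)))"
      by (simp add: complex_eq_iff)
    also have "\<dots> = cis (2 * pi * u) + 1" by (simp add: distrib_left cis_mult mult.assoc)
    finally show ?thesis by (simp add: e_altdef)
  qed
  then show ?thesis by (simp add: norm_mult abs_mult)
qed

lemma e_add: "e (x + y) = e x * e y"
  by (simp add: e_altdef cis_mult distrib_left)

lemma e_sum: "finite X \<Longrightarrow> e (\<Sum>k\<in>X. f k) = (\<Prod>k\<in>X. e (f k))"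
  by (induction X rule: finite_induct) (auto simp: e_add, simp add: e_altdef)

lemma cmod_e [simp]: "cmod (e x) = 1"
  by (simp add: e_altdef)

lemma cnj_e: "cnj (e x) = e (- x)"
  by (simp add: e_altdef cis_cnj)

text \<open>
  A subset \<open>X\<close> of \<open>K\<close> stands for the digits 1 at the places in \<open>X\<close> and 0 elsewhere. The sum over
  all subsets factors into the terms \<open>1 + e (y * w k)\<close>.
\<close>

lemma cantor_exp_sum:
  assumes "finite K"
  shows "cmod (\<Sum>X\<in>Pow K. e (y * (\<eta> + (\<Sum>k\<in>X. w k)))) = 2 ^ card K * (\<Prod>k\<in>K. \<bar>cos (pi * (y * w k))\<bar>)"
proof -
  have "(\<Sum>X\<in>Pow K. e (y * (\<eta> + (\<Sum>k\<in>X. w k)))) = (\<Sum>X\<in>Pow K. e (y * \<eta>) * ((\<Prod>k\<in>X. e (y * w k)) * (\<Prod>k\<in>K - X. 1)))"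
  proof (intro sum.cong refl)
    fix X assume "X \<in> Pow K"
    then have "finite X" using assms finite_subset by auto
    then have "e (\<Sum>k\<in>X. y * w k) = (\<Prod>k\<in>X. e (y * w k))" by (rule e_sum)
    then show "e (y * (\<eta> + (\<Sum>k\<in>X. w k))) = e (y * \<eta>) * ((\<Prod>k\<in>X. e (y * w k)) * (\<Prod>k\<in>K - X. 1))"
      by (simp add: distrib_left e_add sum_distrib_left)
  qed
  also have "\<dots> = e (y * \<eta>) * (\<Prod>k\<in>K. e (y * w k) + 1)"
    by (simp add: prod_add[OF assms] sum_distrib_left)
  finally have "cmod (\<Sum>X\<in>Pow K. e (y * (\<eta> + (\<Sum>k\<in>X. w k)))) = (\<Prod>k\<in>K. cmod (1 + e (y * w k)))"
    by (simp add: norm_mult prod_norm[symmetric] add.commute)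
  also have "\<dots> = 2 ^ card K * (\<Prod>k\<in>K. \<bar>cos (pi * (y * w k))\<bar>)"
    by (simp add: cmod_one_plus_e prod.distrib)
  finally show ?thesis .
qed

lemma cantor_mean_square:
  fixes y :: "'j \<Rightarrow> real"
  assumes K: "finite K"
  shows "(\<Sum>X\<in>Pow K. (cmod (\<Sum>j\<in>J. e (y j * (\<eta> + (\<Sum>k\<in>X. w k)))))\<^sup>2)
    \<le> 2 ^ card K * (\<Sum>i\<in>J. \<Sum>j\<in>J. \<Prod>k\<in>K. \<bar>cos (pi * ((y i - y j) * w k))\<bar>)"
proof -
  define x where "x X = \<eta> + (\<Sum>k\<in>X. w k)" for X
  have sq: "complex_of_real ((cmod (\<Sum>j\<in>J. e (y j * x X)))\<^sup>2) = (\<Sum>i\<in>J. \<Sum>j\<in>J. e ((y i - y j) * x X))" for X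
  proof -
    have "complex_of_real ((cmod (\<Sum>j\<in>J. e (y j * x X)))\<^sup>2) = (\<Sum>i\<in>J. e (y i * x X)) * cnj (\<Sum>j\<in>J. e (y j * x X))"
      by (rule complex_norm_square)
    also have "\<dots> = (\<Sum>i\<in>J. \<Sum>j\<in>J. e (y i * x X) * e (- (y j * x X)))"
      by (simp add: sum_product cnj_sum cnj_e)
    also have "\<dots> = (\<Sum>i\<in>J. \<Sum>j\<in>J. e ((y i - y j) * x X))"
      by (intro sum.cong refl) (simp add: left_diff_distrib flip: e_add)
    finally show ?thesis .
  qed
  have "complex_of_real (\<Sum>X\<in>Pow K. (cmod (\<Sum>j\<in>J. e (y j * x X)))\<^sup>2)
      = (\<Sum>X\<in>Pow K. \<Sum>i\<in>J. \<Sum>j\<in>J. e ((y i - y j) * x X))"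
    unfolding of_real_sum by (intro sum.cong refl sq)
  also have "\<dots> = (\<Sum>i\<in>J. \<Sum>j\<in>J. \<Sum>X\<in>Pow K. e ((y i - y j) * x X))"
    by (subst sum.swap, intro sum.cong refl, subst sum.swap, simp)
  finally have eq: "complex_of_real (\<Sum>X\<in>Pow K. (cmod (\<Sum>j\<in>J. e (y j * x X)))\<^sup>2)
      = (\<Sum>i\<in>J. \<Sum>j\<in>J. \<Sum>X\<in>Pow K. e ((y i - y j) * x X))" .
  have "(\<Sum>X\<in>Pow K. (cmod (\<Sum>j\<in>J. e (y j * x X)))\<^sup>2) \<le> cmod (complex_of_real (\<Sum>X\<in>Pow K. (cmod (\<Sum>j\<in>J. e (y j * x X)))\<^sup>2))"
    unfolding norm_of_real by (rule abs_ge_self)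
  also have "\<dots> \<le> (\<Sum>i\<in>J. \<Sum>j\<in>J. cmod (\<Sum>X\<in>Pow K. e ((y i - y j) * x X)))"
    unfolding eq by (rule order.trans[OF norm_sum], intro sum_mono norm_sum)
  also have "\<dots> = (\<Sum>i\<in>J. \<Sum>j\<in>J. 2 ^ card K * (\<Prod>k\<in>K. \<bar>cos (pi * ((y i - y j) * w k))\<bar>))"
    unfolding x_def by (simp only: cantor_exp_sum[OF K])
  also have "\<dots> = 2 ^ card K * (\<Sum>i\<in>J. \<Sum>j\<in>J. \<Prod>k\<in>K. \<bar>cos (pi * ((y i - y j) * w k))\<bar>)"
    by (simp only: sum_distrib_left)
  finally show ?thesis by (simp only: x_def)
qed

text \<open>
  All places but the \<open>D\<close> places below the leading one are dropped.
\<close>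

lemma cos_prod_le_top_cos:
  fixes u :: real and s D lo hi :: nat
  assumes s: "s \<ge> 2" and u: "u > 0" and lo: "real (lo + D) \<le> log (real s) u" and hi: "log (real s) u < real hi + 2"
  shows "(\<Prod>k = lo..hi. \<bar>cos (pi * (u * (1 / real s ^ k)))\<bar>) \<le> top_cos s D u"
proof -
  define n where "n = nat \<lfloor>log (real s) u\<rfloor>"
  have s0: "real s > 1" using s by simp
  have n: "int n = \<lfloor>log (real s) u\<rfloor>" using lo unfolding n_def by simp
  have nlo: "lo + D \<le> n" using lo unfolding n_def by (simp add: le_nat_floor)
  have nhi: "n \<le> hi + 1"
  proof -
    have "real n < real hi + 2" using hi n by linarith
    then show ?thesis by linarith
  qed
  have mant: "real s powr frac (log (real s) u) = u / real s ^ n"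
  proof -
    have "frac (log (real s) u) = log (real s) u - real n" using n by (simp add: frac_def flip: n)
    then have "real s powr frac (log (real s) u) = real s powr (log (real s) u) / real s powr (real n)"
      by (simp add: powr_diff)
    then show ?thesis using s0 u by (simp add: powr_realpow)
  qed
  have "top_cos s D u = (\<Prod>d = 1..D. \<bar>cos (pi * (u * (1 / real s ^ (n - d))))\<bar>)"
    unfolding top_cos_def mant
  proof (intro prod.cong refl)
    fix d assume d: "d \<in> {1..D}"
    then have "real s ^ n = real s ^ d * real s ^ (n - d)" using nlo by (simp flip: power_add)
    then have "real s ^ d * (u / real s ^ n) = u * (1 / real s ^ (n - d))" using s0 by simp
    then show "\<bar>cos (pi * (real s ^ d * (u / real s ^ n)))\<bar> = \<bar>cos (pi * (u * (1 / real s ^ (n - d))))\<bar>" by simp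
  qed
  also have "\<dots> = (\<Prod>k\<in>(\<lambda>d. n - d) ` {1..D}. \<bar>cos (pi * (u * (1 / real s ^ k)))\<bar>)"
    by (subst prod.reindex) (use nlo in \<open>auto simp: inj_on_def\<close>)
  finally have top: "top_cos s D u = (\<Prod>k\<in>(\<lambda>d. n - d) ` {1..D}. \<bar>cos (pi * (u * (1 / real s ^ k)))\<bar>)" .
  have sub: "(\<lambda>d. n - d) ` {1..D} \<subseteq> {lo..hi}" using nlo nhi by auto
  have "(\<Prod>k = lo..hi. \<bar>cos (pi * (u * (1 / real s ^ k)))\<bar>)
      = (\<Prod>k\<in>{lo..hi} - (\<lambda>d. n - d) ` {1..D}. \<bar>cos (pi * (u * (1 / real s ^ k)))\<bar>) * top_cos s D u"
    unfolding top by (rule prod.subset_diff[OF sub]) simp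
  also have "\<dots> \<le> 1 * top_cos s D u"
    by (intro mult_right_mono prod_le_1 top_cos_nonneg) auto
  finally show ?thesis by simp
qed

lemma card_nat_between_le:
  assumes "A \<subseteq> {j :: nat. \<alpha> < real j \<and> real j \<le> \<beta>}" "\<alpha> \<le> \<beta>"
  shows "real (card A) \<le> \<beta> - \<alpha> + 1"
proof -
  have "int ` A \<subseteq> {\<lfloor>\<alpha>\<rfloor> + 1..\<lfloor>\<beta>\<rfloor>}"
  proof
    fix z assume "z \<in> int ` A"
    then obtain j where j: "z = int j" "\<alpha> < real j" "real j \<le> \<beta>" using assms by auto
    have "\<lfloor>\<alpha>\<rfloor> < int j" using j by linarith
    moreover have "int j \<le> \<lfloor>\<beta>\<rfloor>" using j by (simp add: le_floor_iff)
    ultimately show "z \<in> {\<lfloor>\<alpha>\<rfloor> + 1..\<lfloor>\<beta>\<rfloor>}" using j by simp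
  qed
  then have "card (int ` A) \<le> card {\<lfloor>\<alpha>\<rfloor> + 1..\<lfloor>\<beta>\<rfloor>}" by (intro card_mono) auto
  also have "card (int ` A) = card A" by (intro card_image) auto
  finally have "real (card A) \<le> real (nat (\<lfloor>\<beta>\<rfloor> - \<lfloor>\<alpha>\<rfloor>))" by simp
  also have "\<dots> \<le> \<beta> - \<alpha> + 1" using assms(2) by linarith
  finally show ?thesis .
qed

lemma ln_ge_two_thirds: "(x :: real) \<ge> 2 \<Longrightarrow> ln x \<ge> 2 / 3"
  using ln2_ge_two_thirds ln_mono[of 2 x] by linarith

text \<open>
  The \<open>D\<close> places below the leading digit of $r^j\theta$ are all free, unless \<open>j\<close> is within a distance of order
  \<open>D * h\<close> of one of the ends of the block \<open>J\<close>. These exceptional exponents are counted trivially.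
\<close>

lemma cos_single_sum:
  fixes r s h D Q M M' :: nat and \<theta> :: real
  assumes s: "s \<ge> 3" "ln (real s) \<le> real h" and r: "r \<ge> 2" and D: "D \<ge> 1" "2 * D \<le> h\<^sup>2"
    and Q: "real h * exp (real h ^ 13) < real Q"
    and lf: "\<And>p q :: nat. coprime p q \<Longrightarrow> 0 < q \<Longrightarrow> real q \<le> exp (real h ^ 3) \<Longrightarrow>
      \<bar>real q * ln (real r) - real p * ln (real s)\<bar> \<ge> exp (- (real h ^ 13))"
    and \<theta>: "\<theta> \<ge> 1 / 2" "ln \<theta> \<le> real h"
  defines "J \<equiv> {nat \<lfloor>real M / ln (real r)\<rfloor> + 1..nat \<lfloor>real M' / ln (real r)\<rfloor>}"
    and "K \<equiv> {nat \<lfloor>real M / ln (real s)\<rfloor> + 1..nat \<lfloor>real M' / ln (real s)\<rfloor> - 2}"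
  shows "(\<Sum>j\<in>J. \<Prod>k\<in>K. \<bar>cos (pi * (real r ^ j * \<theta> * (1 / real s ^ k)))\<bar>)
    \<le> real (2 * D * h + 6 * h + 6) + (real (card J) + real Q) * (11 * real s * sqrt (1 / 2) ^ D)"
proof -
  define G where "G j = (\<Prod>k\<in>K. \<bar>cos (pi * (real r ^ j * \<theta> * (1 / real s ^ k)))\<bar>)" for j
  have G01: "0 \<le> G j" "G j \<le> 1" for j
    unfolding G_def by (auto intro!: prod_nonneg prod_le_1)
  have s1: "real s > 1" using s by auto
  have lnS: "ln (real s) \<ge> 1" using s by (intro ln_ge_1) auto
  have lnr: "ln (real r) \<ge> 2 / 3" using r by (intro ln_ge_two_thirds) auto
  have \<theta>0: "\<theta> > 0" using \<theta> by linarith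
  have ln\<theta>: "ln \<theta> \<ge> -1"
  proof -
    have "ln (1 / 2) \<le> ln \<theta>" using \<theta> by (intro ln_mono) auto
    moreover have "ln (1 / 2 :: real) = - ln 2" by (simp add: ln_div)
    moreover have "ln (2 :: real) \<le> 2 - 1" by (rule ln_le_minus_one) simp
    ultimately show ?thesis by linarith
  qed
  have Jrange: "real M < real j * ln (real r)" "real j * ln (real r) \<le> real M'" if "j \<in> J" for j
  proof -
    have "real M / ln (real r) \<ge> 0" "real M' / ln (real r) \<ge> 0" using lnr by auto
    then have "real M / ln (real r) < real j" "real j \<le> real M' / ln (real r)"
      using that unfolding J_def atLeastAtMost_iff by linarith+
    then show "real M < real j * ln (real r)" "real j * ln (real r) \<le> real M'"
      using lnr by (simp_all add: field_simps)
  qed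
  have lnu: "ln (real r ^ j * \<theta>) = real j * ln (real r) + ln \<theta>" for j
    using r \<theta>0 by (simp add: ln_mult ln_realpow)
  define bad1 where "bad1 = {j\<in>J. real j * ln (real r) + ln \<theta> < real M + (1 + real D) * real h}"
  define bad2 where "bad2 = {j\<in>J. real j * ln (real r) + ln \<theta> > real M' - real h}"
  have good: "G j \<le> top_cos s D (real r ^ j * \<theta>)" if j: "j \<in> J - bad1 - bad2" for j
  proof -
    define lo hi where "lo = nat \<lfloor>real M / ln (real s)\<rfloor> + 1" and "hi = nat \<lfloor>real M' / ln (real s)\<rfloor> - 2"
    define u where "u = real r ^ j * \<theta>"
    have u: "u > 0" using r \<theta>0 by (simp add: u_def)
    have rng: "real M + (1 + real D) * real h \<le> ln u" "ln u \<le> real M' - real h"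
      using j by (auto simp: bad1_def bad2_def u_def lnu)
    have "real (lo + D) \<le> log (real s) u"
    proof -
      have "real M / ln (real s) \<ge> 0" using lnS by auto
      then have "real lo \<le> real M / ln (real s) + 1" unfolding lo_def by linarith
      then have "real (lo + D) * ln (real s) \<le> (real M / ln (real s) + (1 + real D)) * ln (real s)"
        using lnS by (intro mult_right_mono) auto
      also have "\<dots> = real M + (1 + real D) * ln (real s)" using lnS by (simp add: distrib_right)
      also have "\<dots> \<le> real M + (1 + real D) * real h" using s by (intro add_left_mono mult_left_mono) auto
      also have "\<dots> \<le> ln u" by (rule rng)
      finally show ?thesis using lnS by (simp add: log_def field_simps)
    qed
    moreover have "log (real s) u < real hi + 2"
    proof -
      have "log (real s) u \<le> (real M' - ln (real s)) / ln (real s)"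
        unfolding log_def using rng(2) s lnS by (intro divide_right_mono) auto
      also have "\<dots> = real M' / ln (real s) - 1" using lnS by (simp add: diff_divide_distrib)
      also have "\<dots> < real (nat \<lfloor>real M' / ln (real s)\<rfloor>)" by linarith
      also have "\<dots> \<le> real hi + 2" unfolding hi_def by linarith
      finally show ?thesis .
    qed
    ultimately show ?thesis
      unfolding G_def K_def u_def[symmetric] lo_def[symmetric] hi_def[symmetric]
      using s u by (intro cos_prod_le_top_cos) auto
  qed
  have lnr': "ln (real r) \<ge> 1 / 2" using lnr by simp
  have c1: "real (card bad1) \<le> 2 * ((1 + real D) * real h + 1) + 1"
  proof -
    define \<alpha> \<beta> where "\<alpha> = real M / ln (real r)" and "\<beta> = (real M + ((1 + real D) * real h + 1)) / ln (real r)"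
    have "bad1 \<subseteq> {j. \<alpha> < real j \<and> real j \<le> \<beta>}"
    proof
      fix j assume "j \<in> bad1"
      then have "real M < real j * ln (real r)" "real j * ln (real r) \<le> real M + ((1 + real D) * real h + 1)"
        using Jrange[of j] ln\<theta> by (auto simp: bad1_def)
      then show "j \<in> {j. \<alpha> < real j \<and> real j \<le> \<beta>}"
        using lnr by (simp add: \<alpha>_def \<beta>_def pos_divide_less_eq pos_le_divide_eq)
    qed
    moreover have "\<alpha> \<le> \<beta>" unfolding \<alpha>_def \<beta>_def using lnr by (intro divide_right_mono) auto
    ultimately have "real (card bad1) \<le> \<beta> - \<alpha> + 1" by (rule card_nat_between_le)
    also have "\<beta> - \<alpha> = ((1 + real D) * real h + 1) / ln (real r)"
      by (simp add: \<alpha>_def \<beta>_def add_divide_distrib)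
    also have "\<dots> \<le> ((1 + real D) * real h + 1) / (1 / 2)" using lnr' by (intro divide_left_mono) auto
    finally show ?thesis by (simp add: mult_ac)
  qed
  have c2: "real (card bad2) \<le> 2 * (2 * real h) + 1"
  proof -
    define \<alpha> \<beta> where "\<alpha> = (real M' - 2 * real h) / ln (real r)" and "\<beta> = real M' / ln (real r)"
    have "bad2 \<subseteq> {j. \<alpha> < real j \<and> real j \<le> \<beta>}"
    proof
      fix j assume "j \<in> bad2"
      then have "real M' - 2 * real h < real j * ln (real r)" "real j * ln (real r) \<le> real M'"
        using Jrange[of j] \<theta>(2) by (auto simp: bad2_def)
      then show "j \<in> {j. \<alpha> < real j \<and> real j \<le> \<beta>}"
        using lnr by (simp add: \<alpha>_def \<beta>_def pos_divide_less_eq pos_le_divide_eq)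
    qed
    moreover have "\<alpha> \<le> \<beta>" unfolding \<alpha>_def \<beta>_def using lnr by (intro divide_right_mono) auto
    ultimately have "real (card bad2) \<le> \<beta> - \<alpha> + 1" by (rule card_nat_between_le)
    also have "\<beta> - \<alpha> = 2 * real h / ln (real r)"
      by (simp add: \<alpha>_def \<beta>_def diff_divide_distrib)
    also have "\<dots> \<le> 2 * real h / (1 / 2)" using lnr' by (intro divide_left_mono) auto
    finally show ?thesis by simp
  qed
  have finJ: "finite J" by (simp add: J_def)
  have bsub: "bad1 \<union> bad2 \<subseteq> J" by (auto simp: bad1_def bad2_def)
  have "(\<Sum>j\<in>J. G j) = (\<Sum>j\<in>J - (bad1 \<union> bad2). G j) + (\<Sum>j\<in>bad1 \<union> bad2. G j)"
    by (rule sum.subset_diff[OF bsub finJ])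
  also have "\<dots> \<le> (\<Sum>j\<in>J - (bad1 \<union> bad2). top_cos s D (real r ^ j * \<theta>)) + (\<Sum>j\<in>bad1 \<union> bad2. 1)"
    by (intro add_mono sum_mono good G01) auto
  also have "\<dots> \<le> (\<Sum>j\<in>J. top_cos s D (real r ^ j * \<theta>)) + real (card (bad1 \<union> bad2))"
    using finJ by (intro add_mono sum_mono2) (auto simp: top_cos_nonneg)
  also have "\<dots> \<le> (real (card J) + real Q) * (11 * real s * sqrt (1 / 2) ^ D) + real (2 * D * h + 6 * h + 6)"
  proof (intro add_mono)
    define j0 where "j0 = nat \<lfloor>real M / ln (real r)\<rfloor> + 1"
    define n where "n = card J"
    have J: "J = {0 + j0..<n + j0}" unfolding n_def J_def j0_def by auto
    have "(\<Sum>j\<in>J. top_cos s D (real r ^ j * \<theta>)) = (\<Sum>i = 0..<card J. top_cos s D (real r ^ (i + j0) * \<theta>))"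
      unfolding n_def[symmetric] by (simp only: J sum.shift_bounds_nat_ivl)
    also have "\<dots> = (\<Sum>i<card J. top_cos s D (real r ^ i * (real r ^ j0 * \<theta>)))"
      by (simp add: lessThan_atLeast0 power_add mult.assoc)
    also have "\<dots> \<le> (real (card J) + real Q) * (11 * real s * sqrt (1 / 2) ^ D)"
      using s r D Q lf \<theta>0 by (intro top_cos_sum) auto
    finally show "(\<Sum>j\<in>J. top_cos s D (real r ^ j * \<theta>)) \<le> (real (card J) + real Q) * (11 * real s * sqrt (1 / 2) ^ D)" .
    have "real (card (bad1 \<union> bad2)) \<le> real (card bad1 + card bad2)" by (intro of_nat_mono card_Un_le)
    also have "\<dots> \<le> 2 * ((1 + real D) * real h + 1) + 1 + (2 * (2 * real h) + 1)"
      using c1 c2 by simp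
    also have "\<dots> \<le> real (2 * D * h + 6 * h + 6)" by (simp add: algebra_simps)
    finally show "real (card (bad1 \<union> bad2)) \<le> real (2 * D * h + 6 * h + 6)" .
  qed
  finally show ?thesis by (simp add: G_def)
qed

text \<open>
  The pairs \<open>i > j\<close> are sorted by the gap \<open>n = i - j\<close>. Since $(r^i-r^j)t=r^i\cdot t(1-r^{-n})$, each
  gap leads to a single sum with $1/2\le\theta\le|t|$.
\<close>

lemma cos_double_sum:
  fixes r s h D Q M M' :: nat and t :: int
  assumes s: "s \<ge> 3" "ln (real s) \<le> real h" and r: "r \<ge> 2" and D: "D \<ge> 1" "2 * D \<le> h\<^sup>2"
    and Q: "real h * exp (real h ^ 13) < real Q"
    and lf: "\<And>p q :: nat. coprime p q \<Longrightarrow> 0 < q \<Longrightarrow> real q \<le> exp (real h ^ 3) \<Longrightarrow>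
      \<bar>real q * ln (real r) - real p * ln (real s)\<bar> \<ge> exp (- (real h ^ 13))"
    and t: "t \<noteq> 0" "ln \<bar>real_of_int t\<bar> \<le> real h"
  defines "J \<equiv> {nat \<lfloor>real M / ln (real r)\<rfloor> + 1..nat \<lfloor>real M' / ln (real r)\<rfloor>}"
    and "K \<equiv> {nat \<lfloor>real M / ln (real s)\<rfloor> + 1..nat \<lfloor>real M' / ln (real s)\<rfloor> - 2}"
  shows "(\<Sum>i\<in>J. \<Sum>j\<in>J. \<Prod>k\<in>K. \<bar>cos (pi * ((real r ^ i * of_int t - real r ^ j * of_int t) * (1 / real s ^ k)))\<bar>)
    \<le> real (card J) + 2 * (real (card J) * (real (2 * D * h + 6 * h + 6)
        + (real (card J) + real Q) * (11 * real s * sqrt (1 / 2) ^ D)))"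
proof -
  define B where "B = real (2 * D * h + 6 * h + 6) + (real (card J) + real Q) * (11 * real s * sqrt (1 / 2) ^ D)"
  define g where "g i j = (\<Prod>k\<in>K. \<bar>cos (pi * ((real r ^ i * of_int t - real r ^ j * of_int t) * (1 / real s ^ k)))\<bar>)" for i j
  define F where "F n i = (\<Prod>k\<in>K. \<bar>cos (pi * (real r ^ i * (\<bar>of_int t\<bar> * (1 - 1 / real r ^ n)) * (1 / real s ^ k)))\<bar>)" for n i
  have F0: "F n i \<ge> 0" for n i unfolding F_def by (intro prod_nonneg) auto
  have finJ: "finite J" by (simp add: J_def)
  have gsym: "g i j = g j i" for i j
    unfolding g_def
  proof (intro prod.cong refl)
    fix k
    have "pi * ((real r ^ i * of_int t - real r ^ j * of_int t) * (1 / real s ^ k))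
        = - (pi * ((real r ^ j * of_int t - real r ^ i * of_int t) * (1 / real s ^ k)))"
      by (simp add: algebra_simps)
    then show "\<bar>cos (pi * ((real r ^ i * of_int t - real r ^ j * of_int t) * (1 / real s ^ k)))\<bar>
        = \<bar>cos (pi * ((real r ^ j * of_int t - real r ^ i * of_int t) * (1 / real s ^ k)))\<bar>"
      by (simp only: cos_minus)
  qed
  have gF: "g i j = F (i - j) i" if "j < i" for i j
    unfolding g_def F_def
  proof (intro prod.cong refl)
    fix k
    have "real r ^ i = real r ^ j * real r ^ (i - j)" using that by (simp flip: power_add)
    then have "real r ^ i * (1 - 1 / real r ^ (i - j)) = real r ^ i - real r ^ j"
      using r by (simp add: right_diff_distrib)
    then have eq: "real r ^ i * (\<bar>of_int t\<bar> * (1 - 1 / real r ^ (i - j))) = (real r ^ i - real r ^ j) * \<bar>of_int t\<bar>"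
      by (metis mult.commute mult.left_commute)
    have A: "(real r ^ i * of_int t - real r ^ j * of_int t) * (1 / real s ^ k)
        = (real r ^ i - real r ^ j) * of_int t * (1 / real s ^ k)"
      by (simp only: left_diff_distrib)
    show "\<bar>cos (pi * ((real r ^ i * of_int t - real r ^ j * of_int t) * (1 / real s ^ k)))\<bar>
        = \<bar>cos (pi * (real r ^ i * (\<bar>of_int t\<bar> * (1 - 1 / real r ^ (i - j))) * (1 / real s ^ k)))\<bar>"
      unfolding eq A
    proof (cases "t \<ge> 0")
      case False
      then have "\<bar>real_of_int t\<bar> = - of_int t" by simp
      then have "pi * ((real r ^ i - real r ^ j) * \<bar>of_int t\<bar> * (1 / real s ^ k))
          = - (pi * ((real r ^ i - real r ^ j) * of_int t * (1 / real s ^ k)))" by simp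
      then show "\<bar>cos (pi * ((real r ^ i - real r ^ j) * of_int t * (1 / real s ^ k)))\<bar>
          = \<bar>cos (pi * ((real r ^ i - real r ^ j) * \<bar>of_int t\<bar> * (1 / real s ^ k)))\<bar>"
        by (simp only: cos_minus)
    qed simp
  qed
  have single: "(\<Sum>i\<in>J. F n i) \<le> B" if n: "n \<ge> 1" for n
  proof -
    define \<theta> where "\<theta> = \<bar>of_int t\<bar> * (1 - 1 / real r ^ n)"
    have t1: "\<bar>of_int t :: real\<bar> \<ge> 1" using t by linarith
    have "real r ^ 1 \<le> real r ^ n" using r n by (intro power_increasing) auto
    moreover have "real r ^ 1 \<ge> 2" using r by simp
    ultimately have rn: "real r ^ n \<ge> 2" by (rule order.trans[rotated])
    then have half: "1 - 1 / real r ^ n \<ge> 1 / 2" "1 - 1 / real r ^ n \<le> 1"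
    proof -
      have "1 / real r ^ n \<le> 1 / 2" using rn r by (intro divide_left_mono) auto
      then show "1 - 1 / real r ^ n \<ge> 1 / 2" by simp
      show "1 - 1 / real r ^ n \<le> 1" using r by simp
    qed
    have "1 * (1 / 2) \<le> \<theta>" unfolding \<theta>_def using t1 half by (intro mult_mono) auto
    then have \<theta>1: "\<theta> \<ge> 1 / 2" by simp
    have "\<theta> \<le> \<bar>of_int t\<bar> * 1" unfolding \<theta>_def using half by (intro mult_left_mono) auto
    then have "ln \<theta> \<le> ln \<bar>of_int t\<bar>" using \<theta>1 by (intro ln_mono) auto
    then have \<theta>2: "ln \<theta> \<le> real h" using t by simp
    show ?thesis
      unfolding F_def B_def J_def K_def \<theta>_def[symmetric]
      by (rule cos_single_sum[OF s r D Q lf \<theta>1 \<theta>2])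
  qed
  have gii: "g i i \<le> 1" for i by (simp add: g_def)
  have g0: "g i j \<ge> 0" for i j unfolding g_def by (intro prod_nonneg) auto
  define T where "T = (\<Sum>i\<in>J. \<Sum>j\<in>{j\<in>J. j < i}. g i j)"
  have T: "T \<le> real (card J) * B"
  proof -
    have "T \<le> (\<Sum>i\<in>J. \<Sum>n\<in>{1..card J}. F n i)"
      unfolding T_def
    proof (intro sum_mono)
      fix i assume i: "i \<in> J"
      have "(\<Sum>j\<in>{j\<in>J. j < i}. g i j) = (\<Sum>j\<in>{j\<in>J. j < i}. F (i - j) i)"
        by (intro sum.cong refl gF) auto
      also have "\<dots> = (\<Sum>n\<in>(\<lambda>j. i - j) ` {j\<in>J. j < i}. F n i)"
        by (subst sum.reindex) (auto simp: inj_on_def)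
      also have "\<dots> \<le> (\<Sum>n\<in>{1..card J}. F n i)"
      proof (rule sum_mono2)
        show "(\<lambda>j. i - j) ` {j \<in> J. j < i} \<subseteq> {1..card J}" using i by (auto simp: J_def)
      qed (use F0 in auto)
      finally show "(\<Sum>j\<in>{j\<in>J. j < i}. g i j) \<le> (\<Sum>n\<in>{1..card J}. F n i)" .
    qed
    also have "\<dots> = (\<Sum>n\<in>{1..card J}. \<Sum>i\<in>J. F n i)" by (rule sum.swap)
    also have "\<dots> \<le> (\<Sum>n\<in>{1..card J}. B)" by (intro sum_mono single) auto
    finally show ?thesis by simp
  qed
  have split: "(\<Sum>j\<in>J. g i j) = (\<Sum>j\<in>{j\<in>J. j < i}. g i j) + g i i + (\<Sum>j\<in>{j\<in>J. i < j}. g i j)" if "i \<in> J" for i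
  proof -
    have "J = ({j\<in>J. j < i} \<union> {i}) \<union> {j\<in>J. i < j}" using that by auto
    then have "(\<Sum>j\<in>J. g i j) = (\<Sum>j\<in>({j\<in>J. j < i} \<union> {i}) \<union> {j\<in>J. i < j}. g i j)" by simp
    also have "\<dots> = (\<Sum>j\<in>{j\<in>J. j < i} \<union> {i}. g i j) + (\<Sum>j\<in>{j\<in>J. i < j}. g i j)"
      by (rule sum.union_disjoint) (use finJ in auto)
    also have "(\<Sum>j\<in>{j\<in>J. j < i} \<union> {i}. g i j) = (\<Sum>j\<in>{j\<in>J. j < i}. g i j) + g i i"
      by (subst sum.union_disjoint) (use finJ in auto)
    finally show ?thesis .
  qed
  have "(\<Sum>i\<in>J. \<Sum>j\<in>{j\<in>J. i < j}. g i j) = (\<Sum>j\<in>J. \<Sum>i\<in>{i\<in>J. i < j}. g i j)"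
    by (rule sum.swap_restrict[OF finJ finJ])
  also have "\<dots> = T" unfolding T_def by (intro sum.cong refl) (rule gsym)
  finally have T': "(\<Sum>i\<in>J. \<Sum>j\<in>{j\<in>J. i < j}. g i j) = T" .
  have "(\<Sum>i\<in>J. \<Sum>j\<in>J. g i j) = T + (\<Sum>i\<in>J. g i i) + T"
    using split T' by (simp add: sum.distrib T_def)
  also have "(\<Sum>i\<in>J. g i i) \<le> (\<Sum>i\<in>J. 1)" by (intro sum_mono gii)
  finally have "(\<Sum>i\<in>J. \<Sum>j\<in>J. g i j) \<le> real (card J) + 2 * (real (card J) * B)" using T by simp
  then show ?thesis by (simp only: g_def B_def)
qed

section \<open>The algorithm\<close>

lemma eta_bounds:
  assumes "s m \<ge> 1"
  shows "x \<le> eta br s m x" "eta br s m x \<le> x + 1 / real (s m) ^ br2 br m (s m)"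
proof -
  define q where "q = real (s m) ^ br2 br m (s m)"
  have q: "q > 0" using assms by (simp add: q_def)
  have "eta br s m x = of_int \<lceil>x * q\<rceil> / q"
    unfolding eta_def q_def[symmetric]
  proof (rule Least_equality)
    have "x * q \<le> of_int \<lceil>x * q\<rceil>" by simp
    then show "\<exists>g. of_int \<lceil>x * q\<rceil> / q = of_int g / q \<and> x \<le> of_int \<lceil>x * q\<rceil> / q"
      using q by (intro exI[of _ "\<lceil>x * q\<rceil>"]) (simp add: pos_le_divide_eq)
    fix y assume "\<exists>g. y = of_int g / q \<and> x \<le> y"
    then obtain g where g: "y = of_int g / q" "x \<le> of_int g / q" by auto
    then have "x * q \<le> of_int g" using q by (simp add: pos_le_divide_eq)
    then have "\<lceil>x * q\<rceil> \<le> g" by (simp add: ceiling_le_iff)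
    then show "of_int \<lceil>x * q\<rceil> / q \<le> y" using g q by (auto intro: divide_right_mono)
  qed
  moreover have "x * q \<le> of_int \<lceil>x * q\<rceil>" "of_int \<lceil>x * q\<rceil> \<le> x * q + 1" by linarith+
  then have "x \<le> of_int \<lceil>x * q\<rceil> / q" "of_int \<lceil>x * q\<rceil> / q \<le> (x * q + 1) / q"
    using q by (auto simp: pos_le_divide_eq intro: divide_right_mono)
  moreover have "(x * q + 1) / q = x + 1 / q" using q by (simp add: add_divide_distrib)
  ultimately show "x \<le> eta br s m x" "eta br s m x \<le> x + 1 / real (s m) ^ br2 br m (s m)"
    by (simp_all add: q_def)
qed

abbreviation digit_positions :: "(nat \<Rightarrow> nat) \<Rightarrow> (nat \<Rightarrow> nat) \<Rightarrow> nat \<Rightarrow> nat set" where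
  "digit_positions br s m \<equiv> {br2 br m (s m) + 1..br2 br (m + 1) (s m) - 2}"

lemma sigma_eq:
  "sigma br s m x = (\<lambda>X. eta br s m x + (\<Sum>k\<in>X. 1 / real (s m) ^ k)) ` Pow (digit_positions br s m)"
proof (intro equalityI subsetI)
  fix y assume "y \<in> sigma br s m x"
  then obtain d :: "nat \<Rightarrow> nat" where d: "\<forall>k. d k \<in> {0, 1}"
    "y = eta br s m x + (\<Sum>k\<in>digit_positions br s m. real (d k) / real (s m) ^ k)"
    unfolding sigma_def by auto
  define X where "X = {k\<in>digit_positions br s m. d k = 1}"
  have "(\<Sum>k\<in>digit_positions br s m. real (d k) / real (s m) ^ k) = (\<Sum>k\<in>X. real (d k) / real (s m) ^ k)"
  proof (rule sum.mono_neutral_right)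
    show "\<forall>k\<in>digit_positions br s m - X. real (d k) / real (s m) ^ k = 0"
    proof
      fix k assume "k \<in> digit_positions br s m - X"
      moreover have "d k \<in> {0, 1}" using d(1) by blast
      ultimately have "d k = 0" by (auto simp: X_def)
      then show "real (d k) / real (s m) ^ k = 0" by simp
    qed
  qed (auto simp: X_def)
  also have "\<dots> = (\<Sum>k\<in>X. 1 / real (s m) ^ k)" by (intro sum.cong refl) (auto simp: X_def)
  finally show "y \<in> (\<lambda>X. eta br s m x + (\<Sum>k\<in>X. 1 / real (s m) ^ k)) ` Pow (digit_positions br s m)"
    using d(2) by (auto simp: X_def)
next
  fix y assume "y \<in> (\<lambda>X. eta br s m x + (\<Sum>k\<in>X. 1 / real (s m) ^ k)) ` Pow (digit_positions br s m)"
  then obtain X where X: "X \<subseteq> digit_positions br s m" "y = eta br s m x + (\<Sum>k\<in>X. 1 / real (s m) ^ k)" by auto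
  define d :: "nat \<Rightarrow> nat" where "d k = (if k \<in> X then 1 else 0)" for k
  have "(\<Sum>k\<in>digit_positions br s m. real (d k) / real (s m) ^ k) = (\<Sum>k\<in>X. real (d k) / real (s m) ^ k)"
    by (rule sum.mono_neutral_right) (use X in \<open>auto simp: d_def\<close>)
  also have "\<dots> = (\<Sum>k\<in>X. 1 / real (s m) ^ k)" by (intro sum.cong refl) (auto simp: d_def)
  finally have "y = eta br s m x + (\<Sum>k\<in>digit_positions br s m. real (d k) / real (s m) ^ k)" using X by simp
  moreover have "\<forall>k. d k \<in> {0, 1}" by (simp add: d_def)
  ultimately show "y \<in> sigma br s m x" unfolding sigma_def by blast
qed

lemma sigma_bounds:
  assumes s: "s m \<ge> 2" and y: "y \<in> sigma br s m x"
  shows "x \<le> y" "y \<le> x + 2 / real (s m) ^ br2 br m (s m)"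
proof -
  define a where "a = br2 br m (s m)"
  define q where "q = real (s m)"
  have q: "q \<ge> 2" using s by (simp add: q_def)
  obtain X where X: "X \<subseteq> digit_positions br s m" "y = eta br s m x + (\<Sum>k\<in>X. 1 / q ^ k)"
    using y unfolding sigma_eq q_def by auto
  have finX: "finite X" using X(1) finite_subset by blast
  have "s m \<ge> 1" using s by simp
  note eta = eta_bounds[where s = s and m = m and x = x and br = br, OF this, folded a_def q_def]
  have pos: "(\<Sum>k\<in>X. 1 / q ^ k) \<ge> 0" using q by (intro sum_nonneg) auto
  have geo: "(\<Sum>k = a + 1..<Suc n. 1 / q ^ k) \<le> 1 / q ^ a - 1 / q ^ n" if "n \<ge> a" for n
    using that
  proof (induction n rule: dec_induct)
    case (step n)
    have "2 / q ^ Suc n \<le> 1 / q ^ n" using q by (simp add: field_simps)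
    moreover have "2 / q ^ Suc n = 1 / q ^ Suc n + 1 / q ^ Suc n" by simp
    moreover have "(\<Sum>k = a + 1..<Suc (Suc n). 1 / q ^ k) = (\<Sum>k = a + 1..<Suc n. 1 / q ^ k) + 1 / q ^ Suc n"
      using step by (subst sum.atLeastLessThan_Suc) auto
    ultimately show ?case using step by linarith
  qed simp
  define b where "b = br2 br (m + 1) (s m) - 2"
  have "(\<Sum>k\<in>X. 1 / q ^ k) \<le> (\<Sum>k = a + 1..<Suc (max a b). 1 / q ^ k)"
    using X(1) q by (intro sum_mono2) (auto simp: a_def b_def)
  also have "\<dots> \<le> 1 / q ^ a - 1 / q ^ max a b" by (rule geo) simp
  also have "\<dots> \<le> 1 / q ^ a" using q by simp
  finally have up: "(\<Sum>k\<in>X. 1 / q ^ k) \<le> 1 / q ^ a" .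
  show "x \<le> y" using X(2) eta(1) pos by linarith
  have "2 / q ^ a = 1 / q ^ a + 1 / q ^ a" by simp
  then show "y \<le> x + 2 / real (s m) ^ br2 br m (s m)"
    using X(2) eta(2) up unfolding a_def[symmetric] unfolding q_def[symmetric] by linarith
qed

lemma xi_Suc:
  shows "xi br r s m0 (Suc m) \<in> sigma br s (Suc m) (xi br r s m0 m)"
    and "y \<in> sigma br s (Suc m) (xi br r s m0 m) \<Longrightarrow>
      A' br r m0 (Suc m) (xi br r s m0 (Suc m)) \<le> A' br r m0 (Suc m) y"
proof -
  define S where "S = sigma br s (Suc m) (xi br r s m0 m)"
  define P where "P = is_arg_min (A' br r m0 (Suc m)) (\<lambda>x. x \<in> S)"
  have fin: "finite S" "S \<noteq> {}" unfolding S_def sigma_eq by auto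
  have ex: "\<exists>x. P x" unfolding P_def using fin by (rule ex_is_arg_min_if_finite)
  have "finite {x. P x}" by (rule finite_subset[OF _ fin(1)]) (auto simp: P_def is_arg_min_def)
  then have "(LEAST x. P x) \<in> {x. P x}" using ex Min_in[of "{x. P x}"] by (subst Least_Min) auto
  then have "P (xi br r s m0 (Suc m))" by (simp add: P_def S_def)
  then show "xi br r s m0 (Suc m) \<in> sigma br s (Suc m) (xi br r s m0 m)"
    "y \<in> sigma br s (Suc m) (xi br r s m0 m) \<Longrightarrow>
      A' br r m0 (Suc m) (xi br r s m0 (Suc m)) \<le> A' br r m0 (Suc m) y"
    by (auto simp: P_def is_arg_min_def S_def)
qed

text \<open>
  The minimizer does at least as well as the average over all choices of digits.
\<close>

lemma A'_xi_le:
  assumes m: "m \<ge> 1"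
    and B: "\<And>t i. t \<in> {- int m..int m} - {0} \<Longrightarrow> i \<in> {i\<in>{1..m}. m0 (r i) \<le> m} \<Longrightarrow>
      (\<Sum>j\<in>{br2 br m (r i) + 1..br2 br (m + 1) (r i)}. \<Sum>j'\<in>{br2 br m (r i) + 1..br2 br (m + 1) (r i)}.
        \<Prod>k\<in>digit_positions br s m. \<bar>cos (pi * ((real (r i) ^ j * of_int t - real (r i) ^ j' * of_int t) * (1 / real (s m) ^ k)))\<bar>) \<le> B"
    and B0: "B \<ge> 0"
  shows "A' br r m0 m (xi br r s m0 m) \<le> 2 * real m * real m * B"
proof -
  obtain m' where m': "m = Suc m'" using m by (cases m) auto
  define x where "x = xi br r s m0 m'"
  define K where "K = digit_positions br s m"
  define Ts where "Ts = {- int m..int m} - {0}"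
  define Is where "Is = {i\<in>{1..m}. m0 (r i) \<le> m}"
  define y where "y X = eta br s m x + (\<Sum>k\<in>X. 1 / real (s m) ^ k)" for X
  define J where "J i = {br2 br m (r i) + 1..br2 br (m + 1) (r i)}" for i
  have finK: "finite K" by (simp add: K_def)
  have "2 ^ card K * A' br r m0 m (xi br r s m0 m) = (\<Sum>X\<in>Pow K. A' br r m0 m (xi br r s m0 m))"
    by (simp add: card_Pow finK)
  also have "\<dots> \<le> (\<Sum>X\<in>Pow K. A' br r m0 m (y X))"
  proof (intro sum_mono)
    fix X assume "X \<in> Pow K"
    then have "y X \<in> sigma br s m x" unfolding sigma_eq y_def K_def by auto
    then show "A' br r m0 m (xi br r s m0 m) \<le> A' br r m0 m (y X)"
      unfolding m' x_def by (rule xi_Suc(2))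
  qed
  also have "\<dots> = (\<Sum>t\<in>Ts. \<Sum>i\<in>Is. \<Sum>X\<in>Pow K. (cmod (\<Sum>j\<in>J i. e (real (r i) ^ j * of_int t * y X)))\<^sup>2)"
    unfolding A'_def Ts_def[symmetric] Is_def[symmetric] J_def[symmetric]
    by (subst sum.swap, intro sum.cong refl, rule sum.swap)
  also have "\<dots> \<le> (\<Sum>t\<in>Ts. \<Sum>i\<in>Is. 2 ^ card K * B)"
  proof (intro sum_mono)
    fix t i assume ti: "t \<in> Ts" "i \<in> Is"
    have "(\<Sum>X\<in>Pow K. (cmod (\<Sum>j\<in>J i. e (real (r i) ^ j * of_int t * y X)))\<^sup>2)
        \<le> 2 ^ card K * (\<Sum>j\<in>J i. \<Sum>j'\<in>J i. \<Prod>k\<in>K. \<bar>cos (pi * ((real (r i) ^ j * of_int t - real (r i) ^ j' * of_int t) * (1 / real (s m) ^ k)))\<bar>)"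
      unfolding y_def by (rule cantor_mean_square[OF finK])
    also have "\<dots> \<le> 2 ^ card K * B"
      unfolding J_def K_def using ti by (intro mult_left_mono B) (auto simp: Ts_def Is_def)
    finally show "(\<Sum>X\<in>Pow K. (cmod (\<Sum>j\<in>J i. e (real (r i) ^ j * of_int t * y X)))\<^sup>2) \<le> 2 ^ card K * B" .
  qed
  also have "\<dots> = 2 ^ card K * (real (card Ts) * real (card Is) * B)" by simp
  finally have "A' br r m0 m (xi br r s m0 m) \<le> real (card Ts) * real (card Is) * B"
    by (rule mult_left_le_imp_le) simp
  also have "\<dots> \<le> 2 * real m * real m * B"
  proof (intro mult_right_mono mult_mono B0)
    have "card Ts = 2 * m" by (simp add: Ts_def)
    then show "real (card Ts) \<le> 2 * real m" by simp
    have "card Is \<le> card {1..m}" unfolding Is_def by (intro card_mono) auto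
    then show "real (card Is) \<le> real m" by simp
  qed auto
  finally show ?thesis .
qed

lemma xi_step:
  assumes "s (Suc m) \<ge> 3"
  shows "xi br r s m0 m \<le> xi br r s m0 (Suc m)"
    and "xi br r s m0 (Suc m) \<le> xi br r s m0 m + 2 * real (s (Suc m)) * exp (- real (br (Suc m)))"
proof -
  define q where "q = real (s (Suc m))"
  define a where "a = br2 br (Suc m) (s (Suc m))"
  have q: "q \<ge> 3" using assms by (simp add: q_def)
  have lnq: "ln q \<ge> 1" using q by (rule ln_ge_1)
  have b: "xi br r s m0 m \<le> xi br r s m0 (Suc m)" "xi br r s m0 (Suc m) \<le> xi br r s m0 m + 2 / q ^ a"
    using sigma_bounds[OF _ xi_Suc(1)[of br r s m0 m]] assms unfolding q_def a_def by (auto simp del: xi.simps)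
  show "xi br r s m0 m \<le> xi br r s m0 (Suc m)" by (rule b)
  have "real (br (Suc m)) / ln q \<ge> 0" using lnq by simp
  then have "real a \<ge> real (br (Suc m)) / ln q - 1" unfolding a_def br2_def q_def by linarith
  then have "(real (br (Suc m)) / ln q - 1) * ln q \<le> real a * ln q" using lnq by (intro mult_right_mono) auto
  then have "real (br (Suc m)) - ln q \<le> real a * ln q" using lnq by (simp add: left_diff_distrib)
  then have "exp (real (br (Suc m)) - ln q) \<le> exp (real a * ln q)" by simp
  also have "exp (real a * ln q) = q ^ a" using q by (simp add: exp_of_nat_mult)
  also have "exp (real (br (Suc m)) - ln q) = exp (real (br (Suc m))) / q" using q by (simp add: exp_diff)
  finally have "exp (real (br (Suc m))) / q \<le> q ^ a" .
  then have "2 / q ^ a \<le> 2 / (exp (real (br (Suc m))) / q)" using q by (intro divide_left_mono) auto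
  also have "\<dots> = 2 * q * exp (- real (br (Suc m)))" by (simp add: exp_minus field_simps)
  finally show "xi br r s m0 (Suc m) \<le> xi br r s m0 m + 2 * real (s (Suc m)) * exp (- real (br (Suc m)))"
    using b(2) unfolding q_def by linarith
qed

text \<open>
  Step \<open>k\<close> moves the approximation by at most $2s_ke^{-\langle k\rangle}$, and the bound
  $2Cke^{-\langle k\rangle}$ is halved from step to step once $\langle k\rangle$ grows by at least 2.
\<close>

lemma xi_limit:
  fixes C :: nat
  assumes s: "\<And>m. m \<ge> 1 \<Longrightarrow> 3 \<le> s m \<and> s m \<le> C * m"
    and br: "\<And>m. m \<ge> m1 \<Longrightarrow> br (Suc m) \<ge> br m + 2"
  shows "\<exists>\<xi>. xi br r s m0 \<longlonglongrightarrow> \<xi> \<and>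
    (\<forall>m\<ge>m1. xi br r s m0 m \<le> \<xi> \<and> \<xi> \<le> xi br r s m0 m + 4 * real C * real (m + 1) * exp (- real (br (m + 1))))"
proof -
  define x where "x = xi br r s m0"
  define E where "E m = 2 * real C * real (m + 1) * exp (- real (br (m + 1)))" for m
  have E0: "E m \<ge> 0" for m by (simp add: E_def)
  have mono: "x m \<le> x (Suc m)" for m unfolding x_def using s[of "Suc m"] by (intro xi_step(1)) auto
  have inc: "incseq x" by (rule incseq_SucI) (rule mono)
  have step: "x (Suc m) \<le> x m + E m" for m
  proof -
    have "real (s (Suc m)) \<le> real (C * Suc m)" using s[of "Suc m"] by (intro of_nat_mono) auto
    then have "2 * real (s (Suc m)) * exp (- real (br (Suc m))) \<le> E m"
      unfolding E_def Suc_eq_plus1[symmetric] by (intro mult_right_mono) (auto simp: algebra_simps)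
    moreover have "x (Suc m) \<le> x m + 2 * real (s (Suc m)) * exp (- real (br (Suc m)))"
      unfolding x_def using s[of "Suc m"] by (intro xi_step(2)) auto
    ultimately show ?thesis by linarith
  qed
  have E_half: "E (Suc m) \<le> E m / 2" if "m \<ge> m1" for m
  proof -
    have "br (Suc m) + 2 \<le> br (Suc (Suc m))" using br[of "Suc m"] that by simp
    then have "exp (- real (br (Suc (Suc m)))) \<le> exp (- real (br (Suc m)) - 2)" by simp
    also have "\<dots> = exp (- real (br (Suc m))) * exp (- 2)" by (simp flip: exp_add)
    also have "\<dots> \<le> exp (- real (br (Suc m))) * (1 / 4)"
    proof (intro mult_left_mono)
      have "(2::real) \<le> exp 1" using exp_ge_add_one_self[of 1] by simp
      then have "2 * 2 \<le> exp 1 * exp (1::real)" by (intro mult_mono) auto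
      then have "4 \<le> exp (2::real)" by (simp flip: exp_add)
      then show "exp (- 2) \<le> (1 / 4 :: real)" by (simp add: exp_minus field_simps)
    qed auto
    finally have ex: "exp (- real (br (Suc (Suc m)))) \<le> exp (- real (br (Suc m))) * (1 / 4)" .
    have "E (Suc m) = 2 * real C * real (m + 2) * exp (- real (br (Suc (Suc m))))" by (simp add: E_def)
    also have "\<dots> \<le> 2 * real C * (2 * real (m + 1)) * (exp (- real (br (Suc m))) * (1 / 4))"
      using ex by (intro mult_mono mult_left_mono) auto
    also have "\<dots> = E m / 2" by (simp add: E_def)
    finally show ?thesis .
  qed
  have bound: "x (m + n) \<le> x m + 2 * E m" if m: "m \<ge> m1" for m n
    using m
  proof (induction n arbitrary: m)
    case (Suc n)
    have "x (Suc m + n) \<le> x (Suc m) + 2 * E (Suc m)" by (rule Suc.IH) (use Suc.prems in simp)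
    also have "\<dots> \<le> x m + E m + 2 * (E m / 2)" using step[of m] E_half[of m] Suc.prems by (intro add_mono mult_left_mono) auto
    finally show ?case by simp
  qed (use E0 in auto)
  have "bdd_above (range x)"
  proof (rule bdd_aboveI2)
    fix n
    have "x n \<le> x (m1 + n)" using inc by (auto simp: incseq_def)
    also have "\<dots> \<le> x m1 + 2 * E m1" by (rule bound) simp
    finally show "x n \<le> x m1 + 2 * E m1" .
  qed
  define \<xi> where "\<xi> = (SUP i. x i)"
  have \<xi>: "x \<longlonglongrightarrow> \<xi>" unfolding \<xi>_def using \<open>bdd_above (range x)\<close> inc by (rule LIMSEQ_incseq_SUP)
  have "x m \<le> \<xi> \<and> \<xi> \<le> x m + 2 * E m" if m: "m \<ge> m1" for m
  proof
    show "x m \<le> \<xi>" using inc \<xi> by (rule incseq_le)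
    have "x n \<le> x m + 2 * E m" if "n \<ge> m" for n using bound[OF m, of "n - m"] that by simp
    then show "\<xi> \<le> x m + 2 * E m" by (intro LIMSEQ_le_const2[OF \<xi>]) auto
  qed
  moreover have "2 * E m = 4 * real C * real (m + 1) * exp (- real (br (m + 1)))" for m
    by (simp add: E_def)
  ultimately show ?thesis using \<xi> unfolding x_def by (intro exI[of _ \<xi>]) simp
qed

lemma cmod_e_diff: "cmod (e x - e y) \<le> 2 * pi * \<bar>x - y\<bar>"
proof -
  have "e x - e y = e y * (e (x - y) - 1)" using e_add[of y "x - y"] by (simp add: algebra_simps)
  then have "cmod (e x - e y) = cmod (e (x - y) - 1)" by (simp add: norm_mult)
  also have "\<dots> = cmod (exp (\<i> * of_real (2 * pi * (x - y))) - 1)" by (simp add: e_altdef cis_conv_exp)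
  also have "\<dots> = 2 * \<bar>sin ((2 * pi * (x - y)) / 2)\<bar>"
    using dist_exp_i_1[of "2 * pi * (x - y)"] by simp
  also have "\<dots> \<le> 2 * \<bar>(2 * pi * (x - y)) / 2\<bar>" by (intro mult_left_mono abs_sin_x_le_abs_x) auto
  finally show ?thesis by (simp add: abs_mult)
qed

text \<open>
  The powers of \<open>b\<close> grow geometrically, so the sum of all differences is dominated by the one with the
  largest exponent.
\<close>

lemma exp_sum_perturb:
  fixes b N t :: nat and \<xi> x :: real
  assumes b: "b \<ge> 2" and J: "J \<subseteq> {..nat \<lfloor>real N / ln (real b)\<rfloor>}"
  shows "cmod (\<Sum>j\<in>J. e (real b ^ j * real t * \<xi>))
    \<le> cmod (\<Sum>j\<in>J. e (real b ^ j * real t * x)) + 4 * pi * real t * exp (real N) * \<bar>\<xi> - x\<bar>"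
proof -
  define n where "n = nat \<lfloor>real N / ln (real b)\<rfloor>"
  have lnb: "ln (real b) > 0" using b by simp
  have geo: "(\<Sum>j\<le>n. real b ^ j) \<le> 2 * real b ^ n" for n
  proof (induction n)
    case (Suc n)
    have "2 * real b ^ n \<le> real b * real b ^ n" using b by (intro mult_right_mono) auto
    then show ?case using Suc by simp
  qed simp
  have "real n \<le> real N / ln (real b)" using lnb unfolding n_def by simp
  then have "real n * ln (real b) \<le> real N" using lnb by (simp add: pos_le_divide_eq)
  then have "exp (real n * ln (real b)) \<le> exp (real N)" by simp
  then have bn: "real b ^ n \<le> exp (real N)" using b by (simp add: exp_of_nat_mult)
  have "cmod ((\<Sum>j\<in>J. e (real b ^ j * real t * \<xi>)) - (\<Sum>j\<in>J. e (real b ^ j * real t * x)))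
      \<le> (\<Sum>j\<in>J. cmod (e (real b ^ j * real t * \<xi>) - e (real b ^ j * real t * x)))"
    unfolding sum_subtractf[symmetric] by (rule norm_sum)
  also have "\<dots> \<le> (\<Sum>j\<in>J. 2 * pi * real t * \<bar>\<xi> - x\<bar> * real b ^ j)"
  proof (intro sum_mono)
    fix j
    have "cmod (e (real b ^ j * real t * \<xi>) - e (real b ^ j * real t * x)) \<le> 2 * pi * \<bar>real b ^ j * real t * \<xi> - real b ^ j * real t * x\<bar>"
      by (rule cmod_e_diff)
    also have "\<bar>real b ^ j * real t * \<xi> - real b ^ j * real t * x\<bar> = real b ^ j * real t * \<bar>\<xi> - x\<bar>"
      by (simp add: abs_mult flip: right_diff_distrib)
    finally show "cmod (e (real b ^ j * real t * \<xi>) - e (real b ^ j * real t * x)) \<le> 2 * pi * real t * \<bar>\<xi> - x\<bar> * real b ^ j"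
      by (simp add: mult_ac)
  qed
  also have "\<dots> = 2 * pi * real t * \<bar>\<xi> - x\<bar> * (\<Sum>j\<in>J. real b ^ j)" by (simp add: sum_distrib_left)
  also have "\<dots> \<le> 2 * pi * real t * \<bar>\<xi> - x\<bar> * (2 * exp (real N))"
  proof (intro mult_left_mono)
    have "(\<Sum>j\<in>J. real b ^ j) \<le> (\<Sum>j\<le>n. real b ^ j)" using J unfolding n_def by (intro sum_mono2) auto
    also have "\<dots> \<le> 2 * real b ^ n" by (rule geo)
    also have "\<dots> \<le> 2 * exp (real N)" using bn by simp
    finally show "(\<Sum>j\<in>J. real b ^ j) \<le> 2 * exp (real N)" .
  qed auto
  finally have "cmod ((\<Sum>j\<in>J. e (real b ^ j * real t * \<xi>)) - (\<Sum>j\<in>J. e (real b ^ j * real t * x)))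
      \<le> 4 * pi * real t * exp (real N) * \<bar>\<xi> - x\<bar>" by (simp add: mult_ac)
  then show ?thesis
    using norm_triangle_sub[of "\<Sum>j\<in>J. e (real b ^ j * real t * \<xi>)" "\<Sum>j\<in>J. e (real b ^ j * real t * x)"] by linarith
qed

section \<open>Block lengths\<close>

lemma exp_bracket_bounds:
  fixes c :: real and m :: nat
  shows "real (exp_bracket c m) \<le> exp (real m powr c)" "exp (real m powr c) < real (exp_bracket c m) + 1"
proof -
  have "exp (real m powr c) \<ge> 0" by simp
  then show "real (exp_bracket c m) \<le> exp (real m powr c)" "exp (real m powr c) < real (exp_bracket c m) + 1"
    unfolding exp_bracket_def by linarith+
qed

lemma exp_bracket_mono: "c > 0 \<Longrightarrow> m \<le> n \<Longrightarrow> exp_bracket c m \<le> exp_bracket c n"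
  unfolding exp_bracket_def by (intro nat_mono floor_mono) (auto intro: powr_mono2)

abbreviation block_size :: "real \<Rightarrow> nat \<Rightarrow> real" where
  "block_size c m \<equiv> real (exp_bracket c (m + 1)) - real (exp_bracket c m)"

abbreviation exp_block :: "real \<Rightarrow> nat \<Rightarrow> nat \<Rightarrow> nat set" where
  "exp_block c b m \<equiv> {br2 (exp_bracket c) m (real b) + 1..br2 (exp_bracket c) (m + 1) (real b)}"

lemma block_size_lower:
  assumes c: "0 < c" "c < 1" and C: "C > 0"
  shows "\<forall>\<^sub>F m in sequentially. exp ((ln (real m) + C) ^ 14) \<le> block_size c m"
proof -
  have "\<forall>\<^sub>F m in sequentially. exp ((ln (real m) + C) ^ 14) \<le> exp (real (m + 1) powr c) - exp (real m powr c) - 1"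
    using c C by real_asymp
  then show ?thesis
  proof eventually_elim
    case (elim m)
    then show ?case using exp_bracket_bounds[where c = c and m = m] exp_bracket_bounds[where c = c and m = "m + 1"] by linarith
  qed
qed

lemma block_size_upper:
  assumes c: "0 < c" "c < 1"
  shows "\<forall>\<^sub>F m in sequentially. block_size c m \<le> 4 * real (exp_bracket c m) * real m powr (c - 1)"
proof -
  have "\<forall>\<^sub>F m in sequentially. exp (real (m + 1) powr c) - exp (real m powr c) + 1 \<le> 4 * (exp (real m powr c) - 1) * real m powr (c - 1)"
    using c by real_asymp
  then show ?thesis
  proof eventually_elim
    case (elim m)
    have "(exp (real m powr c) - 1) * real m powr (c - 1) \<le> real (exp_bracket c m) * real m powr (c - 1)"
      using exp_bracket_bounds[where c = c and m = m] by (intro mult_right_mono) auto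
    then show ?case using elim exp_bracket_bounds[where c = c and m = m] exp_bracket_bounds[where c = c and m = "m + 1"] by linarith
  qed
qed

text \<open>
  Inductive step for bounding the accumulated errors of the blocks: the sum of
  \<open>block_size c k * k powr (c - 1)\<close> over \<open>k < m\<close> is at most $2\langle m\rangle m^{c-1}$ up to an additive constant. The factor
  2 leaves room for the decrease of $m^{c-1}$, whose relative size $1/m$ is small against the relative
  increase $m^{c-1}$ of $\langle m\rangle$.
\<close>

lemma block_sum_step:
  assumes c: "0 < c" "c < 1"
  shows "\<forall>\<^sub>F m in sequentially. 2 * real (exp_bracket c m) * real m powr (c - 1) + block_size c m * real m powr (c - 1)
    \<le> 2 * real (exp_bracket c (m + 1)) * real (m + 1) powr (c - 1)"
proof -
  have 1: "\<forall>\<^sub>F m in sequentially. real m powr (c - 1) * exp (real m powr c)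
      \<le> (exp (real (m + 1) powr c) - 1) * (2 * real (m + 1) powr (c - 1) - real m powr (c - 1))"
    using c by real_asymp
  have 2: "\<forall>\<^sub>F m in sequentially. 2 * real (m + 1) powr (c - 1) - real m powr (c - 1) \<ge> 0"
    using c by real_asymp
  from 1 2 show ?thesis
  proof eventually_elim
    case (elim m)
    define u v where "u = real m powr (c - 1)" and "v = real (m + 1) powr (c - 1)"
    define M M' where "M = real (exp_bracket c m)" and "M' = real (exp_bracket c (m + 1))"
    have "u * M \<le> u * exp (real m powr c)" unfolding u_def M_def by (intro mult_left_mono exp_bracket_bounds) auto
    also have "\<dots> \<le> (exp (real (m + 1) powr c) - 1) * (2 * v - u)" using elim by (simp only: u_def v_def)
    also have "\<dots> \<le> M' * (2 * v - u)"
      using exp_bracket_bounds(2)[where c = c and m = "m + 1"] elim unfolding M'_def u_def v_def by (intro mult_right_mono) linarith+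
    finally have "2 * M * u + (M' - M) * u \<le> 2 * M' * v" by (simp add: algebra_simps)
    then show ?case by (simp only: u_def v_def M_def M'_def)
  qed
qed

lemma log_le_power: "0 < c \<Longrightarrow> \<forall>\<^sub>F m in sequentially. 343 * (1 + ln (3 * real m)) \<le> real m powr c"
  by real_asymp

lemma lower_terms_negligible:
  assumes c: "0 < c" "c < 1"
  shows "\<forall>\<^sub>F m in sequentially. C \<le> real (exp_bracket c m) * real m powr (c - 1)"
proof -
  have "\<forall>\<^sub>F m in sequentially. C \<le> (exp (real m powr c) - 1) * real m powr (c - 1)"
    using c by real_asymp
  then show ?thesis
  proof eventually_elim
    case (elim m)
    have "(exp (real m powr c) - 1) * real m powr (c - 1) \<le> real (exp_bracket c m) * real m powr (c - 1)"
      using exp_bracket_bounds[where c = c and m = m] by (intro mult_right_mono) auto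
    then show ?case using elim by linarith
  qed
qed

lemma exp_bracket_at_top:
  assumes c: "0 < c"
  shows "filterlim (\<lambda>m. real (exp_bracket c m)) at_top sequentially"
proof -
  have "filterlim (\<lambda>m. exp (real m powr c) - 1) at_top sequentially" using c by real_asymp
  then show ?thesis
    by (rule filterlim_at_top_mono) (use exp_bracket_bounds(2)[where c = c] in \<open>auto intro!: always_eventually less_imp_le simp: algebra_simps\<close>)
qed

section \<open>From blocks to initial segments\<close>

text \<open>
  An initial segment consists of complete blocks, whose errors add up to $O(\langle m\rangle m^{c-1})$ by
  \<open>block_sum_step\<close>, and of an incomplete block, which has at most that many elements. Its length \<open>n\<close> is at
  least of the order of $\langle m\rangle$, and $\log n\le3m^c$, so that $m^{c-1}$ is at most a constant times
  $(\log n)^{-A}$.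
\<close>

lemma discrepancy_from_blocks:
  fixes c A \<xi> K :: real and b start :: nat
  defines "N \<equiv> (\<lambda>k. br2 (exp_bracket c) k (real b))"
  assumes c: "0 < c" "c < 1" and A: "A > 0" "c * A = 1 - c" and b: "b \<ge> 2"
    and block: "\<And>k I. k \<ge> start \<Longrightarrow> is_interval I \<Longrightarrow> I \<subseteq> {0..<1} \<Longrightarrow>
      \<bar>real (card {j\<in>{N k + 1..N (k + 1)}. frac (real b ^ j * \<xi>) \<in> I}) - real (card {N k + 1..N (k + 1)}) * measure lborel I\<bar>
        \<le> block_size c k * real k powr (c - 1)"
  shows "(\<lambda>n. discrepancy n (\<lambda>i. frac (real b ^ (i - 1) * \<xi>))) \<in> O(\<lambda>n. ln (ln (real n)) / ln (real n) powr A)"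
proof -
  define M where "M k = real (exp_bracket c k)" for k
  have lnb: "ln (real b) \<ge> 2 / 3" using b by (intro ln_ge_two_thirds) auto
  have N_bounds: "real (N k) \<le> M k / ln (real b)" "M k / ln (real b) < real (N k) + 1" for k
  proof -
    have "M k / ln (real b) \<ge> 0" using lnb by (auto simp: M_def)
    then show "real (N k) \<le> M k / ln (real b)" "M k / ln (real b) < real (N k) + 1"
      unfolding N_def br2_def M_def by linarith+
  qed
  have N_mono: "N k \<le> N l" if "k \<le> l" for k l
    unfolding N_def br2_def using exp_bracket_mono[OF c(1) that] lnb
    by (intro nat_mono floor_mono divide_right_mono) auto
  define F where "F I S = real (card {j\<in>S. frac (real b ^ j * \<xi>) \<in> I}) - real (card S) * measure lborel I"
    for I and S :: "nat set"
  have F_union: "F I (S \<union> T) = F I S + F I T" if "finite S" "finite T" "S \<inter> T = {}" for I S T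
  proof -
    have "{j\<in>S \<union> T. frac (real b ^ j * \<xi>) \<in> I} = {j\<in>S. frac (real b ^ j * \<xi>) \<in> I} \<union> {j\<in>T. frac (real b ^ j * \<xi>) \<in> I}"
      by auto
    then have "card {j\<in>S \<union> T. frac (real b ^ j * \<xi>) \<in> I} = card {j\<in>S. frac (real b ^ j * \<xi>) \<in> I} + card {j\<in>T. frac (real b ^ j * \<xi>) \<in> I}"
      using that by (simp only:) (intro card_Un_disjoint, auto)
    moreover have "card (S \<union> T) = card S + card T" using that by (rule card_Un_disjoint)
    ultimately show ?thesis by (simp add: F_def algebra_simps)
  qed
  have F_triv: "\<bar>F I S\<bar> \<le> real (card S)" if I: "is_interval I" "I \<subseteq> {0..<1}" and "finite S" for I S
  proof -
    have "card {j\<in>S. frac (real b ^ j * \<xi>) \<in> I} \<le> card S" using that by (intro card_mono) auto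
    moreover have "measure lborel I \<le> 1"
      proof (cases "I = {}")
        case False
        obtain \<alpha> \<beta> where "0 \<le> \<alpha>" "\<beta> \<le> 1" "measure lborel I = \<beta> - \<alpha>"
          by (rule unit_interval_bounds[OF I False])
        then show ?thesis by simp
      qed simp
    then have "real (card S) * measure lborel I \<le> real (card S) * 1" by (intro mult_left_mono) auto
    moreover have "0 \<le> real (card S) * measure lborel I" by simp
    ultimately show ?thesis unfolding F_def by linarith
  qed
  obtain m2 where m2: "\<And>m. m \<ge> m2 \<Longrightarrow> 2 * M m * real m powr (c - 1) + block_size c m * real m powr (c - 1)
      \<le> 2 * M (m + 1) * real (m + 1) powr (c - 1)"
    using block_sum_step[OF c] unfolding M_def eventually_sequentially by auto
  obtain m3 where m3: "\<And>m. m \<ge> m3 \<Longrightarrow> block_size c m \<le> 4 * M m * real m powr (c - 1)"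
    using block_size_upper[OF c] unfolding M_def eventually_sequentially by auto
  define m4 where "m4 = max start (max m2 (max m3 1))"
  have m4: "m4 \<ge> start" "m4 \<ge> m2" "m4 \<ge> m3" "m4 \<ge> 1" by (auto simp: m4_def)
  define C0 where "C0 = real (N m4) + 2"
  have main: "\<bar>F I {0..N m}\<bar> \<le> C0 + 2 * M m * real m powr (c - 1)" if "m \<ge> m4" and I: "is_interval I" "I \<subseteq> {0..<1}" for m I
    using that(1)
  proof (induction m rule: dec_induct)
    case base
    have "\<bar>F I {0..N m4}\<bar> \<le> real (card {0..N m4})" by (rule F_triv[OF I]) simp
    also have "\<dots> \<le> C0" by (simp add: C0_def)
    also have "\<dots> \<le> C0 + 2 * M m4 * real m4 powr (c - 1)" by (simp add: M_def)
    finally show ?case .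
  next
    case (step k)
    have "{0..N (Suc k)} = {0..N k} \<union> {N k + 1..N (Suc k)}" using N_mono[of k "Suc k"] by auto
    then have "F I {0..N (Suc k)} = F I {0..N k} + F I {N k + 1..N (Suc k)}"
      by (simp only:) (rule F_union, auto)
    then have "\<bar>F I {0..N (Suc k)}\<bar> \<le> \<bar>F I {0..N k}\<bar> + \<bar>F I {N k + 1..N (Suc k)}\<bar>" by linarith
    moreover have "\<bar>F I {N k + 1..N (Suc k)}\<bar> \<le> block_size c k * real k powr (c - 1)"
      using block[of k I] I step.hyps m4 unfolding F_def by simp
    moreover have "2 * M k * real k powr (c - 1) + block_size c k * real k powr (c - 1)
      \<le> 2 * M (Suc k) * real (Suc k) powr (c - 1)" using m2[of k] step.hyps m4 by simp
    ultimately show ?case using step.IH by linarith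
  qed
  obtain m5 where m5: "\<And>m. m \<ge> m5 \<Longrightarrow> C0 + 2 \<le> M m * real m powr (c - 1)"
    using lower_terms_negligible[OF c, of "C0 + 2"] unfolding M_def eventually_sequentially by auto
  obtain m6 where m6: "\<And>m. m \<ge> m6 \<Longrightarrow> 2 * ln (real b) \<le> M m"
    using exp_bracket_at_top[OF c(1)] unfolding filterlim_at_top eventually_sequentially M_def by meson
  define m7 where "m7 = max m4 (max m5 m6)"
  have m7: "m7 \<ge> m4" "m7 \<ge> m5" "m7 \<ge> m6" by (auto simp: m7_def)
  define C1 where "C1 = 22 * ln (real b)"
  have C1: "C1 \<ge> 0" using lnb by (simp add: C1_def)
  have fine: "discrepancy n (\<lambda>i. frac (real b ^ (i - 1) * \<xi>)) \<le> C1 * real m powr (c - 1) * 1"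
    if m: "m \<ge> m7" and n: "N m < n" "n \<le> N (m + 1)" for m n
  proof (rule discrepancy_leI)
    fix I :: "real set" assume I: "is_interval I" "I \<subseteq> {0..<1}"
    have mge: "m \<ge> m4" "m \<ge> m5" "m \<ge> m6" "m \<ge> m3" using m m7 m4 by auto
    define P where "P = M m * real m powr (c - 1)"
    have P0: "P \<ge> 0" by (simp add: P_def M_def)
    have "{0..<n} = {0..N m} \<union> {N m + 1..<n}" using n by auto
    then have "F I {0..<n} = F I {0..N m} + F I {N m + 1..<n}" by (simp only:) (rule F_union, auto)
    then have "\<bar>F I {0..<n}\<bar> \<le> \<bar>F I {0..N m}\<bar> + \<bar>F I {N m + 1..<n}\<bar>" by linarith
    also have "\<bar>F I {0..N m}\<bar> \<le> C0 + 2 * P" using main[OF mge(1) I] by (simp add: P_def)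
    also have "\<bar>F I {N m + 1..<n}\<bar> \<le> real (card {N m + 1..<n})" by (rule F_triv[OF I]) simp
    also have "real (card {N m + 1..<n}) \<le> real (N (m + 1)) - real (N m)" using n by simp
    also have "real (N (m + 1)) - real (N m) \<le> M (m + 1) / ln (real b) - M m / ln (real b) + 1"
      using N_bounds(1)[of "m + 1"] N_bounds(2)[of m] by linarith
    also have "M (m + 1) / ln (real b) - M m / ln (real b) = (M (m + 1) - M m) / ln (real b)"
      by (simp add: diff_divide_distrib)
    also have "\<dots> \<le> (M (m + 1) - M m) / (1 / 2)"
      using lnb exp_bracket_mono[OF c(1), of m "m + 1"] unfolding M_def by (intro divide_left_mono) auto
    also have "\<dots> = 2 * (M (m + 1) - M m)" by simp
    also have "M (m + 1) - M m \<le> 4 * P" using m3[OF mge(4)] unfolding P_def M_def by simp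
    finally have "\<bar>F I {0..<n}\<bar> \<le> C0 + 2 * P + (2 * (4 * P) + 1)" by simp
    also have "\<dots> \<le> 11 * P" using m5[OF mge(2)] unfolding P_def[symmetric] by linarith
    finally have up: "\<bar>F I {0..<n}\<bar> \<le> 10 * P + P" by simp
    have n_low: "real n \<ge> M m / (2 * ln (real b))"
    proof -
      have "real n \<ge> real (N m) + 1" using n by linarith
      then have "real n \<ge> M m / ln (real b)" using N_bounds(2)[of m] by linarith
      moreover have "M m / (2 * ln (real b)) \<le> M m / ln (real b)"
        using lnb by (intro divide_left_mono) (auto simp: M_def)
      ultimately show ?thesis by linarith
    qed
    have Mpos: "M m > 0" using m6[OF mge(3)] lnb by linarith
    have npos: "real n > 0" using n by simp
    have cards: "card {i\<in>{1..n}. frac (frac (real b ^ (i - 1) * \<xi>)) \<in> I} = card {j\<in>{0..<n}. frac (real b ^ j * \<xi>) \<in> I}"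
      by (rule bij_betw_same_card[where f = "\<lambda>i. i - 1"], rule bij_betwI[where g = Suc]) auto
    have "\<bar>real (card {i\<in>{1..n}. frac (frac (real b ^ (i - 1) * \<xi>)) \<in> I}) / real n - measure lborel I\<bar> = \<bar>F I {0..<n}\<bar> / real n"
    proof -
      have "real (card {i\<in>{1..n}. frac (frac (real b ^ (i - 1) * \<xi>)) \<in> I}) / real n - measure lborel I = F I {0..<n} / real n"
        unfolding cards F_def using npos by (simp add: diff_divide_distrib)
      then show ?thesis by (simp add: abs_divide)
    qed
    also have "\<dots> \<le> (11 * P) / (M m / (2 * ln (real b)))"
    proof (rule frac_le)
      show "0 < M m / (2 * ln (real b))" using Mpos lnb by simp
    qed (use up P0 n_low in auto)
    also have "\<dots> = 22 * ln (real b) * real m powr (c - 1)" using Mpos by (simp add: P_def)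
    finally show "\<bar>real (card {i\<in>{1..n}. frac (frac (real b ^ (i - 1) * \<xi>)) \<in> I}) / real n - measure lborel I\<bar>
        \<le> C1 * real m powr (c - 1) * 1" by (simp add: C1_def)
  qed
  define C where "C = C1 * 3 powr A"
  have final: "discrepancy n (\<lambda>i. frac (real b ^ (i - 1) * \<xi>)) \<le> C * (1 / ln (real n) powr A)" if n: "n > N m7" "n \<ge> 2" for n
  proof -
    have "\<exists>k. N k \<ge> n"
    proof -
      obtain k where "real (n + 1) * ln (real b) \<le> M k"
        using exp_bracket_at_top[OF c(1)] unfolding filterlim_at_top eventually_sequentially M_def by blast
      then have "real (n + 1) \<le> M k / ln (real b)" using lnb by (simp add: pos_le_divide_eq)
      then have "real n \<le> real (N k)" using N_bounds(2)[of k] by simp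
      then show ?thesis by auto
    qed
    then obtain k where k: "N k \<ge> n" "\<And>l. l < k \<Longrightarrow> \<not> N l \<ge> n"
      using exists_least_iff[of "\<lambda>k. N k \<ge> n"] by blast
    have "k > m7" using k(1) n(1) N_mono[of k m7] by (cases "k \<le> m7") auto
    define m where "m = k - 1"
    have m: "m \<ge> m7" "k = m + 1" "N m < n" "n \<le> N (m + 1)"
      using \<open>k > m7\<close> k(1) k(2)[of "k - 1"] by (auto simp: m_def)
    have m1: "m \<ge> 1" using m m7 m4 by simp
    have "real n \<le> M (m + 1) / ln (real b)" using m(4) N_bounds(1)[of "m + 1"] by linarith
    also have "\<dots> \<le> M (m + 1) / (1 / 2)" using lnb by (intro divide_left_mono) (auto simp: M_def)
    also have "\<dots> \<le> 2 * exp (real (m + 1) powr c)" using exp_bracket_bounds(1)[where c = c and m = "m + 1"] by (simp add: M_def)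
    finally have "ln (real n) \<le> ln (2 * exp (real (m + 1) powr c))" using n by (intro ln_mono) auto
    also have "\<dots> = ln 2 + real (m + 1) powr c" by (simp add: ln_mult)
    also have "\<dots> \<le> 1 + real (m + 1) powr c" using ln_2_less_1 by simp
    also have "real (m + 1) powr c \<le> 2 * real m powr c"
    proof -
      have "real (m + 1) powr c \<le> (2 * real m) powr c" using m1 c by (intro powr_mono2) auto
      also have "\<dots> = 2 powr c * real m powr c" by (simp add: powr_mult)
      also have "\<dots> \<le> 2 powr 1 * real m powr c" using c by (intro mult_right_mono powr_mono) auto
      finally show ?thesis by simp
    qed
    also have "1 + 2 * real m powr c \<le> 3 * real m powr c"
      using m1 c ge_one_powr_ge_zero[of "real m" c] by simp
    finally have lnn: "ln (real n) \<le> 3 * real m powr c" by simp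
    have lnn0: "ln (real n) > 0" using n by simp
    have "ln (real n) powr A \<le> (3 * real m powr c) powr A" using lnn lnn0 A by (intro powr_mono2) auto
    also have "\<dots> = 3 powr A * real m powr (1 - c)" using A by (simp add: powr_mult powr_powr)
    finally have "ln (real n) powr A * real m powr (c - 1) \<le> (3 powr A * real m powr (1 - c)) * real m powr (c - 1)"
      by (intro mult_right_mono) auto
    also have "\<dots> = 3 powr A" using m1 by (simp add: mult.assoc flip: powr_add)
    finally have "real m powr (c - 1) \<le> 3 powr A / ln (real n) powr A" using lnn0 by (simp add: field_simps)
    then have "C1 * real m powr (c - 1) \<le> C1 * (3 powr A / ln (real n) powr A)" using C1 by (intro mult_left_mono)
    then show ?thesis using fine[OF m(1,3,4)] by (simp add: C_def)
  qed
  show ?thesis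
  proof (rule bigoI[where c = C])
    have "\<forall>\<^sub>F n in sequentially. ln (ln (real n)) \<ge> 1" by real_asymp
    moreover have "\<forall>\<^sub>F n in sequentially. ln (real n) > 0" by real_asymp
    ultimately show "\<forall>\<^sub>F n in sequentially. norm (discrepancy n (\<lambda>i. frac (real b ^ (i - 1) * \<xi>)))
        \<le> C * norm (ln (ln (real n)) / ln (real n) powr A)"
      using eventually_gt_at_top[of "N m7"] eventually_ge_at_top[of 2]
    proof eventually_elim
      case (elim n)
      have "C \<ge> 0" using C1 by (simp add: C_def)
      have "discrepancy n (\<lambda>i. frac (real b ^ (i - 1) * \<xi>)) \<le> C * (1 / ln (real n) powr A)"
        using final elim by simp
      also have "\<dots> \<le> C * (ln (ln (real n)) / ln (real n) powr A)"
        using elim \<open>C \<ge> 0\<close> by (intro mult_left_mono divide_right_mono) auto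
      finally show ?case using discrepancy_nonneg elim by simp
    qed
  qed
qed

section \<open>Assembly\<close>

lemma mult_independent:
  fixes b s :: nat
  assumes "b \<ge> 2" "s \<ge> 2" "\<not> mult_dependent b s" "b ^ x = s ^ y"
  shows "x = 0"
proof (rule ccontr)
  assume x: "x \<noteq> 0"
  have y: "y \<noteq> 0"
  proof
    assume "y = 0"
    then have "b ^ x = 1" using assms(4) by simp
    then show False using x assms(1) by simp
  qed
  have "real b ^ x = real s ^ y" using assms(4) by (simp flip: of_nat_power)
  then have eq: "real b powr real x = real s powr real y" using assms(1,2) by (simp add: powr_realpow)
  have "real b = (real b powr real x) powr (1 / real x)" using assms(1) x by (simp add: powr_powr)
  also have "\<dots> = real s powr (real y / real x)" unfolding eq by (simp add: powr_powr)
  finally have 1: "real b = real s powr (real y / real x)" .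
  have "real s = (real s powr real y) powr (1 / real y)" using assms(2) y by (simp add: powr_powr)
  also have "\<dots> = real b powr (real x / real y)" unfolding eq[symmetric] by (simp add: powr_powr)
  finally have 2: "real s = real b powr (real x / real y)" .
  have "real y / real x \<in> \<rat>" "real x / real y \<in> \<rat>" by (auto intro!: Rats_divide Rats_of_nat)
  then have "mult_dependent b s" unfolding mult_dependent_def using 1 2 by blast
  then show False using assms(3) by simp
qed

lemma card_block_le:
  assumes c: "0 < c" and b: "b \<ge> 2" and big: "block_size c m \<ge> 1"
  shows "real (card (exp_block c b m)) \<le> 3 * block_size c m"
proof -
  define M M' where "M = real (exp_bracket c m)" and "M' = real (exp_bracket c (m + 1))"
  have lnb: "ln (real b) \<ge> 2 / 3" using b by (intro ln_ge_two_thirds) auto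
  have MM: "M' - M \<ge> 1" using big by (simp add: M_def M'_def)
  have nn: "M / ln (real b) \<ge> 0" "M' / ln (real b) \<ge> 0" using lnb by (auto simp: M_def M'_def)
  have "M / ln (real b) \<le> M' / ln (real b)" using MM lnb by (intro divide_right_mono) auto
  then have "real (nat \<lfloor>M' / ln (real b)\<rfloor> - nat \<lfloor>M / ln (real b)\<rfloor>) \<le> M' / ln (real b) - M / ln (real b) + 1"
    using nn by linarith
  also have "M' / ln (real b) - M / ln (real b) = (M' - M) / ln (real b)" by (simp add: diff_divide_distrib)
  also have "\<dots> \<le> (M' - M) / (1 / 2)" using lnb MM by (intro divide_left_mono) auto
  finally show ?thesis using MM by (simp add: br2_def M_def M'_def)
qed

lemma sqrt_half_power_le: "sqrt (1 / 2) ^ (30 * h) \<le> exp (- (10 * real h))"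
proof -
  have "30 * h = 2 * (15 * h)" by simp
  then have "sqrt (1 / 2) ^ (30 * h) = (sqrt (1 / 2) ^ 2) ^ (15 * h)" by (simp only: power_mult)
  also have "\<dots> = (1 / 2) ^ (15 * h)" by simp
  also have "\<dots> = exp (- ln 2) ^ (15 * h)" by (simp add: exp_minus power_one_over inverse_eq_divide)
  also have "\<dots> = exp (real (15 * h) * (- ln 2))" by (rule exp_of_nat_mult[symmetric])
  also have "\<dots> \<le> exp (- (10 * real h))"
  proof -
    have "real h * (2 / 3) \<le> real h * ln 2" using ln2_ge_two_thirds by (intro mult_left_mono) auto
    then show ?thesis by simp
  qed
  finally show ?thesis .
qed

text \<open>
  With \<open>h\<close> close to $\log m$ and $D=30h$ the cosine products save the factor $m^{-9}$ even after multiplication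
  by \<open>s m\<close>. The diagonal terms, the exceptional exponents and \<open>Q\<close> are negligible, because a block has at
  least $\exp((\log m+C)^{14})$ exponents for every constant \<open>C\<close>.
\<close>

lemma minimizer_exp_sums:
  fixes c :: real and r s m0 :: "nat \<Rightarrow> nat" and C :: nat
  assumes c: "0 < c" "c < 1"
    and r: "\<And>k. k \<ge> 1 \<Longrightarrow> 2 \<le> r k \<and> r k \<le> k + 1"
    and s: "\<And>k. k \<ge> 1 \<Longrightarrow> 3 \<le> s k \<and> s k \<le> C * k"
    and ind: "\<And>i m x y. 1 \<le> i \<Longrightarrow> i \<le> m \<Longrightarrow> m0 (r i) \<le> m \<Longrightarrow> r i ^ x = s m ^ y \<Longrightarrow> x = 0"
  shows "\<forall>\<^sub>F m in sequentially. A' (exp_bracket c) r m0 m (xi (exp_bracket c) r s m0 m) \<le> (block_size c m / real m ^ 3)\<^sup>2"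
proof -
  have C: "C \<ge> 3" using s[of 1] by simp
  \<comment> \<open>This constant makes \<open>h m\<close> a bound for the logarithms of \<open>s m\<close>, of \<open>r i\<close> and of \<open>t\<close>, and makes
    \<open>exp (- 10 * h m)\<close> absorb the factor \<open>C\<close> in the bound for \<open>s m\<close>.\<close>
  define C0 where "C0 = ln (real C) + 2"
  have C0: "C0 > 0" using C by (simp add: C0_def add_pos_pos)
  define C1 where "C1 = C0 + 1"
  have C1: "C1 > 0" using C0 by (simp add: C1_def)
  define h where "h m = nat \<lceil>ln (real m) + C0\<rceil>" for m
  have h_at_top: "filterlim h at_top sequentially"
  proof -
    have "filterlim (\<lambda>m. ln (real m) + C0) at_top sequentially" by real_asymp
    then have "filterlim (\<lambda>m. real (h m)) at_top sequentially"
      by (rule filterlim_at_top_mono) (auto simp: h_def real_nat_ceiling_ge intro: always_eventually)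
    then show ?thesis by (simp add: filterlim_sequentially_iff_filterlim_real)
  qed
  have E0: "\<forall>\<^sub>F m in sequentially. \<forall>r s p q :: nat. r \<ge> 2 \<longrightarrow> s \<ge> 2 \<longrightarrow> ln (real r) \<le> real (h m) \<longrightarrow> ln (real s) \<le> real (h m) \<longrightarrow>
     (\<forall>x y. r ^ x = s ^ y \<longrightarrow> x = 0) \<longrightarrow> coprime p q \<longrightarrow> 0 < q \<longrightarrow> real q \<le> exp (real (h m) ^ 3) \<longrightarrow>
     \<bar>real q * ln (real r) - real p * ln (real s)\<bar> \<ge> exp (- (real (h m) ^ 13))"
    by (rule eventually_compose_filterlim[OF linear_form_in_two_logarithms h_at_top])
  have E1: "\<forall>\<^sub>F m in sequentially. exp ((ln (real m) + C1) ^ 14) \<le> block_size c m"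
    by (rule block_size_lower[OF c C1])
  have E2: "\<forall>\<^sub>F m in sequentially. (ln (real m) + C1) * exp ((ln (real m) + C1) ^ 13) + 2 \<le> exp ((ln (real m) + C1) ^ 14)"
    by real_asymp
  have E3: "\<forall>\<^sub>F m in sequentially. 12 * real m ^ 8 * (120 * (ln (real m) + C1)\<^sup>2 + 12 * (ln (real m) + C1) + 13) \<le> exp ((ln (real m) + C1) ^ 14)"
    by real_asymp
  have E4: "\<forall>\<^sub>F m in sequentially. h m \<ge> 60" using h_at_top unfolding filterlim_at_top by blast
  show ?thesis
    using E0 E1 E2 E3 E4 eventually_ge_at_top[of 1056]
  proof eventually_elim
    case (elim m)
    note lf = elim(1) and big = elim(2) and e2 = elim(3) and e3 = elim(4) and h60 = elim(5) and m = elim(6)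
    define H where "H = h m"
    define y where "y = ln (real m) + C1"
    define \<Delta> where "\<Delta> = block_size c m"
    have m1: "m \<ge> 1" "real m \<ge> 1" using m by auto
    have lnm: "ln (real m) \<ge> 0" using m1 by simp
    have H: "ln (real m) + C0 \<le> real H" "real H \<le> y"
    proof -
      show "ln (real m) + C0 \<le> real H" unfolding H_def h_def by (rule real_nat_ceiling_ge)
      show "real H \<le> y" unfolding H_def h_def y_def C1_def using lnm C0 by linarith
    qed
    have y1: "y \<ge> 1" using lnm C0 by (simp add: y_def C1_def)
    have \<Delta>: "exp (y ^ 14) \<le> \<Delta>" using big by (simp add: y_def \<Delta>_def)
    have \<Delta>1: "\<Delta> \<ge> 1" using \<Delta> one_le_exp_iff[of "y ^ 14"] y1 by (smt (verit) zero_le_power)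
    define Q where "Q = nat \<lceil>real H * exp (real H ^ 13)\<rceil> + 1"
    have Q: "real H * exp (real H ^ 13) < real Q"
      unfolding Q_def of_nat_add of_nat_1 using real_nat_ceiling_ge[of "real H * exp (real H ^ 13)"] by linarith
    have Q\<Delta>: "real Q \<le> \<Delta>"
    proof -
      have "0 \<le> real H * exp (real H ^ 13)" by simp
      then have "real Q \<le> real H * exp (real H ^ 13) + 2" unfolding Q_def by linarith
      also have "real H * exp (real H ^ 13) \<le> y * exp (y ^ 13)"
        using H(2) y1 by (intro mult_mono) (auto intro: power_mono)
      also have "y * exp (y ^ 13) + 2 \<le> \<Delta>" using e2 \<Delta> by (simp add: y_def)
      finally show ?thesis by simp
    qed
    define D where "D = 30 * H"
    have D: "D \<ge> 1" "2 * D \<le> H\<^sup>2" using h60 unfolding D_def H_def power2_eq_square by auto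
    have sm: "3 \<le> s m" "s m \<le> C * m" using s[OF m1(1)] by auto
    have lns: "ln (real (s m)) \<le> real H"
    proof -
      have "real (s m) \<le> real (C * m)" using sm(2) by (simp only: of_nat_le_iff)
      then have "real (s m) \<le> real C * real m" by simp
      then have "ln (real (s m)) \<le> ln (real C * real m)" using sm m1 C by (intro ln_mono) auto
      also have "\<dots> = ln (real C) + ln (real m)" using C m1 by (simp add: ln_mult)
      also have "\<dots> \<le> real H" using H(1) by (simp add: C0_def)
      finally show ?thesis .
    qed
    have sk: "real (s m) * sqrt (1 / 2) ^ D \<le> 1 / real m ^ 9"
    proof -
      have "sqrt (1 / 2) ^ D \<le> exp (- (10 * real H))" unfolding D_def by (rule sqrt_half_power_le)
      also have "\<dots> \<le> exp (- (10 * ln (real m) + ln (real C)))"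
      proof -
        have "ln (real C) \<ge> 0" using C by simp
        then show ?thesis using H(1) by (simp add: C0_def)
      qed
      also have "\<dots> = 1 / (real C * real m ^ 10)"
      proof -
        have "exp (10 * ln (real m)) = real m ^ 10" using exp_of_nat_mult[of 10 "ln (real m)"] m1 by simp
        then have "exp (10 * ln (real m) + ln (real C)) = real C * real m ^ 10" using C by (simp add: exp_add)
        then show ?thesis unfolding exp_minus by (simp add: inverse_eq_divide)
      qed
      finally have "real (s m) * sqrt (1 / 2) ^ D \<le> real (C * m) * (1 / (real C * real m ^ 10))"
        using sm(2) by (intro mult_mono) (auto simp flip: of_nat_mult)
      also have "\<dots> = 1 / real m ^ 9" using C m1 by (simp add: field_simps eval_nat_numeral)
      finally show ?thesis .
    qed
    define Z where "Z = 11 * real (s m) * sqrt (1 / 2) ^ D"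
    have Z: "Z \<le> 11 * (1 / real m ^ 9)" "Z \<ge> 0" using sk by (simp_all add: Z_def)
    note Z0 = Z(2)
    define B where "B = 3 * \<Delta> * (120 * y\<^sup>2 + 12 * y + 13) + 264 * \<Delta>\<^sup>2 * (1 / real m ^ 9)"
    have B0: "B \<ge> 0" using \<Delta>1 y1 by (auto simp: B_def intro!: add_nonneg_nonneg mult_nonneg_nonneg)
    have "A' (exp_bracket c) r m0 m (xi (exp_bracket c) r s m0 m) \<le> 2 * real m * real m * B"
    proof (rule A'_xi_le[OF m1(1) _ B0])
      fix t i assume t: "t \<in> {- int m..int m} - {0}" and i: "i \<in> {i\<in>{1..m}. m0 (r i) \<le> m}"
      define J where "J = exp_block c (r i) m"
      have ri: "2 \<le> r i" "r i \<le> m + 1" using r[of i] i by auto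
      have lnr: "ln (real (r i)) \<le> real H"
      proof -
        have "ln (real (r i)) \<le> ln (2 * real m)" using ri m1 by (intro ln_mono) auto
        also have "\<dots> = ln 2 + ln (real m)" using m1 by (simp add: ln_mult)
        also have "\<dots> \<le> real H" 
        proof -
          have "ln (real C) \<ge> 0" using C by simp
          then show ?thesis using H(1) ln_2_less_1 unfolding C0_def by linarith
        qed
        finally show ?thesis .
      qed
      have lnt: "ln \<bar>real_of_int t\<bar> \<le> real H"
      proof -
        have "\<bar>real_of_int t\<bar> \<le> real m" "\<bar>real_of_int t\<bar> > 0" using t by auto
        then have "ln \<bar>real_of_int t\<bar> \<le> ln (real m)" by (intro ln_mono)
        then show ?thesis using H(1) C0 by linarith
      qed
      have L: "real (card J) \<le> 3 * \<Delta>"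
        unfolding J_def \<Delta>_def using c(1) ri(1) \<Delta>1 by (intro card_block_le) (auto simp: \<Delta>_def)
      have "(\<Sum>j\<in>J. \<Sum>j'\<in>J. \<Prod>k\<in>digit_positions (exp_bracket c) s m.
            \<bar>cos (pi * ((real (r i) ^ j * of_int t - real (r i) ^ j' * of_int t) * (1 / real (s m) ^ k)))\<bar>)
          \<le> real (card J) + 2 * (real (card J) * (real (2 * D * H + 6 * H + 6)
            + (real (card J) + real Q) * (11 * real (s m) * sqrt (1 / 2) ^ D)))"
        unfolding J_def br2_def
      proof (rule cos_double_sum[OF sm(1) lns ri(1) D Q])
        fix p q :: nat assume pq: "coprime p q" "0 < q" "real q \<le> exp (real H ^ 3)"
        show "exp (- (real H ^ 13)) \<le> \<bar>real q * ln (real (r i)) - real p * ln (real (s m))\<bar>"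
          unfolding H_def
        proof (rule lf[rule_format])
          show "2 \<le> r i" by (rule ri(1))
          show "2 \<le> s m" using sm(1) by linarith
          show "ln (real (r i)) \<le> real (h m)" using lnr by (simp only: H_def)
          show "ln (real (s m)) \<le> real (h m)" using lns by (simp only: H_def)
          show "real q \<le> exp (real (h m) ^ 3)" using pq(3) by (simp only: H_def)
          fix x y assume "r i ^ x = s m ^ y"
          then show "x = 0" using ind[of i m x y] i by simp
        qed (rule pq(1,2))+
      qed (use t lnt in auto)
      also have "\<dots> \<le> 3 * \<Delta> + 2 * (3 * \<Delta> * ((60 * y\<^sup>2 + 6 * y + 6) + (3 * \<Delta> + \<Delta>) * (11 * (1 / real m ^ 9))))"
        unfolding Z_def[symmetric]
      proof (intro add_mono mult_left_mono mult_mono L Q\<Delta> Z(1))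
        have "real (2 * D * H + 6 * H + 6) = 60 * (real H)\<^sup>2 + 6 * real H + 6"
          by (simp add: D_def power2_eq_square)
        also have "\<dots> \<le> 60 * y\<^sup>2 + 6 * y + 6" using H(2) by (intro add_mono mult_left_mono power_mono) auto
        finally show "real (2 * D * H + 6 * H + 6) \<le> 60 * y\<^sup>2 + 6 * y + 6" .
      qed (use \<Delta>1 Z0 in auto)
      also have "\<dots> = B" by (simp add: B_def power2_eq_square algebra_simps)
      finally show "(\<Sum>j\<in>exp_block c (r i) m.
          \<Sum>j'\<in>exp_block c (r i) m.
          \<Prod>k\<in>digit_positions (exp_bracket c) s m.
            \<bar>cos (pi * ((real (r i) ^ j * of_int t - real (r i) ^ j' * of_int t) * (1 / real (s m) ^ k)))\<bar>) \<le> B"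
        by (simp only: J_def)
    qed
    also have "2 * real m * real m * B \<le> (\<Delta> / real m ^ 3)\<^sup>2"
    proof -
      define P where "P = 120 * y\<^sup>2 + 12 * y + 13"
      have "12 * real m ^ 8 * P \<le> \<Delta>" using e3 \<Delta> unfolding P_def y_def by linarith
      then have "\<Delta> * (12 * real m ^ 8 * P) \<le> \<Delta> * \<Delta>" using \<Delta>1 by (intro mult_left_mono) auto
      then have 1: "12 * real m ^ 8 * P * \<Delta> / real m ^ 6 \<le> \<Delta>\<^sup>2 / real m ^ 6"
        by (intro divide_right_mono) (auto simp: power2_eq_square mult_ac)
      have 2: "1056 * \<Delta>\<^sup>2 / real m ^ 7 \<le> \<Delta>\<^sup>2 / real m ^ 6"
      proof -
        have "1056 * \<Delta>\<^sup>2 \<le> real m * \<Delta>\<^sup>2" using m by (intro mult_right_mono) auto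
        then have "1056 * \<Delta>\<^sup>2 / real m ^ 7 \<le> real m * \<Delta>\<^sup>2 / real m ^ 7" by (intro divide_right_mono) auto
        also have "\<dots> = \<Delta>\<^sup>2 / real m ^ 6" using m1 by (simp add: eval_nat_numeral)
        finally show ?thesis .
      qed
      have "2 * (2 * real m * real m * B) = 12 * real m ^ 8 * P * \<Delta> / real m ^ 6 + 1056 * \<Delta>\<^sup>2 / real m ^ 7"
        using m1 unfolding B_def P_def[symmetric] by (simp add: field_simps eval_nat_numeral)
      then have "2 * real m * real m * B \<le> \<Delta>\<^sup>2 / real m ^ 6" using 1 2 by linarith
      then show ?thesis by (simp add: power_divide flip: power_mult)
    qed
    finally show ?case by (simp add: \<Delta>_def)
  qed
qed

text \<open>
  From some stage on the base \<open>b = r i\<close> takes part in \<open>A'\<close>, so its exponential sums are single summands of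
  the minimum. Replacing the approximation by the limit costs only a polynomial in \<open>m\<close>.
\<close>

lemma limit_exp_sums:
  fixes c \<xi> :: real and r s m0 :: "nat \<Rightarrow> nat" and C b i start :: nat
  assumes c: "0 < c" "c < 1" and b: "b \<ge> 2" and i: "i \<ge> 1" "r i = b"
    and A': "\<forall>\<^sub>F m in sequentially. A' (exp_bracket c) r m0 m (xi (exp_bracket c) r s m0 m) \<le> (block_size c m / real m ^ 3)\<^sup>2"
    and \<xi>: "\<And>m. m \<ge> start \<Longrightarrow> xi (exp_bracket c) r s m0 m \<le> \<xi> \<and>
      \<xi> \<le> xi (exp_bracket c) r s m0 m + 4 * real C * real (m + 1) * exp (- real (exp_bracket c (m + 1)))"
  shows "\<forall>\<^sub>F m in sequentially. \<forall>t\<in>{1..m}.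
    cmod (\<Sum>j\<in>exp_block c b m. e (real b ^ j * real t * \<xi>))
      \<le> 2 * (block_size c m / real m ^ 3)"
proof -
  have E1: "\<forall>\<^sub>F m in sequentially. exp ((ln (real m) + 1) ^ 14) \<le> block_size c m"
    by (rule block_size_lower[OF c]) simp
  have E2: "\<forall>\<^sub>F m in sequentially. 64 * K * real m * real (m + 1) * real m ^ 3 \<le> exp ((ln (real m) + 1) ^ 14)" for K :: real
    by real_asymp
  show ?thesis
    using A' E1 E2[of "real C"] eventually_ge_at_top[of "max 1 (max start (max i (m0 b)))"]
  proof eventually_elim
    case (elim m)
    define \<Delta> where "\<Delta> = block_size c m"
    define J where "J = exp_block c b m"
    define x where "x = xi (exp_bracket c) r s m0 m"
    have m: "m \<ge> 1" "m \<ge> start" "m \<ge> i" "m \<ge> m0 b" using elim(4) by auto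
    have \<Delta>0: "\<Delta> \<ge> 0" using elim(2) exp_ge_zero[of "(ln (real m) + 1) ^ 14"] unfolding \<Delta>_def by linarith
    show ?case
    proof
      fix t assume t: "t \<in> {1..m}"
      have "(cmod (\<Sum>j\<in>J. e (real b ^ j * real t * x)))\<^sup>2 \<le> A' (exp_bracket c) r m0 m x"
      proof -
        define f where "f t i = (cmod (\<Sum>j = br2 (exp_bracket c) m (real (r i)) + 1..br2 (exp_bracket c) (m + 1) (real (r i)).
            e (real (r i) ^ j * of_int t * x)))\<^sup>2" for t i
        have "f (int t) i \<le> (\<Sum>i\<in>{i\<in>{1..m}. m0 (r i) \<le> m}. f (int t) i)"
          by (rule member_le_sum) (use i m in \<open>auto simp: f_def\<close>)
        also have "\<dots> \<le> (\<Sum>t\<in>{- int m..int m} - {0}. \<Sum>i\<in>{i\<in>{1..m}. m0 (r i) \<le> m}. f t i)"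
          by (rule member_le_sum[where f = "\<lambda>t. \<Sum>i\<in>{i\<in>{1..m}. m0 (r i) \<le> m}. f t i"])
             (use t in \<open>auto simp: f_def intro!: sum_nonneg\<close>)
        also have "\<dots> = A' (exp_bracket c) r m0 m x" by (simp only: A'_def f_def)
        finally show ?thesis by (simp add: f_def i(2) J_def)
      qed
      also have "\<dots> \<le> (\<Delta> / real m ^ 3)\<^sup>2" using elim(1) by (simp add: x_def \<Delta>_def)
      finally have 1: "cmod (\<Sum>j\<in>J. e (real b ^ j * real t * x)) \<le> \<Delta> / real m ^ 3"
        by (rule power2_le_imp_le) (use \<Delta>0 in simp)
      have dist: "\<bar>\<xi> - x\<bar> \<le> 4 * real C * real (m + 1) * exp (- real (exp_bracket c (m + 1)))"
        using \<xi>[OF m(2)] unfolding x_def by linarith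
      have "cmod (\<Sum>j\<in>J. e (real b ^ j * real t * \<xi>))
          \<le> cmod (\<Sum>j\<in>J. e (real b ^ j * real t * x)) + 4 * pi * real t * exp (real (exp_bracket c (m + 1))) * \<bar>\<xi> - x\<bar>"
        by (rule exp_sum_perturb[OF b]) (auto simp: J_def br2_def)
      also have "4 * pi * real t * exp (real (exp_bracket c (m + 1))) * \<bar>\<xi> - x\<bar>
          \<le> 4 * 4 * real m * exp (real (exp_bracket c (m + 1))) * (4 * real C * real (m + 1) * exp (- real (exp_bracket c (m + 1))))"
        using t pi_less_4 dist by (intro mult_mono) auto
      also have "\<dots> = 64 * real C * real m * real (m + 1)" by (simp add: exp_minus field_simps)
      also have "\<dots> \<le> \<Delta> / real m ^ 3"
      proof -
        have "64 * real C * real m * real (m + 1) * real m ^ 3 \<le> \<Delta>" using elim(2,3) unfolding \<Delta>_def by linarith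
        then show ?thesis using m by (simp add: pos_le_divide_eq)
      qed
      finally show "cmod (\<Sum>j\<in>exp_block c b m. e (real b ^ j * real t * \<xi>))
          \<le> 2 * (block_size c m / real m ^ 3)"
        using 1 unfolding J_def \<Delta>_def by linarith
    qed
  qed
qed

lemma block_discrepancy:
  fixes c \<xi> :: real and b :: nat
  assumes c: "0 < c" "c < 1" and b: "b \<ge> 2"
    and sums: "\<forall>\<^sub>F m in sequentially. \<forall>t\<in>{1..m}.
    cmod (\<Sum>j\<in>exp_block c b m. e (real b ^ j * real t * \<xi>))
      \<le> 2 * (block_size c m / real m ^ 3)"
  shows "\<forall>\<^sub>F m in sequentially. \<forall>I. is_interval I \<longrightarrow> I \<subseteq> {0..<1} \<longrightarrow>
      \<bar>real (card {j\<in>exp_block c b m. frac (real b ^ j * \<xi>) \<in> I})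
        - real (card (exp_block c b m)) * measure lborel I\<bar>
      \<le> block_size c m * real m powr (c - 1)"
proof -
  have E1: "\<forall>\<^sub>F m in sequentially. exp ((ln (real m) + 1) ^ 14) \<le> block_size c m"
    by (rule block_size_lower[OF c]) simp
  have E2: "\<forall>\<^sub>F m in sequentially. 1 \<le> exp ((ln (real m) + 1) ^ 14)" by real_asymp
  show ?thesis
    using sums E1 E2 log_le_power[OF c(1)] eventually_ge_at_top[of 1]
  proof eventually_elim
    case (elim m)
    define \<Delta> where "\<Delta> = block_size c m"
    define J where "J = exp_block c b m"
    define L where "L = real (card J)"
    define W where "W = (\<Sum>t = 1..m. cmod (\<Sum>j\<in>J. e (real t * (real b ^ j * \<xi>))))"
    define l where "l = 1 + ln (3 * real m)"
    have m: "m > 0" "real m \<ge> 1" using elim(5) by auto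
    have \<Delta>1: "\<Delta> \<ge> 1" using elim(2,3) unfolding \<Delta>_def by linarith
    have L: "L \<le> 3 * \<Delta>" unfolding L_def J_def \<Delta>_def using c(1) b \<Delta>1 by (intro card_block_le) (auto simp: \<Delta>_def)
    have l1: "l \<ge> 1" using m by (simp add: l_def)
    have "W \<le> (\<Sum>t = 1..m. 2 * (\<Delta> / real m ^ 3))"
      unfolding W_def
    proof (intro sum_mono)
      fix t assume "t \<in> {1..m}"
      then have "cmod (\<Sum>j\<in>J. e (real b ^ j * real t * \<xi>)) \<le> 2 * (\<Delta> / real m ^ 3)"
        using elim(1) unfolding J_def \<Delta>_def by blast
      then show "cmod (\<Sum>j\<in>J. e (real t * (real b ^ j * \<xi>))) \<le> 2 * (\<Delta> / real m ^ 3)" by (simp add: mult_ac)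
    qed
    also have "\<dots> = 2 * \<Delta> / real m ^ 2" using m by (simp add: eval_nat_numeral)
    finally have W2: "W \<le> 2 * \<Delta> / real m ^ 2" .
    have "2 * \<Delta> / real m ^ 2 \<le> 2 * \<Delta> / real m ^ 1"
      using m \<Delta>1 by (intro divide_left_mono power_increasing) auto
    then have W1: "W \<le> 2 * \<Delta> / real m" using W2 by simp
    have "2 * \<Delta> / real m \<le> 2 * \<Delta> / 1" using m \<Delta>1 by (intro divide_left_mono) auto
    then have W0: "W \<le> 2 * \<Delta>" using W1 by simp
    have bound: "L / real m + 2 * (W + 24 * l / real m * (L + 2 * W)) \<le> \<Delta> * real m powr (c - 1)"
    proof -
      have "L / real m + 2 * (W + 24 * l / real m * (L + 2 * W))
          \<le> 3 * \<Delta> / real m + 2 * (2 * \<Delta> / real m + 24 * l / real m * (3 * \<Delta> + 2 * (2 * \<Delta>)))"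
        using L W0 W1 l1 m by (intro add_mono mult_left_mono divide_right_mono) auto
      also have "\<dots> = (7 + 336 * l) * \<Delta> / real m" using m by (simp add: field_simps)
      also have "\<dots> \<le> (343 * l) * \<Delta> / real m" using l1 \<Delta>1 by (intro divide_right_mono mult_right_mono) auto
      also have "\<dots> \<le> real m powr c * \<Delta> / real m" using elim(4) \<Delta>1 unfolding l_def by (intro divide_right_mono mult_right_mono) auto
      also have "\<dots> = \<Delta> * real m powr (c - 1)" using m by (simp add: powr_diff)
      finally show ?thesis .
    qed
    show ?case
    proof (intro allI impI)
      fix I :: "real set" assume I: "is_interval I" "I \<subseteq> {0..<1}"
      have "\<bar>real (card {j\<in>J. frac (real b ^ j * \<xi>) \<in> I}) - real (card J) * measure lborel I\<bar>
          \<le> real (card J) / real m + 2 * (W + 24 * l / real m * (real (card J) + 2 * W))"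
        unfolding W_def l_def using discrepancy_exp_sum_bound[OF _ m(1) I, of J "\<lambda>j. real b ^ j * \<xi>"] by (simp add: J_def)
      also have "\<dots> \<le> \<Delta> * real m powr (c - 1)" using bound by (simp only: L_def)
      finally show "\<bar>real (card {j\<in>exp_block c b m. frac (real b ^ j * \<xi>) \<in> I})
        - real (card (exp_block c b m)) * measure lborel I\<bar>
      \<le> block_size c m * real m powr (c - 1)" by (simp only: J_def \<Delta>_def)
    qed
  qed
qed

theorem mainTheorem2:
  fixes A :: real
    and a :: "nat \<Rightarrow> nat \<Rightarrow> real"
    and S :: "nat \<Rightarrow> nat"
    and r s :: "nat \<Rightarrow> nat"
    and m0 :: "nat \<Rightarrow> nat"
  assumes "A > 0"
    and "schmidt_constants a"
    and "\<forall>m\<ge>1. S m > 2 \<and> S m \<le> m * S 1"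
    and "\<forall>b\<ge>2. \<exists>M\<ge>1. \<forall>m\<ge>M. \<not> mult_dependent b (S m)"
    and "\<forall>k\<ge>1. beta a all_bases S k < 1 / 2"
    and "r = (\<lambda>k. all_bases (phi a all_bases S k))"
    and "s = (\<lambda>k. S (phi a all_bases S k))"
    and "\<forall>b\<ge>2. m0 b \<ge> 1 \<and> (\<forall>m\<ge>m0 b. \<not> mult_dependent b (s m))"
  shows "\<exists>c. 0 < c \<and> c < 1 \<and> A = (1 - c) / c \<and>
           (\<exists>\<xi>. xi (exp_bracket c) r s m0 \<longlonglongrightarrow> \<xi> \<and>
                absolutely_normal \<xi> \<and>
                (\<forall>b\<ge>2. (\<lambda>N. discrepancy N (\<lambda>n. frac (real b ^ (n - 1) * \<xi>)))
                          \<in> O(\<lambda>N. ln (ln (real N)) / ln (real N) powr A)))"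
proof -
  define c where "c = 1 / (A + 1)"
  have c: "0 < c" "c < 1" "A = (1 - c) / c" "c * A = 1 - c" using assms(1) by (auto simp: c_def field_simps)
  have a_pos: "\<And>i j. i > 1 \<Longrightarrow> j > 1 \<Longrightarrow> a i j > 0" using assms(2) unfolding schmidt_constants_def by blast
  have S_gt: "\<And>m. m \<ge> 1 \<Longrightarrow> S m > 2" using assms(3) by blast
  have phi: "1 \<le> phi a all_bases S k" "phi a all_bases S k \<le> k" if "k \<ge> 1" for k
    using phi_bounds[of a S k] a_pos S_gt that by blast+
  define C where "C = S 1"
  have r: "2 \<le> r k \<and> r k \<le> k + 1" if "k \<ge> 1" for k
    using phi[OF that] unfolding assms(6) all_bases_def by simp
  have s: "3 \<le> s k \<and> s k \<le> C * k" if k: "k \<ge> 1" for k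
  proof -
    define p where "p = phi a all_bases S k"
    have p: "1 \<le> p" "p \<le> k" using phi[OF k] by (simp_all add: p_def)
    have "S p \<le> p * S 1" "S p > 2" using assms(3) p by auto
    moreover have "p * S 1 \<le> C * k" using p by (simp add: C_def)
    ultimately show ?thesis unfolding assms(7) p_def[symmetric] by simp
  qed
  have ind: "x = 0" if "1 \<le> i" "i \<le> m" "m0 (r i) \<le> m" "r i ^ x = s m ^ y" for i m x y
  proof (rule mult_independent[OF _ _ _ that(4)])
    show "2 \<le> r i" using r that by simp
    then show "\<not> mult_dependent (r i) (s m)" using assms(8) that by blast
    show "2 \<le> s m" using s[of m] that by simp
  qed
  have A': "\<forall>\<^sub>F m in sequentially. A' (exp_bracket c) r m0 m (xi (exp_bracket c) r s m0 m) \<le> (block_size c m / real m ^ 3)\<^sup>2"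
    by (rule minimizer_exp_sums[where C = C, OF c(1,2) r s ind])
  have "\<forall>\<^sub>F m in sequentially. exp ((ln (real m) + 1) ^ 14) \<le> block_size c m"
    by (rule block_size_lower[OF c(1,2)]) simp
  moreover have "\<forall>\<^sub>F m in sequentially. 2 \<le> exp ((ln (real m) + 1) ^ 14)" by real_asymp
  ultimately have "\<forall>\<^sub>F m in sequentially. 2 \<le> block_size c m" by eventually_elim linarith
  then obtain m1 where m1: "\<And>m. m \<ge> m1 \<Longrightarrow> 2 \<le> block_size c m" unfolding eventually_sequentially by auto
  have "exp_bracket c m + 2 \<le> exp_bracket c (Suc m)" if "m \<ge> m1" for m
  proof -
    have "real (exp_bracket c m + 2) \<le> real (exp_bracket c (Suc m))" using m1[OF that] by simp
    then show ?thesis by (simp only: of_nat_le_iff)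
  qed
  then obtain \<xi> where \<xi>: "xi (exp_bracket c) r s m0 \<longlonglongrightarrow> \<xi>"
    "\<forall>m\<ge>m1. xi (exp_bracket c) r s m0 m \<le> \<xi> \<and>
      \<xi> \<le> xi (exp_bracket c) r s m0 m + 4 * real C * real (m + 1) * exp (- real (exp_bracket c (m + 1)))"
    using xi_limit[of s C m1 "exp_bracket c" r m0] s by blast
  have disc: "(\<lambda>N. discrepancy N (\<lambda>n. frac (real b ^ (n - 1) * \<xi>))) \<in> O(\<lambda>N. ln (ln (real N)) / ln (real N) powr A)"
    if b: "b \<ge> 2" for b
  proof -
    obtain i where i: "i \<ge> 1" "phi a all_bases S i = b - 1"
      using phi_surj[of a S "b - 1"] a_pos S_gt b by (metis le_diff_conv2 nat_1_add_1 le_trans one_le_numeral)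
    have ri: "r i = b" using i(2) b by (simp add: assms(6) all_bases_def)
    have "\<forall>\<^sub>F m in sequentially. \<forall>t\<in>{1..m}.
      cmod (\<Sum>j\<in>exp_block c b m. e (real b ^ j * real t * \<xi>))
        \<le> 2 * (block_size c m / real m ^ 3)"
      by (rule limit_exp_sums[where C = C and start = m1, OF c(1,2) b i(1) ri A']) (use \<xi>(2) in blast)
    from block_discrepancy[OF c(1,2) b this] obtain m2 where m2: "\<And>m I. m \<ge> m2 \<Longrightarrow> is_interval I \<Longrightarrow> I \<subseteq> {0..<1} \<Longrightarrow>
      \<bar>real (card {j\<in>exp_block c b m. frac (real b ^ j * \<xi>) \<in> I})
        - real (card (exp_block c b m)) * measure lborel I\<bar>
      \<le> block_size c m * real m powr (c - 1)"
      unfolding eventually_sequentially by blast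
    show ?thesis
      by (rule discrepancy_from_blocks[where start = m2, OF c(1,2) assms(1) c(4) b m2])
  qed
  have "absolutely_normal \<xi>"
    unfolding absolutely_normal_def
  proof (intro allI impI normal_of_discrepancy)
    fix b :: nat assume b: "b \<ge> 2"
    have "(\<lambda>N. ln (ln (real N)) / ln (real N) powr A) \<in> o(\<lambda>_. 1)" using assms(1) by real_asymp
    then have "(\<lambda>N. discrepancy N (\<lambda>n. frac (real b ^ (n - 1) * \<xi>))) \<in> o(\<lambda>_. 1)"
      by (rule landau_o.big_small_trans[OF disc[OF b]])
    from smalloD_tendsto[OF this] show "(\<lambda>N. discrepancy N (\<lambda>n. frac (real b ^ (n - 1) * \<xi>))) \<longlonglongrightarrow> 0"
      by simp
  qed
  then show ?thesis using c \<xi>(1) disc by blast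
qed

end
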